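(* For any $(t,w)\in\mathbb G$ there exists an optimal control for $(t,w)$. In addition, every optimal control for $(t,w)$ admits a Lipschitz representative. Moreover, for every $r>0$ there exists $C(r)>0$ such that for all $t\in I$ and $w\in V(r)$, $\operatorname{Lip}(\alpha)\le C(r)$ for all optimal controls $\alpha$ of $(t,w)$ (identified with their Lipschitz representatives).
   Context: Setting. Let $t_0<T$, $I=[t_0,T]$, $n,m\ge 1$; $A\subset\mathbb R^m$ is nonempty, convex and compact. $\|\cdot\|$ is the Euclidean norm on $\mathbb R^n$; $\|\cdot\|_m$ that on $\mathbb R^m$; $\|\cdot\|_1,\|\cdot\|_\infty$ are the usual $L^1,L^\infty$ norms for functions on $[-\bar\tau,0]$ (with $\bar\tau$ introduced in (7) below). $\operatorname{Lip}(v)$ is the Lipschitz constant of $v$. $\mathbb G:=I\times\operatorname{Lip}([-\bar\tau,0];\mathbb R^n)$. For $t_0\le t<s\le T$, $\mathcal A_{t,s}$ is the set of measurable functions $\alpha:(t,s)\to A$ (controls are considered for initial times $t<T$). For $R>0$: $P(R)=\{w\in\operatorname{Lip}([-\bar\tau,0];\mathbb R^n):\|w\|_\infty\le R\}$, $V(R)=\{w\in P(R):\|\dot w\|_\infty\le R\}$, $B_R=\{x\in\mathbb R^n:\|x\|\le R\}$. $\mathcal X=\{(z,w):w\in\operatorname{Lip}([-\bar\tau,0];\mathbb R^n),\ z=w(0)\}$ with norm $\|(z,w)\|_{\mathcal X}=\|z\|+\|w\|_1$. Standing assumptions. (1) $f:I\times\mathbb R^n\times\mathbb R^n\times A\to\mathbb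 R^n$ and $L:I\times\mathbb R^n\times\mathbb R^n\times A\to\mathbb R$ are continuous. (2) There is $\lambda_f>0$ with $\|f(t,z,y,a)-f(t,z',y',a)\|\le\lambda_f(\|z-z'\|+\|y-y'\|)$ for all arguments, and hence $\|f(t,z,y,a)\|\le C_f(1+\|z\|+\|y\|)$ for some $C_f>0$. (3) For every $(t,z,y)$ the set $\{(f(t,z,y,a),\ell)\in\mathbb R^n\times\mathbb R:a\in A,\ \ell\ge L(t,z,y,a)\}$ is convex. (4) For every $R>0$ there is $\lambda_L(R)>0$ with $|L(t,z,y,a)-L(t,z',y',a)|\le\lambda_L(R)(\|z-z'\|+\|y-y'\|)$ for $t\in I$, $a\in A$, $z,y,z',y'\in B_R$. (5) There is $C_L>0$ with $|L(t,z,y,a)|\le C_L(1+\|z\|+\|y\|)$ for all arguments. (6) $g:\mathcal X\to\mathbb R$ and for every $R>0$ there is $\lambda_g(R)>0$ with $|g(z_1,w_1)-g(z_2,w_2)|\le\lambda_g(R)\|(z_1,w_1)-(z_2,w_2)\|_{\mathcal X}$ for all $(z_i,w_i)\in\mathcal X$ with $w_i\in P(R)$. (7) $\tau:I\times\mathbb R^n\to[0,\infty)$ is $C^1$ with supremum $\bar\tau<\infty$, and there is $\lambda_\tau>0$ with $|\tau(t,z)-\tau(t,y)|\le\lambda_\tau\|z-y\|$ for all $t\in I$, $z,y\in\mathbb R^n$. State equation. For $(t,w)\in\mathbb G$ and $\alpha\in\mathcal A_{t,T}$, $x(\cdot\,|\,t,w,\alpha)$ denotes the unique Lipschitz $x:[t-\bar\tau,T]\to\mathbb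 R^n$ with $\dot x(s)=f(s,x(s),x(s-\tau(s,x(s))),\alpha(s))$ for a.e. $s\in(t,T)$ and $x(t+\theta)=w(\theta)$ for $\theta\in[-\bar\tau,0]$ (it exists and is unique under (1)-(7)). Write $x_s(\theta)=x(s+\theta)$, $\theta\in[-\bar\tau,0]$. (8) (Monotone delay) For every $r>0$ there is $d(r)>0$ such that for every such solution with $t\in I$, $w\in P(r)$, $\alpha\in\mathcal A_{t,T}$: $1-\tau_t(s,x(s))-\tau_z(s,x(s))\cdot\dot x(s)\ge d(r)$ for a.e. $s\in[t,T]$. Cost and value. $J(t,w,\alpha)=\int_t^TL(s,x(s),x(s-\tau(s,x(s))),\alpha(s))\,ds+g(x(T),x_T)$ with $x=x(\cdot\,|\,t,w,\alpha)$, and $\rho(t,w)=\inf_{\alpha\in\mathcal A_{t,T}}J(t,w,\alpha)$. $\alpha\in\mathcal A_{t,T}$ is an optimal control for $(t,w)$ if $J(t,w,\alpha)=\rho(t,w)$. Additional assumptions. With $\mathcal H(t,z,y,p,a)=f(t,z,y,a)\cdot p+L(t,z,y,a)$: (S1) $f,L\in C^1(I\times\mathbb R^n\times\mathbb R^n\times A)$. (S2) There are $\mu,\lambda_{\mathcal H}>0$ with $(\mathcal H_a(t,z,y,p,a_1)-\mathcal H_a(t,z,y,p,a_2))\cdot(a_1-a_2)\ge\mu\|a_1-a_2\|_m^2$ and $\|\mathcal H_a(t_1,z_1,y_1,p_1,a)-\mathcal H_a(t_2,z_2,y_2,p_2,a)\|\le\lambda_{\mathcal H}(|t_1-t_2|+\|z_1-z_2\|+\|y_1-y_2\|+\|p_1-p_2\|)$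 for all $(t,z,y,p),(t_i,z_i,y_i,p_i)\in I\times(\mathbb R^n)^3$, $a,a_1,a_2\in A$. (S3) For every $r>0$ there are $\gamma_f(r),\gamma_L(r)>0$ with $\|f(t,z_1,y_1,a)+f(t,z_2,y_2,a)-2f(t,\frac{z_1+z_2}2,\frac{y_1+y_2}2,a)\|\le\gamma_f(r)(\|z_1-z_2\|^2+\|y_1-y_2\|^2)$ and $|L(t,z_1,y_1,a)+L(t,z_2,y_2,a)-2L(t,\frac{z_1+z_2}2,\frac{y_1+y_2}2,a)|\le\gamma_L(r)(\|z_1-z_2\|^2+\|y_1-y_2\|^2)$ for $t\in I$, $a\in A$, $z_i,y_i\in B_r$. (S4) For every $r>0$ there is $\gamma_\tau(r)>0$ with $|\tau(t,z_1)+\tau(t,z_2)-2\tau(t,\frac{z_1+z_2}2)|\le\gamma_\tau(r)\|z_1-z_2\|^2$ for $t\in I$, $z_1,z_2\in B_r$. (S5) For any $(t,w)\in\mathbb G$, $\alpha\in\mathcal A_{t,T}$ and $x=x(\cdot\,|\,t,w,\alpha)$, $g$ is Fr\'echet differentiable at $(x(T),x_T)$; and for every $r>0$ there is $\gamma_g(r)>0$ with $\|g_w(x(T),x_T)\|_\infty\le\gamma_g(r)$ for all $t\in I$, $w\in V(r)$, $\alpha\in\mathcal A_{t,T}$. Here $g$ is Fr\'echet differentiable at $(z,w)\in\mathcal X$ if there are $g_z(z,w)\in\mathbb R^n$, $g_w(z,w)\in L^\infty([-\bar\tau,0];\mathbb R^n)$ with $g(z+\delta z,w+\delta w)-g(z,w)=g_z(z,w)\cdot\delta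 z+\int_{-\bar\tau}^0g_w(z,w)(\theta)\cdot\delta w(\theta)\,d\theta+o(\|(\delta z,\delta w)\|_{\mathcal X})$ for $(\delta z,\delta w)\in\mathcal X$. *)

theory Defs
  imports "HOL-Analysis.Analysis"
begin

text \<open>
  Functions on an interval are total HOL functions of which only the values on that interval
  matter. Throughout, \<open>b\<close> stands for the maximal delay (the supremum of the delay function),
  so histories live on \<open>{-b..0}\<close>.
\<close>

text \<open>
  Continuous differentiability on a set that need not be open: the derivative is taken within
  the set and is continuous up to the boundary. On the sets used here (convex, with or without
  interior) every restriction of a $C^1$ function on an open neighbourhood has this property.
\<close>

definition C1_on :: "'a::real_normed_vector set \<Rightarrow> ('a \<Rightarrow> 'b::real_normed_vector) \<Rightarrow> bool" where
  "C1_on S F \<longleftrightarrow>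
     (\<exists>F' :: 'a \<Rightarrow> 'a \<Rightarrow>\<^sub>L 'b.
        (\<forall>x\<in>S. (F has_derivative blinfun_apply (F' x)) (at x within S)) \<and> continuous_on S F')"


subsection \<open>History spaces\<close>

definition lip_space :: "real \<Rightarrow> (real \<Rightarrow> real ^ 'n) set" where
  "lip_space b = {w. \<exists>K. K-lipschitz_on {-b..0} w}"

definition G_set :: "real \<Rightarrow> real \<Rightarrow> real \<Rightarrow> (real \<times> (real \<Rightarrow> real ^ 'n)) set" where
  "G_set t0 T b = {t0..T} \<times> lip_space b"

text \<open>
  The sup norm of a Lipschitz function is rendered pointwise, which also gives the intended
  meaning when \<open>b = 0\<close> and the interval is a null set. The bound on the derivative is an
  essential one.
\<close>

definition P_set :: "real \<Rightarrow> real \<Rightarrow> (real \<Rightarrow> real ^ 'n) set" where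
  "P_set b R = {w \<in> lip_space b. \<forall>\<theta>\<in>{-b..0}. norm (w \<theta>) \<le> R}"

definition V_set :: "real \<Rightarrow> real \<Rightarrow> (real \<Rightarrow> real ^ 'n) set" where
  "V_set b R = {w \<in> P_set b R.
     AE \<theta> in lebesgue_on {-b..0}. \<exists>v. (w has_vector_derivative v) (at \<theta>) \<and> norm v \<le> R}"

definition X_space :: "real \<Rightarrow> ((real ^ 'n) \<times> (real \<Rightarrow> real ^ 'n)) set" where
  "X_space b = {(z, w). w \<in> lip_space b \<and> z = w 0}"

definition X_norm :: "real \<Rightarrow> (real ^ 'n) \<times> (real \<Rightarrow> real ^ 'n) \<Rightarrow> real" where
  "X_norm b = (\<lambda>(z, w). norm z + (LINT \<theta>:{-b..0}|lebesgue. norm (w \<theta>)))"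

text \<open>
  \<open>(gz, gw)\<close> is a Frechet derivative of \<open>g\<close> at \<open>(z, w)\<close>; the second component is essentially
  bounded, and the remainder is small in the norm of the space above.
\<close>

definition has_X_gradient ::
  "real \<Rightarrow> ((real ^ 'n) \<times> (real \<Rightarrow> real ^ 'n) \<Rightarrow> real) \<Rightarrow> (real ^ 'n) \<times> (real \<Rightarrow> real ^ 'n)
     \<Rightarrow> real ^ 'n \<Rightarrow> (real \<Rightarrow> real ^ 'n) \<Rightarrow> bool" where
  "has_X_gradient b g zw gz gw \<longleftrightarrow>
     gw \<in> borel_measurable (lebesgue_on {-b..0}) \<and>
     (\<exists>K. AE \<theta> in lebesgue_on {-b..0}. norm (gw \<theta>) \<le> K) \<and>
     (\<forall>\<epsilon>>0. \<exists>\<delta>>0. \<forall>(dz, dw) \<in> X_space b. X_norm b (dz, dw) < \<delta> \<longrightarrow>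
        \<bar>g (fst zw + dz, \<lambda>\<theta>. snd zw \<theta> + dw \<theta>) - g zw
          - (gz \<bullet> dz + (LINT \<theta>:{-b..0}|lebesgue. gw \<theta> \<bullet> dw \<theta>))\<bar>
        \<le> \<epsilon> * X_norm b (dz, dw))"


subsection \<open>Controls and trajectories\<close>

definition controls :: "(real ^ 'm) set \<Rightarrow> real \<Rightarrow> real \<Rightarrow> (real \<Rightarrow> real ^ 'm) set" where
  "controls A t s =
     {\<alpha>. \<alpha> \<in> borel_measurable (lebesgue_on {t<..<s}) \<and> (\<forall>r\<in>{t<..<s}. \<alpha> r \<in> A)}"

definition is_trajectory ::
  "real \<Rightarrow> real \<Rightarrow> (real \<Rightarrow> real ^ 'n \<Rightarrow> real ^ 'n \<Rightarrow> real ^ 'm \<Rightarrow> real ^ 'n)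
     \<Rightarrow> (real \<Rightarrow> real ^ 'n \<Rightarrow> real) \<Rightarrow> real \<Rightarrow> (real \<Rightarrow> real ^ 'n) \<Rightarrow> (real \<Rightarrow> real ^ 'm)
     \<Rightarrow> (real \<Rightarrow> real ^ 'n) \<Rightarrow> bool" where
  "is_trajectory T b f tau t w \<alpha> x \<longleftrightarrow>
     (\<exists>K. K-lipschitz_on {t - b..T} x) \<and>
     (AE s in lebesgue_on {t<..<T}.
        (x has_vector_derivative f s (x s) (x (s - tau s (x s))) (\<alpha> s)) (at s)) \<and>
     (\<forall>\<theta>\<in>{-b..0}. x (t + \<theta>) = w \<theta>)"

text \<open>
  The solution is unique only as a function on \<open>{t - b..T}\<close>; the \<open>extensional\<close> normalisation
  fixes its irrelevant values outside, so that the definite description is meaningful.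
\<close>

definition traj ::
  "real \<Rightarrow> real \<Rightarrow> (real \<Rightarrow> real ^ 'n \<Rightarrow> real ^ 'n \<Rightarrow> real ^ 'm \<Rightarrow> real ^ 'n)
     \<Rightarrow> (real \<Rightarrow> real ^ 'n \<Rightarrow> real) \<Rightarrow> real \<Rightarrow> (real \<Rightarrow> real ^ 'n) \<Rightarrow> (real \<Rightarrow> real ^ 'm)
     \<Rightarrow> real \<Rightarrow> real ^ 'n" where
  "traj T b f tau t w \<alpha> =
     (THE x. x \<in> extensional {t - b..T} \<and> is_trajectory T b f tau t w \<alpha> x)"

definition hist :: "(real \<Rightarrow> real ^ 'n) \<Rightarrow> real \<Rightarrow> real \<Rightarrow> real ^ 'n" where
  "hist x s = (\<lambda>\<theta>. x (s + \<theta>))"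

definition end_state ::
  "real \<Rightarrow> real \<Rightarrow> (real \<Rightarrow> real ^ 'n \<Rightarrow> real ^ 'n \<Rightarrow> real ^ 'm \<Rightarrow> real ^ 'n)
     \<Rightarrow> (real \<Rightarrow> real ^ 'n \<Rightarrow> real) \<Rightarrow> real \<Rightarrow> (real \<Rightarrow> real ^ 'n) \<Rightarrow> (real \<Rightarrow> real ^ 'm)
     \<Rightarrow> (real ^ 'n) \<times> (real \<Rightarrow> real ^ 'n)" where
  "end_state T b f tau t w \<alpha> =
     (traj T b f tau t w \<alpha> T, hist (traj T b f tau t w \<alpha>) T)"


subsection \<open>Cost, value and optimal controls\<close>

definition cost ::
  "real \<Rightarrow> real \<Rightarrow> (real \<Rightarrow> real ^ 'n \<Rightarrow> real ^ 'n \<Rightarrow> real ^ 'm \<Rightarrow> real ^ 'n)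
     \<Rightarrow> (real \<Rightarrow> real ^ 'n \<Rightarrow> real ^ 'n \<Rightarrow> real ^ 'm \<Rightarrow> real)
     \<Rightarrow> ((real ^ 'n) \<times> (real \<Rightarrow> real ^ 'n) \<Rightarrow> real) \<Rightarrow> (real \<Rightarrow> real ^ 'n \<Rightarrow> real)
     \<Rightarrow> real \<Rightarrow> (real \<Rightarrow> real ^ 'n) \<Rightarrow> (real \<Rightarrow> real ^ 'm) \<Rightarrow> real" where
  "cost T b f L g tau t w \<alpha> =
     (let x = traj T b f tau t w \<alpha> in
      (LINT s:{t<..<T}|lebesgue. L s (x s) (x (s - tau s (x s))) (\<alpha> s)) + g (x T, hist x T))"

definition value_fun ::
  "real \<Rightarrow> real \<Rightarrow> (real ^ 'm) set \<Rightarrow> (real \<Rightarrow> real ^ 'n \<Rightarrow> real ^ 'n \<Rightarrow> real ^ 'm \<Rightarrow> real ^ 'n)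
     \<Rightarrow> (real \<Rightarrow> real ^ 'n \<Rightarrow> real ^ 'n \<Rightarrow> real ^ 'm \<Rightarrow> real)
     \<Rightarrow> ((real ^ 'n) \<times> (real \<Rightarrow> real ^ 'n) \<Rightarrow> real) \<Rightarrow> (real \<Rightarrow> real ^ 'n \<Rightarrow> real)
     \<Rightarrow> real \<Rightarrow> (real \<Rightarrow> real ^ 'n) \<Rightarrow> real" where
  "value_fun T b A f L g tau t w = (INF \<alpha>\<in>controls A t T. cost T b f L g tau t w \<alpha>)"

definition optimal_control ::
  "real \<Rightarrow> real \<Rightarrow> (real ^ 'm) set \<Rightarrow> (real \<Rightarrow> real ^ 'n \<Rightarrow> real ^ 'n \<Rightarrow> real ^ 'm \<Rightarrow> real ^ 'n)
     \<Rightarrow> (real \<Rightarrow> real ^ 'n \<Rightarrow> real ^ 'n \<Rightarrow> real ^ 'm \<Rightarrow> real)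
     \<Rightarrow> ((real ^ 'n) \<times> (real \<Rightarrow> real ^ 'n) \<Rightarrow> real) \<Rightarrow> (real \<Rightarrow> real ^ 'n \<Rightarrow> real)
     \<Rightarrow> real \<Rightarrow> (real \<Rightarrow> real ^ 'n) \<Rightarrow> (real \<Rightarrow> real ^ 'm) \<Rightarrow> bool" where
  "optimal_control T b A f L g tau t w \<alpha> \<longleftrightarrow>
     \<alpha> \<in> controls A t T \<and> cost T b f L g tau t w \<alpha> = value_fun T b A f L g tau t w"

definition lipschitz_representative ::
  "(real ^ 'm) set \<Rightarrow> real \<Rightarrow> real \<Rightarrow> (real \<Rightarrow> real ^ 'm) \<Rightarrow> (real \<Rightarrow> real ^ 'm) \<Rightarrow> bool" where
  "lipschitz_representative A t T \<alpha> \<beta> \<longleftrightarrow>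
     \<beta> \<in> controls A t T \<and> (\<exists>K. K-lipschitz_on {t<..<T} \<beta>) \<and>
     (AE s in lebesgue_on {t<..<T}. \<beta> s = \<alpha> s)"

definition hamiltonian ::
  "(real \<Rightarrow> real ^ 'n \<Rightarrow> real ^ 'n \<Rightarrow> real ^ 'm \<Rightarrow> real ^ 'n)
     \<Rightarrow> (real \<Rightarrow> real ^ 'n \<Rightarrow> real ^ 'n \<Rightarrow> real ^ 'm \<Rightarrow> real)
     \<Rightarrow> real \<Rightarrow> real ^ 'n \<Rightarrow> real ^ 'n \<Rightarrow> real ^ 'n \<Rightarrow> real ^ 'm \<Rightarrow> real" where
  "hamiltonian f L t z y p a = f t z y a \<bullet> p + L t z y a"

text \<open>
  \<open>Ha\<close> is the gradient of the Hamiltonian in the control variable. When the control set has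
  empty interior such a gradient is determined only up to a component normal to the set, so it
  is a relation rather than a function of the Hamiltonian; conditions on the gradient are
  imposed on some \<open>Ha\<close> satisfying this relation.
\<close>

definition is_control_gradient ::
  "real set \<Rightarrow> (real ^ 'm) set
     \<Rightarrow> (real \<Rightarrow> real ^ 'n \<Rightarrow> real ^ 'n \<Rightarrow> real ^ 'n \<Rightarrow> real ^ 'm \<Rightarrow> real)
     \<Rightarrow> (real \<Rightarrow> real ^ 'n \<Rightarrow> real ^ 'n \<Rightarrow> real ^ 'n \<Rightarrow> real ^ 'm \<Rightarrow> real ^ 'm) \<Rightarrow> bool" where
  "is_control_gradient I A H Ha \<longleftrightarrow>
     (\<forall>t\<in>I. \<forall>z y p. \<forall>a\<in>A. (H t z y p has_derivative (\<lambda>v. Ha t z y p a \<bullet> v)) (at a within A))"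

end

theory Submission
  imports Defs "HOL-Complex_Analysis.Great_Picard"
begin

text \<open>
  The conditions on the gradient of the Hamiltonian hold uniformly in the costate \<open>p\<close>, in which
  the Hamiltonian is affine. Letting \<open>p\<close> grow, they force \<open>f t z y a = F t z y + G a\<close> with \<open>G\<close>
  affine and Lipschitz on the control set, while \<open>p = 0\<close> gives strong convexity of the
  running cost in the control. No costate is then needed.

  Existence: along a minimizing sequence the states converge uniformly (Arzela--Ascoli). By the
  structure of \<open>f\<close>, the midpoint of two late controls has nearly the same state, and strong
  convexity makes the controls Cauchy in \<open>L\<^sup>2\<close>; a subsequence converges almost everywhere to an
  optimal control.

  Regularity: replace an optimal control on \<open>[p, p + \<eta>]\<close> and \<open>[p + \<delta>, p + \<delta> + \<eta>]\<close>
  by the average of its values at \<open>s\<close> and \<open>s + \<delta>\<close>. The changes of the integral of \<open>G\<close> on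
  the two intervals cancel, so with \<open>I\<close> the integral of \<open>|\<alpha> (s + \<delta>) - \<alpha> s|\<close> over the first
  interval the state moves by \<open>O(I)\<close> between the intervals and by \<open>O(\<delta> I)\<close>
  afterwards; since the delay is monotone, delayed arguments fall between the intervals only for a
  time \<open>O(\<delta>)\<close>. The cost thus grows by at most \<open>O(\<delta> I)\<close>, minus the gain from strong
  convexity, which is a multiple of the integral of \<open>|\<alpha> (s + \<delta>) - \<alpha> s|\<^sup>2\<close>.
  Optimality yields \<open>I = O(\<delta> \<eta>)\<close>, and letting \<open>\<eta>\<close> tend to zero gives the Lipschitz bound.
\<close>

subsection \<open>Lipschitz functions and integrals\<close>

text \<open>Once the control enters additively, it acts on the state only through the primitive of
  \<open>G\<close> along it. Controls with nearby primitives have nearby states, however far apart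
  they are pointwise; and averaging controls averages the primitives exactly, although the equation
  is nonlinear in the state.

  The obstacle to regularity is that a change on a single interval shifts the state by an amount of
  order \<open>I\<close> at all later times. The resulting cost of order \<open>I\<close> is too
  large to be beaten by a quadratic gain at the scale of \<delta>; the second interval serves to
  undo the shift of the primitive.

  Costs are compared one change at a time: the state is changed with the control in the integrand
  frozen, and the control is changed along a frozen state. All constants depend on the history only
  through a bound \<open>R\<close> and a Lipschitz constant \<open>Kw\<close>, and not on the
  initial time, which is the source of the uniform constant on \<open>V_set\<close>.\<close>

lemma AE_lebesgue_on_iff_negligible:
  assumes "S \<in> sets lebesgue"
  shows "(AE x in lebesgue_on S. P x) \<longleftrightarrow> negligible {x \<in> S. \<not> P x}"
proof -
  have "(AE x in lebesgue_on S. P x) \<longleftrightarrow> (AE x in lebesgue. x \<in> S \<longrightarrow> P x)"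
    using assms by (subst AE_restrict_space_iff) auto
  also have "\<dots> \<longleftrightarrow> negligible {x \<in> S. \<not> P x}"
    by (auto simp: completion.AE_iff_null_sets negligible_iff_null_sets
        intro!: arg_cong[where f="\<lambda>X. X \<in> null_sets lebesgue"])
  finally show ?thesis .
qed

text \<open>If \<open>f b < f a\<close>, tilt \<open>f\<close> slightly and pick a level \<open>c\<close> strictly between the end values
  that is not attained on the exceptional null set (whose Lipschitz image is null); the last point
  at which the tilted function is at least \<open>c\<close> has positive derivative, a contradiction.\<close>

lemma lipschitz_AE_deriv_nonneg_imp_le:
  fixes f :: "real \<Rightarrow> real"
  assumes "a \<le> b" and lip: "K-lipschitz_on {a..b} f" and N: "negligible N"
    and deriv: "\<And>x. \<lbrakk>a < x; x < b; x \<notin> N\<rbrakk> \<Longrightarrow> \<exists>D\<ge>0. (f has_real_derivative D) (at x)"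
  shows "f a \<le> f b"
proof (rule ccontr)
  assume "\<not> f a \<le> f b"
  then have lt: "f b < f a" and "a < b" using \<open>a \<le> b\<close> by (auto simp: order.order_iff_strict)
  define \<eta> where "\<eta> = (f a - f b) / (2 * (b - a))"
  have \<eta>: "\<eta> > 0" using lt \<open>a < b\<close> by (simp add: \<eta>_def)
  define h where "h x = f x + \<eta> * (x - a)" for x
  have ha: "h a = f a" by (simp add: h_def)
  have "\<eta> * (b - a) = (f a - f b) / 2" using \<open>a < b\<close> by (simp add: \<eta>_def field_simps)
  then have hb: "h b < h a" using lt by (simp add: h_def)
  have hcont: "continuous_on {a..b} h"
    unfolding h_def by (intro continuous_intros lipschitz_on_continuous_on[OF lip])
  have hlip: "\<bar>h y - h x\<bar> \<le> (K + \<eta>) * \<bar>y - x\<bar>" if "x \<in> {a..b}" "y \<in> {a..b}" for x y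
  proof -
    have "\<bar>f y - f x\<bar> \<le> K * \<bar>y - x\<bar>"
      using lipschitz_on_normD[OF lip that(2,1)] by simp
    moreover have "h y - h x = (f y - f x) + \<eta> * (y - x)"
      by (simp add: h_def algebra_simps)
    moreover have "\<bar>\<eta> * (y - x)\<bar> = \<eta> * \<bar>y - x\<bar>" using \<eta> by (simp add: abs_mult)
    ultimately show ?thesis by (simp add: algebra_simps)
  qed
  have "negligible (h ` (N \<inter> {a..b}))"
  proof (rule negligible_locally_Lipschitz_image)
    show "negligible (N \<inter> {a..b})" using N negligible_subset by blast
    fix x assume x: "x \<in> N \<inter> {a..b}"
    show "\<exists>T B. open T \<and> x \<in> T \<and> (\<forall>y\<in>N \<inter> {a..b} \<inter> T. norm (h y - h x) \<le> B * norm (y - x))"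
      using x hlip by (intro exI[of _ UNIV] exI[of _ "K + \<eta>"]) auto
  qed simp
  moreover have "\<not> negligible {h b<..<h a}"
    using hb open_not_negligible[of "{h b<..<h a}"] by auto
  ultimately obtain c where c: "h b < c" "c < h a" "c \<notin> h ` (N \<inter> {a..b})"
    by (metis greaterThanLessThan_iff negligible_subset subsetI)
  define S where "S = {x \<in> {a..b}. c \<le> h x}"
  have "closed S"
    unfolding S_def
    using continuous_closed_preimage[OF hcont, of "{c..}"] by (auto simp: vimage_def Int_def)
  moreover have "bounded S" by (rule bounded_subset[of "{a..b}"]) (auto simp: S_def)
  ultimately have "compact S" by (simp add: compact_eq_bounded_closed)
  have "a \<in> S" using c \<open>a < b\<close> by (auto simp: S_def)
  then obtain x where x: "x \<in> S" "\<And>y. y \<in> S \<Longrightarrow> y \<le> x"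
    using compact_attains_sup[OF \<open>compact S\<close>] by blast
  have "x < b" using x c by (auto simp: S_def order.order_iff_strict)
  have hx: "h x = c"
  proof (rule ccontr)
    assume "h x \<noteq> c"
    then have gt: "c < h x" using x by (auto simp: S_def)
    have "continuous_on {x..b} h" by (rule continuous_on_subset[OF hcont]) (use x in \<open>auto simp: S_def\<close>)
    then obtain z where "x \<le> z" "z \<le> b" "h z = c"
      using IVT2'[of h b c x] gt c \<open>x < b\<close> by auto
    then have "z \<in> S" using x by (auto simp: S_def)
    then show False using x(2)[of z] \<open>x \<le> z\<close> \<open>h z = c\<close> gt by auto
  qed
  then have "x \<notin> N" "a < x" using c x by (auto simp: S_def order.order_iff_strict)
  then obtain D where D: "D \<ge> 0" "(f has_real_derivative D) (at x)"
    using deriv \<open>x < b\<close> by blast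
  have "(h has_real_derivative D + \<eta>) (at x)"
    unfolding h_def by (auto intro!: derivative_eq_intros D)
  then obtain d where d: "d > 0" "\<And>k. 0 < k \<Longrightarrow> k < d \<Longrightarrow> h x < h (x + k)"
    using DERIV_pos_inc_right[of h "D + \<eta>" x] D \<eta> by auto
  define k where "k = min (d/2) ((b - x)/2)"
  have "0 < k" "k < d" "x + k \<le> b" using d \<open>x < b\<close> by (auto simp: k_def min_def field_simps)
  then have "x + k \<in> S" using d(2)[of k] hx x by (auto simp: S_def)
  then show False using x(2)[of "x + k"] \<open>0 < k\<close> by auto
qed

text \<open>Reduction to the scalar case: with \<open>u\<close> the direction of the total
  increment, \<open>r * s - x s \<bullet> u\<close> has nonnegative derivative almost everywhere.
  The convention \<open>sgn 0 = 0\<close> covers a vanishing increment.\<close>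

lemma lipschitz_AE_deriv_bound_imp_le:
  fixes x :: "real \<Rightarrow> 'a::euclidean_space"
  assumes "a \<le> b" and lip: "K-lipschitz_on {a..b} x" and N: "negligible N" and "0 \<le> r"
    and deriv: "\<And>s. \<lbrakk>a < s; s < b; s \<notin> N\<rbrakk> \<Longrightarrow> \<exists>v. (x has_vector_derivative v) (at s) \<and> norm v \<le> r"
  shows "norm (x b - x a) \<le> r * (b - a)"
proof -
  define u where "u = sgn (x b - x a)"
  have nu: "norm u \<le> 1" by (simp add: u_def norm_sgn)
  define f where "f s = r * s - x s \<bullet> u" for s
  have "(r + K)-lipschitz_on {a..b} f"
  proof (rule lipschitz_onI)
    fix p q assume pq: "p \<in> {a..b}" "q \<in> {a..b}"
    have "\<bar>(x p - x q) \<bullet> u\<bar> \<le> norm (x p - x q)"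
      using Cauchy_Schwarz_ineq2[of "x p - x q" u] nu
      by (meson mult_left_le norm_ge_zero order_trans)
    also have "\<dots> \<le> K * \<bar>p - q\<bar>" using lipschitz_on_normD[OF lip pq] by simp
    finally have "\<bar>(x p - x q) \<bullet> u\<bar> \<le> K * \<bar>p - q\<bar>" .
    moreover have "f p - f q = r * (p - q) - (x p - x q) \<bullet> u"
      by (simp add: f_def algebra_simps)
    moreover have "\<bar>r * (p - q)\<bar> = r * \<bar>p - q\<bar>" using \<open>0 \<le> r\<close> by (simp add: abs_mult)
    ultimately show "dist (f p) (f q) \<le> (r + K) * dist p q"
      by (simp add: dist_real_def algebra_simps)
  qed (use \<open>0 \<le> r\<close> lipschitz_on_nonneg[OF lip] in simp)
  then have "f a \<le> f b"
  proof (rule lipschitz_AE_deriv_nonneg_imp_le[OF \<open>a \<le> b\<close> _ N])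
    fix s assume "a < s" "s < b" "s \<notin> N"
    then obtain v where v: "(x has_vector_derivative v) (at s)" "norm v \<le> r" using deriv by blast
    have "(f has_vector_derivative r - v \<bullet> u) (at s)"
      unfolding f_def
      by (auto intro!: derivative_eq_intros v bounded_linear.has_vector_derivative[OF bounded_linear_inner_left])
    moreover have "v \<bullet> u \<le> r"
      using norm_cauchy_schwarz[of v u] v nu by (meson mult_left_le norm_ge_zero order_trans)
    ultimately show "\<exists>D\<ge>0. (f has_real_derivative D) (at s)"
      by (intro exI[of _ "r - v \<bullet> u"]) (simp add: has_real_derivative_iff_has_vector_derivative)
  qed
  moreover have "(x b - x a) \<bullet> u = norm (x b - x a)"
    by (simp add: u_def sgn_div_norm dot_square_norm power2_eq_square divide_simps)
  ultimately show ?thesis by (simp add: f_def algebra_simps)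
qed

text \<open>The constant \<open>K\<close> only supplies absolute continuity; the almost everywhere
  bound then replaces it by \<open>r\<close>. The case \<open>r = 0\<close> is the uniqueness of
  primitives.\<close>

lemma lipschitz_onI_AE_deriv_bound:
  fixes x :: "real \<Rightarrow> 'a::euclidean_space"
  assumes lip: "K-lipschitz_on {a..b} x" and N: "negligible N" and "0 \<le> r"
    and deriv: "\<And>s. \<lbrakk>a < s; s < b; s \<notin> N\<rbrakk> \<Longrightarrow> \<exists>v. (x has_vector_derivative v) (at s) \<and> norm v \<le> r"
  shows "r-lipschitz_on {a..b} x"
proof (rule lipschitz_on_leI)
  fix p q assume pq: "p \<in> {a..b}" "q \<in> {a..b}" "p \<le> q"
  have "norm (x q - x p) \<le> r * (q - p)"
    using pq
    by (intro lipschitz_AE_deriv_bound_imp_le[OF \<open>p \<le> q\<close> lipschitz_on_subset[OF lip] N \<open>0 \<le> r\<close>] deriv) auto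
  then show "dist (x p) (x q) \<le> r * dist p q"
    using pq by (simp add: dist_norm norm_minus_commute)
qed fact

text \<open>Lebesgue differentiation. \<open>integrable_ccontinuous_explicit\<close> speaks of
  averages to the right of a point; applied to the reflected function it gives the averages to the
  left as well. Extension by zero makes both functions integrable on every interval.\<close>

lemma AE_has_vector_derivative_integral:
  fixes f :: "real \<Rightarrow> 'a::euclidean_space"
  assumes f: "f absolutely_integrable_on {a..b}"
  obtains N where "negligible N"
    "\<And>s. \<lbrakk>a < s; s < b; s \<notin> N\<rbrakk> \<Longrightarrow> ((\<lambda>s. integral {a..s} f) has_vector_derivative f s) (at s)"
proof -
  define f0 where "f0 s = (if s \<in> {a..b} then f s else 0)" for s
  have "f0 absolutely_integrable_on UNIV"
    unfolding f0_def using absolutely_integrable_restrict_UNIV[of "{a..b}" f] f by simp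
  then have f0: "f0 integrable_on {p..q}" for p q
    using set_lebesgue_integral_eq_integral(1) set_integrable_subset[of lebesgue UNIV f0 "{p..q}"] by auto
  define f1 where "f1 s = f0 (- s)" for s
  have f1: "f1 integrable_on {p..q}" for p q
    unfolding f1_def using f0 Henstock_Kurzweil_Integration.integrable_reflect_real[where f = f0 and a = "-q" and b = "-p"] by simp
  obtain N0 where N0: "negligible N0" and D0: "\<And>x e. \<lbrakk>x \<notin> N0; 0 < e\<rbrakk> \<Longrightarrow>
     \<exists>d>0. \<forall>h. 0 < h \<and> h < d \<longrightarrow> norm (integral {x..x + h} f0 /\<^sub>R h - f0 x) < e"
    using integrable_ccontinuous_explicit[of f0] f0 by auto
  obtain N1 where N1: "negligible N1" and D1: "\<And>x e. \<lbrakk>x \<notin> N1; 0 < e\<rbrakk> \<Longrightarrow>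
     \<exists>d>0. \<forall>h. 0 < h \<and> h < d \<longrightarrow> norm (integral {x..x + h} f1 /\<^sub>R h - f1 x) < e"
    using integrable_ccontinuous_explicit[of f1] f1 by auto
  define N where "N = N0 \<union> uminus ` N1"
  have "negligible (uminus ` N1)"
    by (rule negligible_differentiable_image_negligible) (auto intro!: N1 derivative_intros simp: differentiable_on_def)
  then have "negligible N" using N0 by (simp add: N_def)
  moreover have "((\<lambda>s. integral {a..s} f) has_vector_derivative f s) (at s)"
    if s: "a < s" "s < b" "s \<notin> N" for s
  proof -
    have eq: "integral {p..q} f0 = integral {p..q} f" if "a \<le> p" "q \<le> b" for p q
      using that by (intro integral_cong) (auto simp: f0_def)
    have fi: "f integrable_on {a..q}" if "q \<le> b" for q
      using f that by (meson absolutely_integrable_on_def atLeastatMost_subset_iff integrable_on_subinterval order_refl)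
    have "s \<notin> N0" "- s \<notin> N1" using s by (auto simp: N_def image_iff)
    have "\<exists>d>0. \<forall>y. norm (y - s) < d \<longrightarrow>
       norm (integral {a..y} f - integral {a..s} f - (y - s) *\<^sub>R f s) \<le> e * norm (y - s)" if e: "e > 0" for e
    proof -
      obtain d0 where d0: "d0 > 0" "\<And>h. 0 < h \<Longrightarrow> h < d0 \<Longrightarrow> norm (integral {s..s + h} f0 /\<^sub>R h - f0 s) < e"
        using D0[OF \<open>s \<notin> N0\<close> e] by blast
      obtain d1 where d1: "d1 > 0" "\<And>h. 0 < h \<Longrightarrow> h < d1 \<Longrightarrow> norm (integral {-s..-s + h} f1 /\<^sub>R h - f1 (-s)) < e"
        using D1[OF \<open>-s \<notin> N1\<close> e] by blast
      define d where "d = Min {d0, d1, s - a, b - s}"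
      have "d > 0" using d0 d1 s by (simp add: d_def)
      moreover have "norm (integral {a..y} f - integral {a..s} f - (y - s) *\<^sub>R f s) \<le> e * norm (y - s)"
        if "norm (y - s) < d" for y
      proof -
        have y: "\<bar>y - s\<bar> < d0" "\<bar>y - s\<bar> < d1" "a < y" "y < b"
          using that by (auto simp: d_def)
        consider "y = s" | "s < y" | "y < s" by linarith
        then show ?thesis
        proof cases
          case 2
          have "integral {a..y} f - integral {a..s} f = integral {s..y} f0"
            using Henstock_Kurzweil_Integration.integral_combine[where a = a and c = s and b = y and f = f] fi[of y] 2 y s eq[of s y] by (simp add: algebra_simps)
          moreover have "norm (integral {s..y} f0 /\<^sub>R (y - s) - f s) < e"
            using d0(2)[of "y - s"] 2 y s by (simp add: f0_def)
          then have "norm ((y - s) *\<^sub>R (integral {s..y} f0 /\<^sub>R (y - s) - f s)) \<le> (y - s) * e"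
            using 2 by simp
          then have "norm (integral {s..y} f0 - (y - s) *\<^sub>R f s) \<le> (y - s) * e"
            using 2 by (simp add: scaleR_diff_right)
          ultimately show ?thesis using 2 by (simp add: mult.commute)
        next
          case 3
          have "integral {a..s} f - integral {a..y} f = integral {y..s} f0"
            using Henstock_Kurzweil_Integration.integral_combine[where a = a and c = y and b = s and f = f] fi[of s] 3 y s eq[of y s] by (simp add: algebra_simps)
          moreover have "integral {-s..-y} f1 = integral {y..s} f0"
            unfolding f1_def using Henstock_Kurzweil_Integration.integral_reflect_real[where f = f0 and a = y and b = s] by simp
          moreover have "norm (integral {-s..-y} f1 /\<^sub>R (s - y) - f s) < e"
            using d1(2)[of "s - y"] 3 y s by (simp add: f0_def f1_def)
          then have "norm ((s - y) *\<^sub>R (integral {-s..-y} f1 /\<^sub>R (s - y) - f s)) \<le> (s - y) * e"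
            using 3 by simp
          then have "norm (integral {-s..-y} f1 - (s - y) *\<^sub>R f s) \<le> (s - y) * e"
            using 3 by (simp add: scaleR_diff_right)
          moreover have "integral {a..y} f - integral {a..s} f - (y - s) *\<^sub>R f s
            = - ((integral {a..s} f - integral {a..y} f) - (s - y) *\<^sub>R f s)"
            by (simp add: algebra_simps)
          ultimately show ?thesis using 3 by (simp add: mult.commute right_diff_distrib del: minus_diff_eq)
        qed simp
      qed
      ultimately show ?thesis by blast
    qed
    then show ?thesis
      unfolding has_vector_derivative_def has_derivative_at_alt
      by (auto simp: bounded_linear_scaleR_left)
  qed
  ultimately show ?thesis by (rule that)
qed

lemma absolutely_integrable_bounded_measurable:
  fixes f :: "real \<Rightarrow> 'a::euclidean_space"
  assumes "f \<in> borel_measurable (lebesgue_on {a..b})" "\<And>s. s \<in> {a..b} \<Longrightarrow> norm (f s) \<le> B"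
  shows "f absolutely_integrable_on {a..b}"
  by (rule measurable_bounded_by_integrable_imp_absolutely_integrable[where g = "\<lambda>_. B"])
    (use assms in auto)

lemma integral_norm_le_const:
  fixes f :: "real \<Rightarrow> 'a::euclidean_space"
  assumes "f integrable_on {a..b}" "a \<le> b" "\<And>s. s \<in> {a..b} \<Longrightarrow> norm (f s) \<le> B"
  shows "norm (integral {a..b} f) \<le> B * (b - a)"
  using Henstock_Kurzweil_Integration.integral_norm_bound_integral[of f "{a..b}" "\<lambda>_. B"] assms by (auto simp: mult.commute)

lemma lipschitz_on_integral:
  fixes f :: "real \<Rightarrow> 'a::euclidean_space"
  assumes "f integrable_on {a..b}" "\<And>s. s \<in> {a..b} \<Longrightarrow> norm (f s) \<le> B" "0 \<le> B"
  shows "B-lipschitz_on {a..b} (\<lambda>s. integral {a..s} f)"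
proof (rule lipschitz_on_leI)
  fix p q assume pq: "p \<in> {a..b}" "q \<in> {a..b}" "p \<le> q"
  have "f integrable_on {a..q}" "f integrable_on {p..q}"
    using assms(1) pq by (auto intro: integrable_on_subinterval)
  then have "integral {a..q} f - integral {a..p} f = integral {p..q} f"
    using Henstock_Kurzweil_Integration.integral_combine[where a = a and c = p and b = q and f = f] pq by (simp add: algebra_simps)
  moreover have "norm (integral {p..q} f) \<le> B * (q - p)"
    using \<open>f integrable_on {p..q}\<close> pq assms by (intro integral_norm_le_const) auto
  ultimately show "dist (integral {a..p} f) (integral {a..q} f) \<le> B * dist p q"
    using pq by (metis abs_of_nonneg diff_ge_0_iff_ge dist_commute dist_norm dist_real_def)
qed fact

text \<open>The difference of \<open>x\<close> and the primitive of \<open>f\<close> is Lipschitz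
  with derivative zero almost everywhere, hence Lipschitz with constant zero.\<close>

lemma lipschitz_fundamental_theorem:
  fixes x :: "real \<Rightarrow> 'a::euclidean_space"
  assumes "a \<le> s" "s \<le> b" and lip: "K-lipschitz_on {a..b} x" and N: "negligible N"
    and f: "f absolutely_integrable_on {a..b}" and fB: "\<And>s. s \<in> {a..b} \<Longrightarrow> norm (f s) \<le> B"
    and deriv: "\<And>s. \<lbrakk>a < s; s < b; s \<notin> N\<rbrakk> \<Longrightarrow> (x has_vector_derivative f s) (at s)"
  shows "x s - x a = integral {a..s} f"
proof -
  obtain M where M: "negligible M"
    "\<And>s. \<lbrakk>a < s; s < b; s \<notin> M\<rbrakk> \<Longrightarrow> ((\<lambda>s. integral {a..s} f) has_vector_derivative f s) (at s)"
    using AE_has_vector_derivative_integral[OF f] by blast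
  have "0 \<le> B" using fB[of s] assms(1,2) by (meson atLeastAtMost_iff norm_ge_zero order_trans)
  then have "B-lipschitz_on {a..b} (\<lambda>s. integral {a..s} f)"
    using f fB by (intro lipschitz_on_integral) (auto simp: absolutely_integrable_on_def)
  then have "(K + B)-lipschitz_on {a..b} (\<lambda>s. x s - integral {a..s} f)"
    using lip by (intro lipschitz_intros)
  then have "0-lipschitz_on {a..b} (\<lambda>s. x s - integral {a..s} f)"
  proof (rule lipschitz_onI_AE_deriv_bound)
    show "negligible (N \<union> M)" using N M by simp
    fix s assume s: "a < s" "s < b" "s \<notin> N \<union> M"
    then show "\<exists>v. ((\<lambda>s. x s - integral {a..s} f) has_vector_derivative v) (at s) \<and> norm v \<le> 0"
      using has_vector_derivative_diff[OF deriv[of s] M(2)[of s]] by auto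
  qed simp
  from lipschitz_onD[OF this, of s a] show ?thesis using assms(1,2) by (simp add: algebra_simps)
qed

text \<open>Testing the hypothesis with the least exponential \<open>\<Phi> \<sigma> = K * exp (2 * C * (\<sigma> - a))\<close> above \<open>v\<close>
  gives \<open>v \<le> B + \<Phi> / 2\<close>. Bounds by monotone majorants absorb delayed arguments.\<close>

lemma gronwall_monotone_majorant:
  fixes v :: "real \<Rightarrow> real"
  assumes cont: "continuous_on {a..c} v" and "0 < C" "0 \<le> B" and s: "s \<in> {a..c}"
    and bound: "\<And>s \<Phi>. \<lbrakk>s \<in> {a..c}; continuous_on {a..s} \<Phi>; mono_on {a..s} \<Phi>;
        \<And>\<sigma>. \<sigma> \<in> {a..s} \<Longrightarrow> 0 \<le> \<Phi> \<sigma>; \<And>\<sigma>. \<sigma> \<in> {a..s} \<Longrightarrow> v \<sigma> \<le> \<Phi> \<sigma>\<rbrakk>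
        \<Longrightarrow> v s \<le> B + C * integral {a..s} \<Phi>"
  shows "v s \<le> 2 * B * exp (2 * C * (s - a))"
proof -
  define E where "E \<sigma> = exp (2 * C * (\<sigma> - a))" for \<sigma>
  have E: "E \<sigma> > 0" for \<sigma> by (simp add: E_def)
  have E1: "E \<sigma> \<ge> 1" if "a \<le> \<sigma>" for \<sigma> using that \<open>0 < C\<close> by (simp add: E_def)
  have "continuous_on {a..c} (\<lambda>\<sigma>. v \<sigma> / E \<sigma>)"
    unfolding E_def by (intro continuous_intros cont) auto
  then obtain z where z: "z \<in> {a..c}" "\<And>\<sigma>. \<sigma> \<in> {a..c} \<Longrightarrow> v \<sigma> / E \<sigma> \<le> v z / E z"
    using continuous_attains_sup[of "{a..c}" "\<lambda>\<sigma>. v \<sigma> / E \<sigma>"] s by auto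
  define K where "K = v z / E z"
  have vK: "v \<sigma> \<le> K * E \<sigma>" if "\<sigma> \<in> {a..c}" for \<sigma>
    using z(2)[OF that] E[of \<sigma>] by (simp add: K_def pos_divide_le_eq)
  have "K \<le> 2 * B"
  proof (cases "K \<le> 0")
    case True then show ?thesis using \<open>0 \<le> B\<close> by simp
  next
    case False
    then have "K > 0" by simp
    have "((\<lambda>\<sigma>. K * E \<sigma>) has_integral K * E z / (2 * C) - K * E a / (2 * C)) {a..z}"
      using z \<open>0 < C\<close>
      by (intro fundamental_theorem_of_calculus)
        (auto simp: E_def has_real_derivative_iff_has_vector_derivative[symmetric] intro!: derivative_eq_intros)
    from integral_unique[OF this] have int: "C * integral {a..z} (\<lambda>\<sigma>. K * E \<sigma>) = K * E z / 2 - K * E a / 2"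
      using \<open>0 < C\<close> by (simp add: field_simps del: integral_mult_right)
    have "v z \<le> B + C * integral {a..z} (\<lambda>\<sigma>. K * E \<sigma>)"
    proof (rule bound)
      show "continuous_on {a..z} (\<lambda>\<sigma>. K * E \<sigma>)" unfolding E_def by (intro continuous_intros)
      show "mono_on {a..z} (\<lambda>\<sigma>. K * E \<sigma>)"
        using \<open>K > 0\<close> \<open>0 < C\<close> by (intro mono_onI) (auto simp: E_def)
    qed (use vK z \<open>K > 0\<close> E[THEN less_imp_le] in auto)
    also have "\<dots> \<le> B + K * E z / 2" using int \<open>K > 0\<close> E[of a] by simp
    \<comment> \<open>At the maximizing point \<open>v z = K * E z\<close>, so the integral term is
      at most half of the left-hand side and is absorbed.\<close>
    finally have "v z \<le> 2 * B" using E[of z] by (simp add: K_def)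
    also have "2 * B \<le> 2 * B * E z" using \<open>0 \<le> B\<close> E1[of z] z by (simp add: mult_le_cancel_left1)
    finally show "K \<le> 2 * B" using E[of z] by (simp add: K_def pos_divide_le_eq)
  qed
  then have "K * E s \<le> 2 * B * E s" using E[of s] by (intro mult_right_mono) auto
  then show ?thesis using vK[OF s] unfolding E_def by linarith
qed

subsection \<open>Equations with state-dependent delay\<close>

lemma integral_exp_shift:
  fixes k t s c :: real
  assumes "t \<le> s"
  shows "integral {t..s} (\<lambda>\<sigma>. c * k * exp (k * (\<sigma> - t))) = c * (exp (k * (s - t)) - 1)"
proof -
  have "((\<lambda>\<sigma>. c * k * exp (k * (\<sigma> - t))) has_integral
      c * exp (k * (s - t)) - c * exp (k * (t - t))) {t..s}"
    using assms
    by (intro fundamental_theorem_of_calculus)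
      (auto simp: has_real_derivative_iff_has_vector_derivative[symmetric] intro!: derivative_eq_intros)
  moreover have "c * exp (k * (s - t)) - c * exp (k * (t - t)) = c * (exp (k * (s - t)) - 1)"
    by (simp add: right_diff_distrib)
  ultimately show ?thesis by (metis integral_unique)
qed

text \<open>The control is represented by a forcing \<open>u\<close> added to the drift
  \<open>F\<close>, so that the solution theory needs only integrability and a bound of
  \<open>u\<close>. The Hamiltonian conditions later supply this splitting.\<close>

locale delay_dynamics =
  fixes t0 T b lF cF ltau :: real
    and F :: "real \<Rightarrow> 'a::euclidean_space \<Rightarrow> 'a \<Rightarrow> 'a"
    and tau :: "real \<Rightarrow> 'a \<Rightarrow> real"
  assumes t0_less_T: "t0 < T"
    and F_cont: "continuous_on ({t0..T} \<times> UNIV \<times> UNIV) (\<lambda>(t, z, y). F t z y)"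
    and lF_pos: "0 < lF"
    and F_lip: "t \<in> {t0..T} \<Longrightarrow> norm (F t z y - F t z' y') \<le> lF * (norm (z - z') + norm (y - y'))"
    and F_zero: "t \<in> {t0..T} \<Longrightarrow> norm (F t 0 0) \<le> cF"
    and tau_nonneg: "t \<in> {t0..T} \<Longrightarrow> 0 \<le> tau t z"
    and tau_le: "t \<in> {t0..T} \<Longrightarrow> tau t z \<le> b"
    and tau_cont: "continuous_on ({t0..T} \<times> UNIV) (\<lambda>(t, z). tau t z)"
    and ltau_pos: "0 < ltau"
    and tau_lip: "t \<in> {t0..T} \<Longrightarrow> \<bar>tau t z - tau t y\<bar> \<le> ltau * norm (z - y)"
begin

definition delayed :: "(real \<Rightarrow> 'a) \<Rightarrow> real \<Rightarrow> real" where
  "delayed x s = s - tau s (x s)"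

definition rate :: "(real \<Rightarrow> 'a) \<Rightarrow> real \<Rightarrow> 'a" where
  "rate x s = F s (x s) (x (delayed x s))"

text \<open>Integral form: the forcing appears only through its primitive, the quantity in which
  stability is measured.\<close>

definition sol :: "real \<Rightarrow> (real \<Rightarrow> 'a) \<Rightarrow> (real \<Rightarrow> 'a) \<Rightarrow> (real \<Rightarrow> 'a) \<Rightarrow> bool" where
  "sol t w u x \<longleftrightarrow> (\<exists>K. K-lipschitz_on {t - b..T} x) \<and> (\<forall>\<theta>\<in>{-b..0}. x (t + \<theta>) = w \<theta>) \<and>
     (\<forall>s\<in>{t..T}. x s = w 0 + integral {t..s} (rate x) + integral {t..s} u)"

lemma b_nonneg: "0 \<le> b"
  using tau_nonneg[of t0 undefined] tau_le[of t0 undefined] t0_less_T by simp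

lemma delayed_bounds: "s - b \<le> delayed x s" "delayed x s \<le> s" if "s \<in> {t0..T}"
  using tau_nonneg[OF that] tau_le[OF that] by (auto simp: delayed_def)

lemma delayed_cont:
  assumes "t0 \<le> t" "continuous_on {t..T} x"
  shows "continuous_on {t..T} (delayed x)"
proof -
  have "continuous_on {t..T} (\<lambda>s. (\<lambda>(t, z). tau t z) (s, x s))"
    by (rule continuous_on_compose2[OF tau_cont]) (use assms in \<open>auto intro!: continuous_intros\<close>)
  then show ?thesis unfolding delayed_def by (auto intro!: continuous_intros)
qed

lemma delayed_value_cont:
  assumes t: "t0 \<le> t" and x: "continuous_on {t - b..T} x"
  shows "continuous_on {t..T} (\<lambda>s. x (delayed x s))"
proof (rule continuous_on_compose2[OF x delayed_cont[OF t]])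
  show "continuous_on {t..T} x" by (rule continuous_on_subset[OF x]) (use b_nonneg in auto)
  show "delayed x ` {t..T} \<subseteq> {t - b..T}"
  proof safe
    fix s assume "s \<in> {t..T}"
    then show "delayed x s \<in> {t - b..T}" using delayed_bounds[of s x] t by auto
  qed
qed

lemma rate_cont:
  assumes t: "t0 \<le> t" and x: "continuous_on {t - b..T} x"
  shows "continuous_on {t..T} (rate x)"
proof -
  have "continuous_on {t..T} x" by (rule continuous_on_subset[OF x]) (use b_nonneg in auto)
  then have "continuous_on {t..T} (\<lambda>s. (\<lambda>(t, z, y). F t z y) (s, x s, x (delayed x s)))"
    by (intro continuous_on_compose2[OF F_cont] continuous_intros delayed_value_cont[OF t x])
      (use t in auto)
  then show ?thesis unfolding rate_def by simp
qed

lemma rate_integrable: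
  assumes "t0 \<le> t" "continuous_on {t - b..T} x" "t \<le> p" "q \<le> T"
  shows "rate x integrable_on {p..q}"
  by (rule integrable_continuous_real, rule continuous_on_subset[OF rate_cont[OF assms(1,2)]])
    (use assms in auto)

lemma delayed_lipschitz:
  assumes t: "t0 \<le> t" and x: "K-lipschitz_on {t..T} x" and bound: "\<And>s. s \<in> {t..T} \<Longrightarrow> norm (x s) \<le> R" and "0 \<le> k"
    and time: "\<And>s s' z. \<lbrakk>s \<in> {t0..T}; s' \<in> {t0..T}; norm z \<le> R\<rbrakk> \<Longrightarrow> \<bar>tau s z - tau s' z\<bar> \<le> k * \<bar>s - s'\<bar>"
  shows "(1 + k + ltau * K)-lipschitz_on {t..T} (delayed x)"
proof (rule lipschitz_onI)
  fix s s' assume s: "s \<in> {t..T}" "s' \<in> {t..T}"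
  then have s0: "s \<in> {t0..T}" "s' \<in> {t0..T}" using t by auto
  have "ltau * norm (x s - x s') \<le> ltau * (K * \<bar>s - s'\<bar>)"
    using lipschitz_on_normD[OF x s] ltau_pos by (intro mult_left_mono) auto
  then have "\<bar>tau s' (x s) - tau s' (x s')\<bar> \<le> ltau * (K * \<bar>s - s'\<bar>)"
    using tau_lip[OF s0(2), of "x s" "x s'"] by linarith
  moreover have "\<bar>tau s (x s) - tau s' (x s)\<bar> \<le> k * \<bar>s - s'\<bar>" by (rule time[OF s0 bound[OF s(1)]])
  ultimately have "\<bar>delayed x s - delayed x s'\<bar> \<le> \<bar>s - s'\<bar> + k * \<bar>s - s'\<bar> + ltau * (K * \<bar>s - s'\<bar>)"
    unfolding delayed_def by linarith
  then show "dist (delayed x s) (delayed x s') \<le> (1 + k + ltau * K) * dist s s'"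
    by (simp add: dist_real_def algebra_simps)
next
  show "0 \<le> 1 + k + ltau * K" using \<open>0 \<le> k\<close> ltau_pos lipschitz_on_nonneg[OF x] by simp
qed

lemma delayed_diff:
  assumes "s \<in> {t0..T}" shows "\<bar>delayed x s - delayed y s\<bar> \<le> ltau * norm (x s - y s)"
  using tau_lip[OF assms, of "x s" "y s"] by (simp add: delayed_def abs_minus_commute)

text \<open>The intermediate value \<open>y (delayed x s)\<close> separates two functions at one
  time from one function at two times. Only \<open>y\<close> needs a known Lipschitz
  constant.\<close>

lemma delayed_value_diff:
  assumes t: "t0 \<le> t" and s: "s \<in> {t..T}" and lip: "K-lipschitz_on {t - b..T} y"
  shows "norm (x (delayed x s) - y (delayed y s))
    \<le> norm (x (delayed x s) - y (delayed x s)) + K * ltau * norm (x s - y s)"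
proof -
  have "s \<in> {t0..T}" using s t by simp
  then have "delayed x s \<in> {t - b..T}" "delayed y s \<in> {t - b..T}"
    using delayed_bounds[of s x] delayed_bounds[of s y] s by auto
  then have "norm (y (delayed x s) - y (delayed y s)) \<le> K * \<bar>delayed x s - delayed y s\<bar>"
    using lipschitz_on_normD[OF lip] by auto
  also have "\<dots> \<le> K * (ltau * norm (x s - y s))"
    by (intro mult_left_mono delayed_diff lipschitz_on_nonneg[OF lip]) fact
  finally show ?thesis
    using norm_triangle_ineq[of "x (delayed x s) - y (delayed x s)" "y (delayed x s) - y (delayed y s)"]
    by simp
qed

lemma rate_diff:
  assumes t: "t0 \<le> t" and s: "s \<in> {t..T}" and lip: "K-lipschitz_on {t - b..T} y"
  shows "norm (rate x s - rate y s)
    \<le> lF * (1 + K * ltau) * norm (x s - y s) + lF * norm (x (delayed x s) - y (delayed x s))"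
proof -
  have "norm (rate x s - rate y s)
      \<le> lF * (norm (x s - y s) + norm (x (delayed x s) - y (delayed y s)))"
    unfolding rate_def using s t by (intro F_lip) auto
  also have "\<dots> \<le> lF * (norm (x s - y s) + (norm (x (delayed x s) - y (delayed x s))
      + K * ltau * norm (x s - y s)))"
    by (intro mult_left_mono add_left_mono delayed_value_diff[OF t s lip]) (use lF_pos in auto)
  finally show ?thesis by (simp add: algebra_simps)
qed

lemma rate_bound:
  assumes "s \<in> {t0..T}"
  shows "norm (rate x s) \<le> cF + lF * (norm (x s) + norm (x (delayed x s)))"
proof -
  have "norm (rate x s) \<le> norm (F s 0 0) + norm (rate x s - F s 0 0)"
    by (metis add.commute norm_triangle_sub)
  also have "norm (rate x s - F s 0 0) \<le> lF * (norm (x s) + norm (x (delayed x s)))"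
    using F_lip[OF assms, of "x s" "x (delayed x s)" 0 0] by (simp add: rate_def)
  finally show ?thesis using F_zero[OF assms] by simp
qed

text \<open>Lipschitz constant of \<open>x \<mapsto> rate x\<close> in the sup norm over the past,
  when one of the two functions is \<open>K\<close>-Lipschitz: \<open>lF * (1 + K * ltau)\<close>
  from the present state and the shifted delay, \<open>lF\<close> from the delayed value.\<close>

definition stab_rate :: "real \<Rightarrow> real" where "stab_rate K = lF * (2 + K * ltau)"

text \<open>The factors 2 are those of \<open>gronwall_monotone_majorant\<close>; the full horizon
  \<open>T - t0\<close> makes the constant independent of the initial time.\<close>

definition stab_const :: "real \<Rightarrow> real" where "stab_const K = 2 * exp (2 * stab_rate K * (T - t0))"

lemma stab_rate_pos: "0 \<le> K \<Longrightarrow> 0 < stab_rate K"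
  unfolding stab_rate_def using lF_pos ltau_pos by (intro mult_pos_pos) (auto intro: add_pos_nonneg)

lemma stab_const_pos: "0 < stab_const K"
  by (simp add: stab_const_def)

lemma rate_diff_majorant:
  assumes t: "t0 \<le> t" and s: "s \<in> {t..T}" and lip: "K-lipschitz_on {t - b..T} y"
    and "norm (x s - y s) \<le> m" "norm (x (delayed x s) - y (delayed x s)) \<le> m"
  shows "norm (rate x s - rate y s) \<le> stab_rate K * m"
proof -
  have K: "0 \<le> lF * (1 + K * ltau)"
    using lF_pos ltau_pos lipschitz_on_nonneg[OF lip] by simp
  have "norm (rate x s - rate y s)
      \<le> lF * (1 + K * ltau) * norm (x s - y s) + lF * norm (x (delayed x s) - y (delayed x s))"
    by (rule rate_diff[OF t s lip])
  also have "\<dots> \<le> lF * (1 + K * ltau) * m + lF * m"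
    by (intro add_mono mult_left_mono assms) (use lF_pos K in auto)
  finally show ?thesis by (simp add: stab_rate_def algebra_simps)
qed

lemma sol_cont: "sol t w u x \<Longrightarrow> continuous_on {t - b..T} x"
  by (auto simp: sol_def intro: lipschitz_on_continuous_on)

lemma sol_hist:
  assumes "sol t w u x" "s \<in> {t - b..t}" shows "x s = w (s - t)"
  using assms unfolding sol_def by (metis atLeastAtMost_iff add.commute diff_add_cancel diff_le_0_iff_le le_diff_eq uminus_add_conv_diff)

text \<open>Forcings are compared through their primitives, so changes of a control with cancelling
  integrals count as small. The majorant in the Gronwall argument is monotone, hence its value at
  \<sigma> also bounds the difference at the earlier delayed time. An end \<open>S\<close> before
  \<open>T\<close> expresses causality.\<close>

lemma stability:
  assumes t: "t0 \<le> t" "S \<le> T"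
    and x: "sol t w u x" and y: "sol t w v y" and lip: "K-lipschitz_on {t - b..T} y"
    and E: "0 \<le> E" "\<And>s. s \<in> {t..S} \<Longrightarrow> norm (integral {t..s} u - integral {t..s} v) \<le> E"
    and s: "s \<in> {t - b..S}"
  shows "norm (x s - y s) \<le> stab_const K * E"
proof (cases "s \<le> t")
  case True
  then have "x s = y s" using sol_hist[OF x] sol_hist[OF y] s by simp
  then show ?thesis using stab_const_pos[of K] E by simp
next
  case False
  then have s: "s \<in> {t..S}" using s by simp
  have K: "0 \<le> K" by (rule lipschitz_on_nonneg[OF lip])
  have cx: "continuous_on {t - b..T} x" and cy: "continuous_on {t - b..T} y"
    using sol_cont x y by auto
  have "norm (x s - y s) \<le> 2 * E * exp (2 * stab_rate K * (s - t))"
  proof (rule gronwall_monotone_majorant[OF _ stab_rate_pos[OF K] \<open>0 \<le> E\<close> s])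
    have "continuous_on {t..S} x" "continuous_on {t..S} y"
      using b_nonneg \<open>S \<le> T\<close> by (auto intro: continuous_on_subset[OF cx] continuous_on_subset[OF cy])
    then show "continuous_on {t..S} (\<lambda>s. norm (x s - y s))" by (intro continuous_intros)
  next
    fix s \<Phi> assume s: "s \<in> {t..S}" and \<Phi>: "continuous_on {t..s} \<Phi>" "mono_on {t..s} \<Phi>"
      "\<And>\<sigma>. \<sigma> \<in> {t..s} \<Longrightarrow> 0 \<le> \<Phi> \<sigma>" "\<And>\<sigma>. \<sigma> \<in> {t..s} \<Longrightarrow> norm (x \<sigma> - y \<sigma>) \<le> \<Phi> \<sigma>"
    have sT: "s \<in> {t..T}" using s \<open>S \<le> T\<close> by simp
    have int: "rate x integrable_on {t..s}" "rate y integrable_on {t..s}"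
      using sT by (auto intro!: rate_integrable[OF t(1) cx] rate_integrable[OF t(1) cy])
    have "norm (integral {t..s} (\<lambda>\<sigma>. rate x \<sigma> - rate y \<sigma>)) \<le> integral {t..s} (\<lambda>\<sigma>. stab_rate K * \<Phi> \<sigma>)"
    proof (rule Henstock_Kurzweil_Integration.integral_norm_bound_integral)
      show "(\<lambda>\<sigma>. rate x \<sigma> - rate y \<sigma>) integrable_on {t..s}"
        using int by (rule integrable_diff)
      show "(\<lambda>\<sigma>. stab_rate K * \<Phi> \<sigma>) integrable_on {t..s}"
        by (intro integrable_continuous_real continuous_intros \<Phi>)
      fix \<sigma> assume \<sigma>: "\<sigma> \<in> {t..s}"
      then have \<sigma>': "\<sigma> \<in> {t..T}" "\<sigma> \<in> {t0..T}" using sT t by auto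
      show "norm (rate x \<sigma> - rate y \<sigma>) \<le> stab_rate K * \<Phi> \<sigma>"
      proof (rule rate_diff_majorant[OF t(1) \<sigma>'(1) lip])
        show "norm (x \<sigma> - y \<sigma>) \<le> \<Phi> \<sigma>" by (rule \<Phi>(4)[OF \<sigma>])
      next
        let ?d = "delayed x \<sigma>"
        show "norm (x ?d - y ?d) \<le> \<Phi> \<sigma>"
        proof (cases "?d \<le> t")
          case True
          then have "x ?d = y ?d"
            using sol_hist[OF x, of ?d] sol_hist[OF y, of ?d] delayed_bounds[OF \<sigma>'(2), of x] \<sigma> by simp
          then show ?thesis using \<Phi>(3)[OF \<sigma>] by simp
        next
          case False
          then have d: "?d \<in> {t..s}" "?d \<le> \<sigma>" using delayed_bounds[OF \<sigma>'(2), of x] \<sigma> by auto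
          show ?thesis using \<Phi>(4)[OF d(1)] mono_onD[OF \<Phi>(2) d(1) \<sigma> d(2)] by simp
        qed
      qed
    qed
    moreover have "x s - y s = integral {t..s} (\<lambda>\<sigma>. rate x \<sigma> - rate y \<sigma>)
        + (integral {t..s} u - integral {t..s} v)"
      using x y sT int by (simp add: sol_def Henstock_Kurzweil_Integration.integral_diff)
    ultimately show "norm (x s - y s) \<le> E + stab_rate K * integral {t..s} \<Phi>"
      using E(2)[OF s] norm_triangle_ineq[of "integral {t..s} (\<lambda>\<sigma>. rate x \<sigma> - rate y \<sigma>)"
          "integral {t..s} u - integral {t..s} v"] by simp
  qed
  also have "\<dots> \<le> 2 * E * exp (2 * stab_rate K * (T - t0))"
    using s t E stab_rate_pos[OF K] by (intro mult_left_mono) auto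
  finally show ?thesis by (simp add: stab_const_def mult_ac)
qed

lemma sol_unique:
  assumes "t0 \<le> t" "sol t w u x" "sol t w u y" "s \<in> {t - b..T}"
  shows "x s = y s"
proof -
  obtain K where "K-lipschitz_on {t - b..T} y" using assms(3) by (auto simp: sol_def)
  from stability[OF assms(1) order_refl assms(2,3) this, of 0 s] assms(4) show ?thesis by simp
qed

section \<open>Existence of solutions and a priori bounds by Picard iteration\<close>

definition growth_rate :: "real \<Rightarrow> real" where "growth_rate cu = max lF (cF + cu)"

text \<open>Since \<open>R + 1\<close> is at least 1, the constants \<open>cF + cu\<close> are
  absorbed into the growing envelope. They, the present state and the delayed state each contribute
  \<open>growth_rate cu\<close> times the envelope to the speed, whence the factor 3.\<close>

definition sol_bound :: "real \<Rightarrow> real \<Rightarrow> real" where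
  "sol_bound cu R = (R + 1) * exp (3 * growth_rate cu * (T - t0))"

definition sol_lip :: "real \<Rightarrow> real \<Rightarrow> real \<Rightarrow> real" where
  "sol_lip cu R Kw = max Kw (3 * growth_rate cu * sol_bound cu R)"

context
  fixes t R Kw cu :: real and w u :: "real \<Rightarrow> 'a"
  assumes t: "t \<in> {t0..T}" and R: "0 \<le> R"
    and w_lip: "Kw-lipschitz_on {-b..0} w" and w_bound: "\<And>\<theta>. \<theta> \<in> {-b..0} \<Longrightarrow> norm (w \<theta>) \<le> R"
    and u_int: "u integrable_on {t..T}" and u_bound: "\<And>s. s \<in> {t..T} \<Longrightarrow> norm (u s) \<le> cu"
begin

private definition "c0 = growth_rate cu"
private definition "growth s = (R + 1) * exp (3 * c0 * (s - t))"
private definition "Klip = sol_lip cu R Kw"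

private definition picard :: "(real \<Rightarrow> 'a) \<Rightarrow> real \<Rightarrow> 'a" where
  "picard x s = (if s \<le> t then w (s - t) else w 0 + integral {t..s} (\<lambda>\<sigma>. rate x \<sigma> + u \<sigma>))"

text \<open>The class preserved by \<open>picard\<close>: the envelope \<open>growth\<close> bounds
  the rate, the bound on the rate gives the Lipschitz constant, and the contraction estimate needs
  that constant.\<close>

private definition admissible :: "(real \<Rightarrow> 'a) \<Rightarrow> bool" where
  "admissible x \<longleftrightarrow> (\<forall>s\<in>{t - b..t}. x s = w (s - t)) \<and> Klip-lipschitz_on {t - b..T} x \<and>
     (\<forall>s\<in>{t..T}. norm (x s) \<le> growth s)"

private lemma c0: "0 < c0" "lF \<le> c0" "cF + cu \<le> c0"
  using lF_pos by (auto simp: c0_def growth_rate_def)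

private lemma growth_mono: "s \<le> s' \<Longrightarrow> growth s \<le> growth s'"
  using R c0 by (auto simp: growth_def intro!: mult_left_mono)

private lemma growth_ge: "t \<le> s \<Longrightarrow> R + 1 \<le> growth s"
  using growth_mono[of t s] by (simp add: growth_def)

private lemma growth_le: "s \<le> T \<Longrightarrow> growth s \<le> sol_bound cu R"
proof -
  assume "s \<le> T"
  then have "growth s \<le> growth T" by (rule growth_mono)
  also have "growth T \<le> sol_bound cu R"
    unfolding growth_def sol_bound_def c0_def[symmetric] using R t c0
    by (intro mult_left_mono) auto
  finally show ?thesis .
qed

private lemma Klip: "Kw \<le> Klip" "s \<le> T \<Longrightarrow> 3 * c0 * growth s \<le> Klip" "0 \<le> Klip"
proof -
  show "Kw \<le> Klip" by (simp add: Klip_def sol_lip_def)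
  then show "0 \<le> Klip" using lipschitz_on_nonneg[OF w_lip] by simp
  assume "s \<le> T"
  then have "3 * c0 * growth s \<le> 3 * c0 * sol_bound cu R"
    using c0 by (intro mult_left_mono growth_le) auto
  then show "3 * c0 * growth s \<le> Klip" by (simp add: Klip_def sol_lip_def c0_def)
qed

private lemma admissible_cont: "admissible x \<Longrightarrow> continuous_on {t - b..T} x"
  by (auto simp: admissible_def intro: lipschitz_on_continuous_on)

private lemma admissible_norm:
  assumes "admissible x" "s \<in> {t - b..\<sigma>}" "\<sigma> \<in> {t..T}"
  shows "norm (x s) \<le> growth \<sigma>"
proof (cases "s \<le> t")
  case True
  then have "norm (x s) \<le> R" using assms w_bound[of "s - t"] by (auto simp: admissible_def)
  then show ?thesis using growth_ge[of \<sigma>] assms by simp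
next
  case False
  then have "norm (x s) \<le> growth s" using assms by (auto simp: admissible_def)
  then show ?thesis using growth_mono[of s \<sigma>] assms by simp
qed

private lemma rate_int:
  assumes "admissible x" "t \<le> p" "q \<le> T" shows "(\<lambda>\<sigma>. rate x \<sigma> + u \<sigma>) integrable_on {p..q}"
proof (rule integrable_add)
  show "rate x integrable_on {p..q}"
    using t assms by (intro rate_integrable[OF _ admissible_cont]) auto
  show "u integrable_on {p..q}"
    using assms by (intro integrable_on_subinterval[OF u_int]) auto
qed

private lemma rate_norm:
  assumes "admissible x" "\<sigma> \<in> {t..T}"
  shows "norm (rate x \<sigma> + u \<sigma>) \<le> 3 * c0 * growth \<sigma>"
proof -
  have s: "\<sigma> \<in> {t0..T}" using assms t by simp
  have "norm (x \<sigma>) \<le> growth \<sigma>" "norm (x (delayed x \<sigma>)) \<le> growth \<sigma>"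
    using assms s delayed_bounds[OF s, of x] b_nonneg by (auto intro!: admissible_norm)
  then have "lF * (norm (x \<sigma>) + norm (x (delayed x \<sigma>))) \<le> c0 * (growth \<sigma> + growth \<sigma>)"
    using c0 lF_pos by (intro mult_mono add_mono) auto
  then have "norm (rate x \<sigma> + u \<sigma>) \<le> (cF + cu) + c0 * (2 * growth \<sigma>)"
    using norm_triangle_ineq[of "rate x \<sigma>" "u \<sigma>"] rate_bound[OF s, of x] u_bound[OF assms(2)] by simp
  also have "\<dots> \<le> c0 * growth \<sigma> + c0 * (2 * growth \<sigma>)"
  proof -
    have "c0 \<le> c0 * growth \<sigma>"
      using c0 growth_ge[of \<sigma>] assms R by (simp add: mult_le_cancel_left1)
    then show ?thesis using c0 by linarith
  qed
  finally show ?thesis by simp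
qed

private lemma admissible_picard:
  assumes x: "admissible x" shows "admissible (picard x)"
  unfolding admissible_def
proof (intro conjI ballI)
  fix s assume "s \<in> {t - b..t}" then show "picard x s = w (s - t)" by (simp add: picard_def)
next
  have "Klip-lipschitz_on {t - b..t} (\<lambda>s. w (s - t))"
  proof (rule lipschitz_onI)
    fix p q assume "p \<in> {t - b..t}" "q \<in> {t - b..t}"
    then have "dist (w (p - t)) (w (q - t)) \<le> Kw * dist (p - t) (q - t)"
      by (intro lipschitz_onD[OF w_lip]) auto
    also have "\<dots> \<le> Klip * dist p q" using Klip by (auto simp: dist_norm intro: mult_right_mono)
    finally show "dist (w (p - t)) (w (q - t)) \<le> Klip * dist p q" .
  qed (rule Klip)
  moreover have "Klip-lipschitz_on {t..T} (\<lambda>s. w 0 + integral {t..s} (\<lambda>\<sigma>. rate x \<sigma> + u \<sigma>))"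
  proof -
    have "Klip-lipschitz_on {t..T} (\<lambda>s. integral {t..s} (\<lambda>\<sigma>. rate x \<sigma> + u \<sigma>))"
      using rate_norm[OF x] Klip
      by (intro lipschitz_on_integral rate_int[OF x]) (auto intro: order_trans)
    from lipschitz_on_add[OF lipschitz_on_constant this] show ?thesis by simp
  qed
  ultimately have "Klip-lipschitz_on {t - b..T} (\<lambda>s. if s \<le> t then w (s - t)
      else w 0 + integral {t..s} (\<lambda>\<sigma>. rate x \<sigma> + u \<sigma>))"
    by (rule lipschitz_on_concat) simp
  then show "Klip-lipschitz_on {t - b..T} (picard x)" unfolding picard_def .
next
  fix s assume s: "s \<in> {t..T}"
  have "norm (integral {t..s} (\<lambda>\<sigma>. rate x \<sigma> + u \<sigma>)) \<le> integral {t..s} (\<lambda>\<sigma>. (R + 1) * (3 * c0) * exp (3 * c0 * (\<sigma> - t)))"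
    using s rate_norm[OF x]
    by (intro Henstock_Kurzweil_Integration.integral_norm_bound_integral rate_int[OF x]
        integrable_continuous_real continuous_intros) (auto simp: growth_def mult_ac)
  \<comment> \<open>The envelope reproduces itself under integration up to its initial value
    \<open>R + 1\<close>, of which the initial state \<open>w 0\<close> uses at most
    \<open>R\<close>.\<close>
  also have "\<dots> = growth s - (R + 1)"
    using s by (subst integral_exp_shift) (auto simp: growth_def right_diff_distrib)
  finally have "norm (integral {t..s} (\<lambda>\<sigma>. rate x \<sigma> + u \<sigma>)) \<le> growth s - (R + 1)" .
  moreover have "norm (w 0) \<le> R" using w_bound[of 0] b_nonneg by simp
  moreover have "R + 1 \<le> growth s" using growth_ge s by simp
  ultimately show "norm (picard x s) \<le> growth s"
    using norm_triangle_ineq[of "w 0" "integral {t..s} (\<lambda>\<sigma>. rate x \<sigma> + u \<sigma>)"] s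
    by (cases "s = t") (auto simp: picard_def)
qed

text \<open>Weight of an exponentially weighted sup norm. Its rate is twice
  \<open>stab_rate Klip\<close>, so integrating a difference of rates gains the factor 1/2, whatever
  the length of the horizon.\<close>

private definition "E s = exp (2 * stab_rate Klip * (s - t))"

private lemma E_pos: "0 < E s" by (simp add: E_def)

private lemma E_mono: "s \<le> s' \<Longrightarrow> E s \<le> E s'"
  using stab_rate_pos[OF Klip(3)] by (simp add: E_def)

private lemma picard_contraction:
  assumes x: "admissible x" and y: "admissible y" and "0 \<le> k"
    and d: "\<And>s. s \<in> {t..T} \<Longrightarrow> norm (x s - y s) \<le> k * E s" and s: "s \<in> {t..T}"
  shows "norm (picard x s - picard y s) \<le> k / 2 * E s"
proof (cases "s = t")
  case True then show ?thesis using \<open>0 \<le> k\<close> E_pos[of s] by (simp add: picard_def)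
next
  case False
  let ?C = "stab_rate Klip"
  have C: "0 < ?C" by (rule stab_rate_pos[OF Klip(3)])
  have "norm (integral {t..s} (\<lambda>\<sigma>. (rate x \<sigma> + u \<sigma>) - (rate y \<sigma> + u \<sigma>)))
      \<le> integral {t..s} (\<lambda>\<sigma>. k / 2 * (2 * ?C) * exp (2 * ?C * (\<sigma> - t)))"
  proof (rule Henstock_Kurzweil_Integration.integral_norm_bound_integral)
    show "(\<lambda>\<sigma>. (rate x \<sigma> + u \<sigma>) - (rate y \<sigma> + u \<sigma>)) integrable_on {t..s}"
      using s by (intro integrable_diff rate_int x y) auto
    show "(\<lambda>\<sigma>. k / 2 * (2 * ?C) * exp (2 * ?C * (\<sigma> - t))) integrable_on {t..s}"
      by (intro integrable_continuous_real continuous_intros)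
    fix \<sigma> assume "\<sigma> \<in> {t..s}"
    then have \<sigma>: "\<sigma> \<in> {t..T}" "\<sigma> \<in> {t0..T}" using s t by auto
    have lip: "Klip-lipschitz_on {t - b..T} y" using y by (simp add: admissible_def)
    have "norm (rate x \<sigma> - rate y \<sigma>) \<le> ?C * (k * E \<sigma>)"
    proof (rule rate_diff_majorant[OF _ \<sigma>(1) lip])
      show "t0 \<le> t" using t by simp
      show "norm (x \<sigma> - y \<sigma>) \<le> k * E \<sigma>" by (rule d[OF \<sigma>(1)])
      let ?d = "delayed x \<sigma>"
      show "norm (x ?d - y ?d) \<le> k * E \<sigma>"
      proof (cases "?d \<le> t")
        case True
        then have "?d \<in> {t - b..t}" using delayed_bounds[OF \<sigma>(2), of x] \<sigma> by auto
        then have "x ?d = y ?d" using x y by (simp add: admissible_def)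
        then show ?thesis using \<open>0 \<le> k\<close> E_pos[of \<sigma>] by simp
      next
        case False
        then have "?d \<in> {t..T}" "?d \<le> \<sigma>" using delayed_bounds[OF \<sigma>(2), of x] \<sigma> by auto
        then have "norm (x ?d - y ?d) \<le> k * E ?d" "k * E ?d \<le> k * E \<sigma>"
          using d[of ?d] E_mono \<open>0 \<le> k\<close> by (auto intro: mult_left_mono)
        then show ?thesis by simp
      qed
    qed
    then show "norm ((rate x \<sigma> + u \<sigma>) - (rate y \<sigma> + u \<sigma>)) \<le> k / 2 * (2 * ?C) * exp (2 * ?C * (\<sigma> - t))"
      by (simp add: E_def mult_ac)
  qed
  also have "\<dots> = k / 2 * (E s - 1)"
    using s by (subst integral_exp_shift) (auto simp: E_def)
  also have "\<dots> \<le> k / 2 * E s" using \<open>0 \<le> k\<close> by (simp add: algebra_simps)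
  finally have "norm (integral {t..s} (\<lambda>\<sigma>. (rate x \<sigma> + u \<sigma>) - (rate y \<sigma> + u \<sigma>))) \<le> k / 2 * E s" .
  moreover have "integral {t..s} (\<lambda>\<sigma>. (rate x \<sigma> + u \<sigma>) - (rate y \<sigma> + u \<sigma>))
      = integral {t..s} (\<lambda>\<sigma>. rate x \<sigma> + u \<sigma>) - integral {t..s} (\<lambda>\<sigma>. rate y \<sigma> + u \<sigma>)"
    using s by (intro Henstock_Kurzweil_Integration.integral_diff rate_int x y) auto
  ultimately show ?thesis using False s by (simp add: picard_def)
qed

private definition "iter k = (picard ^^ k) (\<lambda>s. w (min 0 (s - t)))"

private lemma iter_admissible: "admissible (iter k)"
proof (induction k)
  case 0
  have "Kw-lipschitz_on {t - b..T} (\<lambda>s. w (min 0 (s - t)))"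
  proof (rule lipschitz_onI)
    fix p q assume "p \<in> {t - b..T}" "q \<in> {t - b..T}"
    then have "dist (w (min 0 (p - t))) (w (min 0 (q - t))) \<le> Kw * dist (min 0 (p - t)) (min 0 (q - t))"
      using b_nonneg by (intro lipschitz_onD[OF w_lip]) (auto simp: min_def)
    also have "\<dots> \<le> Kw * dist p q"
      using lipschitz_on_nonneg[OF w_lip] by (intro mult_left_mono) (auto simp: dist_real_def min_def)
    finally show "dist (w (min 0 (p - t))) (w (min 0 (q - t))) \<le> Kw * dist p q" .
  qed (rule lipschitz_on_nonneg[OF w_lip])
  then have "Klip-lipschitz_on {t - b..T} (\<lambda>s. w (min 0 (s - t)))"
    by (rule lipschitz_on_mono) (use Klip in auto)
  moreover have "norm (w (min 0 (s - t))) \<le> growth s" if "s \<in> {t..T}" for s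
    using w_bound[of 0] b_nonneg growth_ge[of s] that by (simp add: min_def)
  ultimately show ?case by (auto simp: iter_def admissible_def min_def)
next
  case (Suc k) then show ?case using admissible_picard by (simp add: iter_def)
qed

private lemma iter_dist:
  assumes "s \<in> {t..T}" shows "norm (iter (Suc k) s - iter k s) \<le> 2 * sol_bound cu R * (1/2) ^ k * E s"
  using assms
proof (induction k arbitrary: s)
  case 0
  have n: "norm (iter k s) \<le> sol_bound cu R" for k
    using iter_admissible[of k] growth_le[of s] 0 by (force simp: admissible_def)
  have "1 \<le> E s" using E_mono[of t s] 0 by (simp add: E_def)
  moreover have "0 \<le> sol_bound cu R" using n[of 0] norm_ge_zero order_trans by blast
  ultimately have "2 * sol_bound cu R * 1 \<le> 2 * sol_bound cu R * E s" by (intro mult_left_mono) auto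
  then show ?case
    using norm_triangle_ineq4[of "iter (Suc 0) s" "iter 0 s"] n[of 0] n[of "Suc 0"] by simp
next
  case (Suc k)
  have "0 \<le> sol_bound cu R" using growth_ge[of T] growth_le[of T] t R by simp
  then have "norm (picard (iter (Suc k)) s - picard (iter k) s) \<le> (2 * sol_bound cu R * (1/2) ^ k) / 2 * E s"
    using Suc by (intro picard_contraction iter_admissible) auto
  then show ?case by (simp add: iter_def)
qed

lemma sol_exists:
  "\<exists>x. sol t w u x \<and> (sol_lip cu R Kw)-lipschitz_on {t - b..T} x \<and>
    (\<forall>s\<in>{t - b..T}. norm (x s) \<le> sol_bound cu R)"
proof -
  let ?M = "2 * sol_bound cu R"
  have M: "0 \<le> ?M" using growth_ge[of T] growth_le[of T] t R by simp
  have eq: "iter k s = w (s - t)" if "s \<in> {t - b..t}" for k s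
    using iter_admissible[of k] that by (simp add: admissible_def)
  have conv: "convergent (\<lambda>k. iter k s)" if s: "s \<in> {t - b..T}" for s
  proof (cases "s \<le> t")
    case True
    then show ?thesis using eq[of s] s by (simp add: convergent_const)
  next
    case False
    have "summable (\<lambda>k. iter (Suc k) s - iter k s)"
    proof (rule summable_comparison_test[OF exI, rule_format])
      show "norm (iter (Suc k) s - iter k s) \<le> ?M * (1/2) ^ k * E s" for k
        using iter_dist[of s k] s False by simp
      show "summable (\<lambda>k. ?M * (1/2::real) ^ k * E s)"
        by (intro summable_mult2 summable_mult summable_geometric) simp
    qed
    then have "convergent (\<lambda>n. iter n s - iter 0 s)"
      unfolding summable_iff_convergent sum_lessThan_telescope[where f = "\<lambda>k. iter k s"] .
    then show ?thesis by (simp only: convergent_diff_const_right_iff)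
  qed
  define x where "x s = lim (\<lambda>k. iter k s)" for s
  have lim: "(\<lambda>k. iter k s) \<longlonglongrightarrow> x s" if "s \<in> {t - b..T}" for s
    using conv[OF that] by (simp add: x_def convergent_LIMSEQ_iff)
  have tb: "s \<in> {t - b..T}" if "s \<in> {t..T}" for s using that b_nonneg by auto
  have adm: "admissible x"
    unfolding admissible_def
  proof (intro conjI ballI)
    fix s assume s: "s \<in> {t - b..t}"
    then have "(\<lambda>k. iter k s) \<longlonglongrightarrow> w (s - t)" using eq by simp
    then show "x s = w (s - t)" using lim[of s] s t LIMSEQ_unique by auto
  next
    show "Klip-lipschitz_on {t - b..T} x"
    proof (rule lipschitz_onI)
      fix p q assume pq: "p \<in> {t - b..T}" "q \<in> {t - b..T}"
      have "(\<lambda>k. dist (iter k p) (iter k q)) \<longlonglongrightarrow> dist (x p) (x q)"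
        by (intro tendsto_intros lim pq)
      moreover have "dist (iter k p) (iter k q) \<le> Klip * dist p q" for k
        using iter_admissible[of k] pq by (auto simp: admissible_def intro: lipschitz_onD)
      ultimately show "dist (x p) (x q) \<le> Klip * dist p q"
        by (intro Lim_bounded[where M = 0]) auto
    qed (rule Klip)
    fix s assume s: "s \<in> {t..T}"
    have "norm (iter k s) \<le> growth s" for k
      using iter_admissible[of k] s by (auto simp: admissible_def)
    then show "norm (x s) \<le> growth s"
      using tendsto_norm[OF lim[OF tb[OF s]]] by (intro Lim_bounded[where M = 0]) auto
  qed
  \<comment> \<open>Summing the geometric increments gives a rate of convergence; the factor
    \<open>1 - (1/2) ^ j\<close> keeps the induction exact.\<close>
  have tail: "norm (iter k s - x s) \<le> 2 * ?M * (1/2) ^ k * E s" if s: "s \<in> {t..T}" for k s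
  proof -
    have "norm (iter k s - iter (k + j) s) \<le> 2 * ?M * (1/2) ^ k * E s * (1 - (1/2) ^ j)" for j
    proof (induction j)
      case (Suc j)
      have "norm (iter k s - iter (k + Suc j) s)
          \<le> norm (iter k s - iter (k + j) s) + norm (iter (Suc (k + j)) s - iter (k + j) s)"
        using norm_triangle_ineq4[of "iter k s - iter (k + j) s" "iter (Suc (k + j)) s - iter (k + j) s"] by simp
      also have "\<dots> \<le> 2 * ?M * (1/2) ^ k * E s * (1 - (1/2) ^ j) + ?M * (1/2) ^ (k + j) * E s"
        by (intro add_mono Suc iter_dist[OF s])
      also have "\<dots> = 2 * ?M * (1/2) ^ k * E s * (1 - (1/2) ^ Suc j)"
        by (simp add: power_add algebra_simps)
      finally show ?case .
    qed simp
    also have "2 * ?M * (1/2) ^ k * E s * (1 - (1/2) ^ j) \<le> 2 * ?M * (1/2) ^ k * E s" for j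
      using M E_pos[of s] by (intro mult_left_le) auto
    finally have bd: "norm (iter k s - iter (k + j) s) \<le> 2 * ?M * (1/2) ^ k * E s" for j .
    have "(\<lambda>j. norm (iter k s - iter (j + k) s)) \<longlonglongrightarrow> norm (iter k s - x s)"
      by (intro tendsto_intros LIMSEQ_ignore_initial_segment lim tb s)
    then show ?thesis using bd by (intro Lim_bounded[where M = 0]) (auto simp: add.commute)
  qed
  \<comment> \<open>\<open>picard (iter k)\<close> is \<open>iter (Suc k)\<close>; it lies within
    \<open>e\<close> of \<open>x\<close> by the tail estimate and within \<open>e\<close> of
    \<open>picard x\<close> by the contraction.\<close>
  have fixpoint: "x s = picard x s" if s: "s \<in> {t..T}" for s
  proof -
    have "norm (picard x s - x s) \<le> 2 * ?M * (1/2) ^ k * E s" for k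
    proof -
      define e where "e = ?M * (1/2) ^ k * E s"
      have "norm (picard (iter k) s - picard x s) \<le> (2 * ?M * (1/2) ^ k) / 2 * E s"
        using M by (intro picard_contraction[OF iter_admissible adm] tail s) auto
      also have "\<dots> = e" by (simp add: e_def)
      finally have 1: "norm (picard (iter k) s - picard x s) \<le> e" .
      have "norm (iter (Suc k) s - x s) \<le> 2 * ?M * (1/2) ^ Suc k * E s" by (rule tail[OF s])
      also have "\<dots> = e" by (simp add: e_def)
      finally have 2: "norm (iter (Suc k) s - x s) \<le> e" .
      have eq: "picard x s - x s = (iter (Suc k) s - x s) - (picard (iter k) s - picard x s)"
        by (simp add: iter_def)
      have "norm (picard x s - x s) \<le> norm (iter (Suc k) s - x s) + norm (picard (iter k) s - picard x s)"
        unfolding eq by (rule norm_triangle_ineq4)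
      then have "norm (picard x s - x s) \<le> e + e" using 1 2 by linarith
      moreover have "e + e = 2 * ?M * (1/2) ^ k * E s" unfolding e_def by (simp add: algebra_simps)
      ultimately show ?thesis by (simp only:)
    qed
    moreover have "(\<lambda>k. 2 * ?M * (1/2::real) ^ k * E s) \<longlonglongrightarrow> 2 * ?M * 0 * E s"
      by (intro tendsto_intros) auto
    ultimately have "norm (picard x s - x s) \<le> 0"
      by (intro Lim_bounded2[where N = 0]) auto
    then show ?thesis by simp
  qed
  have "sol t w u x"
    unfolding sol_def
  proof (intro conjI ballI)
    show "\<exists>K. K-lipschitz_on {t - b..T} x" using adm by (auto simp: admissible_def)
    fix \<theta> assume "\<theta> \<in> {-b..0}" then show "x (t + \<theta>) = w \<theta>" using adm by (simp add: admissible_def)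
  next
    fix s assume s: "s \<in> {t..T}"
    have "integral {t..s} (\<lambda>\<sigma>. rate x \<sigma> + u \<sigma>) = integral {t..s} (rate x) + integral {t..s} u"
      using s t
      by (intro Henstock_Kurzweil_Integration.integral_add rate_integrable[OF _ admissible_cont[OF adm]]
          integrable_on_subinterval[OF u_int]) auto
    then show "x s = w 0 + integral {t..s} (rate x) + integral {t..s} u"
      using fixpoint[OF s] s by (cases "s = t") (auto simp: picard_def)
  qed
  moreover have "\<forall>s\<in>{t - b..T}. norm (x s) \<le> sol_bound cu R"
  proof
    fix s assume "s \<in> {t - b..T}"
    then have "norm (x s) \<le> growth T" using t by (intro admissible_norm[OF adm]) auto
    then show "norm (x s) \<le> sol_bound cu R" using growth_le[of T] by linarith
  qed
  moreover have "(sol_lip cu R Kw)-lipschitz_on {t - b..T} x"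
    using adm unfolding admissible_def Klip_def by (rule conjunct1[OF conjunct2])
  ultimately show ?thesis by (intro exI[of _ x] conjI)
qed

text \<open>By uniqueness every solution coincides on \<open>{t - b..T}\<close> with the constructed
  one and inherits its explicit bounds, although its own Lipschitz constant was arbitrary.\<close>

lemma sol_bounds:
  assumes x: "sol t w u x"
  shows "(sol_lip cu R Kw)-lipschitz_on {t - b..T} x"
    and "\<And>s. s \<in> {t - b..T} \<Longrightarrow> norm (x s) \<le> sol_bound cu R"
proof -
  obtain y where y: "sol t w u y" "(sol_lip cu R Kw)-lipschitz_on {t - b..T} y"
    "\<forall>s\<in>{t - b..T}. norm (y s) \<le> sol_bound cu R"
    using sol_exists by blast
  have eq: "x s = y s" if "s \<in> {t - b..T}" for s
    using sol_unique[OF _ x y(1) that] t by simp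
  show "(sol_lip cu R Kw)-lipschitz_on {t - b..T} x"
    by (rule lipschitz_on_transform[OF y(2) eq])
  show "norm (x s) \<le> sol_bound cu R" if "s \<in> {t - b..T}" for s
    using y(3) eq[OF that] that by simp
qed

end

text \<open>One direction differentiates the primitive almost everywhere, the other is the
  fundamental theorem for Lipschitz functions; the rate is continuous along \<open>x\<close>, hence
  bounded and integrable.\<close>

lemma sol_iff_AE_derivative:
  assumes t: "t \<in> {t0..T}" and u: "u absolutely_integrable_on {t..T}"
    and u_bound: "\<And>s. s \<in> {t..T} \<Longrightarrow> norm (u s) \<le> cu"
  shows "sol t w u x \<longleftrightarrow> (\<exists>K. K-lipschitz_on {t - b..T} x) \<and> (\<forall>\<theta>\<in>{-b..0}. x (t + \<theta>) = w \<theta>) \<and>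
     (AE s in lebesgue_on {t<..<T}. (x has_vector_derivative rate x s + u s) (at s))"
proof (cases "\<exists>K. K-lipschitz_on {t - b..T} x")
  case True
  then obtain K where K: "K-lipschitz_on {t - b..T} x" by blast
  then have cont: "continuous_on {t - b..T} x" by (rule lipschitz_on_continuous_on)
  have lipt: "K-lipschitz_on {t..T} x" by (rule lipschitz_on_subset[OF K]) (use b_nonneg in auto)
  let ?r = "\<lambda>s. rate x s + u s"
  have rc: "continuous_on {t..T} (rate x)" using rate_cont[OF _ cont] t by simp
  then have ri: "rate x absolutely_integrable_on {t..T}"
    by (rule absolutely_integrable_continuous_real)
  then have int: "?r absolutely_integrable_on {t..T}"
    using u by (rule set_integral_add)
  have ui: "u integrable_on {t..T}" by (rule set_lebesgue_integral_eq_integral(1)[OF u])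
  have split: "integral {t..s} ?r = integral {t..s} (rate x) + integral {t..s} u" if "s \<in> {t..T}" for s
  proof (rule Henstock_Kurzweil_Integration.integral_add)
    show "rate x integrable_on {t..s}" using t that by (intro rate_integrable[OF _ cont]) auto
    show "u integrable_on {t..s}" by (rule integrable_on_subinterval[OF ui]) (use that in auto)
  qed
  obtain Br where Br: "\<And>s. s \<in> {t..T} \<Longrightarrow> norm (rate x s) \<le> Br"
    using compact_imp_bounded[OF compact_continuous_image[OF rc compact_Icc]]
    unfolding bounded_iff by blast
  have rB: "norm (?r s) \<le> Br + cu" if "s \<in> {t..T}" for s
    using norm_triangle_ineq[of "rate x s" "u s"] Br[OF that] u_bound[OF that] by simp
  have meas: "{t<..<T} \<in> sets lebesgue" by simp
  show ?thesis
  proof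
    assume x: "sol t w u x"
    obtain N where N: "negligible N" "\<And>s. \<lbrakk>t < s; s < T; s \<notin> N\<rbrakk> \<Longrightarrow>
        ((\<lambda>s. integral {t..s} ?r) has_vector_derivative ?r s) (at s)"
      using AE_has_vector_derivative_integral[OF int] by blast
    have "(x has_vector_derivative ?r s) (at s)" if s: "t < s" "s < T" "s \<notin> N" for s
    proof (rule has_vector_derivative_transform_within_open[where S = "{t<..<T}"])
      show "((\<lambda>s. w 0 + integral {t..s} ?r) has_vector_derivative ?r s) (at s)"
        using N(2)[OF s] by (auto intro!: derivative_eq_intros)
      fix \<sigma> assume "\<sigma> \<in> {t<..<T}"
      then show "w 0 + integral {t..\<sigma>} ?r = x \<sigma>"
        using x split[of \<sigma>] by (simp add: sol_def add.assoc)
    qed (use s in auto)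
    then have "{s \<in> {t<..<T}. \<not> (x has_vector_derivative ?r s) (at s)} \<subseteq> N" by auto
    then show "(\<exists>K. K-lipschitz_on {t - b..T} x) \<and> (\<forall>\<theta>\<in>{-b..0}. x (t + \<theta>) = w \<theta>) \<and>
        (AE s in lebesgue_on {t<..<T}. (x has_vector_derivative ?r s) (at s))"
      using x negligible_subset[OF N(1)] unfolding AE_lebesgue_on_iff_negligible[OF meas] sol_def by blast
  next
    assume R: "(\<exists>K. K-lipschitz_on {t - b..T} x) \<and> (\<forall>\<theta>\<in>{-b..0}. x (t + \<theta>) = w \<theta>) \<and>
        (AE s in lebesgue_on {t<..<T}. (x has_vector_derivative ?r s) (at s))"
    define N where "N = {s \<in> {t<..<T}. \<not> (x has_vector_derivative ?r s) (at s)}"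
    have "negligible N" using R AE_lebesgue_on_iff_negligible[OF meas] by (simp add: N_def)
    have "x s - x t = integral {t..s} ?r" if "s \<in> {t..T}" for s
    proof (rule lipschitz_fundamental_theorem[where N = N])
      show "K-lipschitz_on {t..T} x" by (rule lipt)
      show "?r absolutely_integrable_on {t..T}" by (rule int)
      show "norm (?r s) \<le> Br + cu" if "s \<in> {t..T}" for s by (rule rB[OF that])
    qed (use that \<open>negligible N\<close> in \<open>auto simp: N_def\<close>)
    moreover have "x t = w 0" using bspec[OF conjunct1[OF conjunct2[OF R]], of 0] b_nonneg by simp
    ultimately have "x s = w 0 + integral {t..s} (rate x) + integral {t..s} u" if "s \<in> {t..T}" for s
      using split[OF that] that by (simp add: algebra_simps)
    then show "sol t w u x" using R unfolding sol_def by blast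
  qed
qed (simp add: sol_def)

end

subsection \<open>Existence of optimal controls\<close>

lemma borel_measurable_compose_continuous_on:
  fixes f :: "'b::metric_space \<Rightarrow> 'c::metric_space"
  assumes "u \<in> borel_measurable M" "\<And>s. s \<in> space M \<Longrightarrow> u s \<in> S" "continuous_on S f"
  shows "(\<lambda>s. f (u s)) \<in> borel_measurable M"
proof -
  have "u \<in> measurable M (restrict_space borel S)"
    using assms by (intro measurable_restrict_space2) auto
  then show ?thesis
    by (rule measurable_compose[OF _ borel_measurable_continuous_on_restrict[OF assms(3)]])
qed

text \<open>
  \<open>lL\<close>, \<open>lg\<close> and \<open>dd\<close> are the constants \<open>\<lambda>\<^sub>L\<close>, \<open>\<lambda>\<^sub>g\<close> and \<open>d\<close> of the hypotheses as
  functions of the radius; \<open>kt R\<close> is a Lipschitz constant in time of the delay on states of norm at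
  most \<open>R\<close>. The terminal cost \<open>h\<close> is a functional of the whole state trajectory.
\<close>

locale delay_control = delay_dynamics t0 T b lF cF ltau F tau
  for t0 T b lF cF ltau :: real
    and F :: "real \<Rightarrow> 'a::euclidean_space \<Rightarrow> 'a \<Rightarrow> 'a"
    and tau :: "real \<Rightarrow> 'a \<Rightarrow> real" +
  fixes A :: "'c::euclidean_space set" and G :: "'c \<Rightarrow> 'a"
    and L :: "real \<Rightarrow> 'a \<Rightarrow> 'a \<Rightarrow> 'c \<Rightarrow> real" and h :: "(real \<Rightarrow> 'a) \<Rightarrow> real"
    and cu kG \<mu> lH :: real and lL lg kt dd :: "real \<Rightarrow> real"
  assumes A_ne: "A \<noteq> {}" and A_compact: "compact A"
    and A_mid: "\<lbrakk>a \<in> A; a' \<in> A\<rbrakk> \<Longrightarrow> (1/2) *\<^sub>R (a + a') \<in> A"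
    and kG_pos: "0 < kG"
    and G_lip: "\<lbrakk>a \<in> A; a' \<in> A\<rbrakk> \<Longrightarrow> norm (G a - G a') \<le> kG * norm (a - a')"
    and G_mid: "\<lbrakk>a \<in> A; a' \<in> A\<rbrakk> \<Longrightarrow> G ((1/2) *\<^sub>R (a + a')) = (1/2) *\<^sub>R (G a + G a')"
    and G_bound: "a \<in> A \<Longrightarrow> norm (G a) \<le> cu"
    and L_cont: "continuous_on ({t0..T} \<times> UNIV \<times> UNIV \<times> A) (\<lambda>(s, z, y, a). L s z y a)"
    and \<mu>_pos: "0 < \<mu>"
    and L_strong: "\<lbrakk>s \<in> {t0..T}; a \<in> A; a' \<in> A\<rbrakk> \<Longrightarrow>
      L s z y ((1/2) *\<^sub>R (a + a')) \<le> (L s z y a + L s z y a') / 2 - \<mu> / 8 * (norm (a - a'))\<^sup>2"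
    and lH_pos: "0 < lH"
    and L_mixed: "\<lbrakk>s \<in> {t0..T}; s' \<in> {t0..T}; a \<in> A; a' \<in> A\<rbrakk> \<Longrightarrow>
      \<bar>(L s z y a - L s z y a') - (L s' z' y' a - L s' z' y' a')\<bar>
        \<le> lH * (\<bar>s - s'\<bar> + norm (z - z') + norm (y - y')) * norm (a - a')"
    and lL_pos: "0 < R \<Longrightarrow> 0 < lL R"
    and L_lip: "\<lbrakk>0 < R; s \<in> {t0..T}; a \<in> A; norm z \<le> R; norm y \<le> R; norm z' \<le> R; norm y' \<le> R\<rbrakk> \<Longrightarrow>
      \<bar>L s z y a - L s z' y' a\<bar> \<le> lL R * (norm (z - z') + norm (y - y'))"
    and lg_pos: "0 < R \<Longrightarrow> 0 < lg R"
    and h_lip: "\<lbrakk>0 < R; K-lipschitz_on {T - b..T} x; K-lipschitz_on {T - b..T} x';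
      \<And>s. s \<in> {T - b..T} \<Longrightarrow> norm (x s) \<le> R; \<And>s. s \<in> {T - b..T} \<Longrightarrow> norm (x' s) \<le> R\<rbrakk> \<Longrightarrow>
      \<bar>h x - h x'\<bar> \<le> lg R * (norm (x T - x' T) + integral {T - b..T} (\<lambda>s. norm (x s - x' s)))"
    and kt_pos: "0 < R \<Longrightarrow> 0 < kt R"
    and tau_time_lip: "\<lbrakk>0 < R; s \<in> {t0..T}; s' \<in> {t0..T}; norm z \<le> R\<rbrakk> \<Longrightarrow>
      \<bar>tau s z - tau s' z\<bar> \<le> kt R * \<bar>s - s'\<bar>"
    and dd_pos: "0 < R \<Longrightarrow> 0 < dd R"
    and delayed_mono: "\<lbrakk>0 < R; t \<in> {t0..<T}; K-lipschitz_on {-b..0} w; \<And>\<theta>. \<theta> \<in> {-b..0} \<Longrightarrow> norm (w \<theta>) \<le> R;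
      \<alpha> \<in> borel_measurable lebesgue; range \<alpha> \<subseteq> A; sol t w (\<lambda>s. G (\<alpha> s)) x;
      t \<le> p; p \<le> q; q \<le> T\<rbrakk> \<Longrightarrow> dd R * (q - p) \<le> delayed x q - delayed x p"
begin

text \<open>Controls are total with values in \<open>A\<close> everywhere, so that shifts, pastings
  and midpoints remain controls without attention to the ends of the interval.\<close>

definition ctl :: "(real \<Rightarrow> 'c) \<Rightarrow> bool" where
  "ctl \<alpha> \<longleftrightarrow> \<alpha> \<in> borel_measurable lebesgue \<and> range \<alpha> \<subseteq> A"

definition running :: "real \<Rightarrow> (real \<Rightarrow> 'a) \<Rightarrow> (real \<Rightarrow> 'c) \<Rightarrow> real" where
  "running t x \<alpha> = integral {t..T} (\<lambda>s. L s (x s) (x (delayed x s)) (\<alpha> s))"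

definition total :: "real \<Rightarrow> (real \<Rightarrow> 'a) \<Rightarrow> (real \<Rightarrow> 'c) \<Rightarrow> real" where
  "total t x \<alpha> = running t x \<alpha> + h x"

definition optimal :: "real \<Rightarrow> (real \<Rightarrow> 'a) \<Rightarrow> (real \<Rightarrow> 'c) \<Rightarrow> (real \<Rightarrow> 'a) \<Rightarrow> bool" where
  "optimal t w \<alpha> x \<longleftrightarrow> ctl \<alpha> \<and> sol t w (\<lambda>s. G (\<alpha> s)) x \<and>
     (\<forall>\<beta> y. ctl \<beta> \<longrightarrow> sol t w (\<lambda>s. G (\<beta> s)) y \<longrightarrow> total t x \<alpha> \<le> total t y \<beta>)"

lemma ctl_mem: "ctl \<alpha> \<Longrightarrow> \<alpha> s \<in> A"
  by (auto simp: ctl_def)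

lemma ctl_measurable: "ctl \<alpha> \<Longrightarrow> \<alpha> \<in> borel_measurable (lebesgue_on S)"
  by (auto simp: ctl_def intro: measurable_restrict_space1)

lemma bounded_ctl_integrable:
  fixes k :: "'c \<Rightarrow> 'd::euclidean_space"
  assumes "ctl \<alpha>" "continuous_on A k"
  shows "(\<lambda>s. k (\<alpha> s)) absolutely_integrable_on {p..q}"
proof -
  obtain B where "\<forall>a\<in>A. norm (k a) \<le> B"
    using compact_imp_bounded[OF compact_continuous_image[OF assms(2) A_compact]]
    unfolding bounded_iff by blast
  then show ?thesis
    using assms
    by (intro absolutely_integrable_bounded_measurable[where B = B]
        borel_measurable_compose_continuous_on[OF ctl_measurable] ctl_mem) (auto simp: ctl_mem)
qed

lemma G_cont: "continuous_on A G"
proof -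
  have "kG-lipschitz_on A G"
    using G_lip kG_pos by (intro lipschitz_onI) (auto simp: dist_norm)
  then show ?thesis by (rule lipschitz_on_continuous_on)
qed

lemma G_ctl_integrable: "ctl \<alpha> \<Longrightarrow> (\<lambda>s. G (\<alpha> s)) absolutely_integrable_on {p..q}"
  by (rule bounded_ctl_integrable[OF _ G_cont])

lemma G_ctl_integrable_on: "ctl \<alpha> \<Longrightarrow> (\<lambda>s. G (\<alpha> s)) integrable_on {p..q}"
  by (rule set_lebesgue_integral_eq_integral(1)[OF G_ctl_integrable])

lemma ctl_integrable_on: "ctl \<alpha> \<Longrightarrow> \<alpha> integrable_on {p..q}"
  using set_lebesgue_integral_eq_integral(1)[OF bounded_ctl_integrable[of \<alpha> "\<lambda>a. a"]] by simp

lemma ctl_diff_integrable: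
  fixes k :: "'c \<Rightarrow> 'd::euclidean_space"
  assumes "ctl \<alpha>" "ctl \<beta>" "continuous_on UNIV k"
  shows "(\<lambda>s. k (\<alpha> s - \<beta> s)) integrable_on {p..q}"
proof -
  have "compact ((\<lambda>(a, a'). a - a') ` (A \<times> A))"
    unfolding case_prod_unfold
    by (rule compact_continuous_image[OF _ compact_Times[OF A_compact A_compact]])
      (intro continuous_intros)
  then have "bounded (k ` ((\<lambda>(a, a'). a - a') ` (A \<times> A)))"
    by (intro compact_imp_bounded compact_continuous_image[OF continuous_on_subset[OF assms(3)]]) auto
  then obtain B where B: "\<forall>a\<in>A. \<forall>a'\<in>A. norm (k (a - a')) \<le> B"
    unfolding bounded_iff by auto
  have "(\<lambda>s. \<alpha> s - \<beta> s) \<in> borel_measurable (lebesgue_on {p..q})"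
    using assms by (intro borel_measurable_diff ctl_measurable)
  then have "(\<lambda>s. k (\<alpha> s - \<beta> s)) absolutely_integrable_on {p..q}"
    using B ctl_mem[OF assms(1)] ctl_mem[OF assms(2)]
    by (intro absolutely_integrable_bounded_measurable[where B = B]
        borel_measurable_compose_continuous_on[OF _ _ assms(3)]) auto
  then show ?thesis by (rule set_lebesgue_integral_eq_integral(1))
qed

lemma L_integrable:
  assumes t: "t0 \<le> t" "q \<le> T" and z: "continuous_on {t..q} z" and y: "continuous_on {t..q} y" and \<alpha>: "ctl \<alpha>"
  shows "(\<lambda>s. L s (z s) (y s) (\<alpha> s)) absolutely_integrable_on {t..q}"
proof -
  let ?S = "{t0..T} \<times> UNIV \<times> UNIV \<times> A"
  let ?u = "\<lambda>s. (s, z s, y s, \<alpha> s)"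
  have zm: "z \<in> borel_measurable (lebesgue_on {t..q})" "y \<in> borel_measurable (lebesgue_on {t..q})"
    using z y by (auto intro: continuous_imp_measurable_on_sets_lebesgue)
  have "?u \<in> borel_measurable (lebesgue_on {t..q})"
    by (intro borel_measurable_Pair zm ctl_measurable[OF \<alpha>])
      (auto intro: continuous_imp_measurable_on_sets_lebesgue)
  then have meas: "(\<lambda>s. (\<lambda>(s, z, y, a). L s z y a) (?u s)) \<in> borel_measurable (lebesgue_on {t..q})"
    using t ctl_mem[OF \<alpha>] by (intro borel_measurable_compose_continuous_on[OF _ _ L_cont]) auto
  let ?C = "{t0..T} \<times> (z ` {t..q}) \<times> (y ` {t..q}) \<times> A"
  have "compact ?C"
    using z y by (intro compact_Times compact_Icc A_compact compact_continuous_image)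
  moreover have "?C \<subseteq> ?S" by auto
  ultimately have C: "compact ((\<lambda>(s, z, y, a). L s z y a) ` ?C)"
    by (intro compact_continuous_image[OF continuous_on_subset[OF L_cont]])
  obtain B where B: "\<forall>v\<in>(\<lambda>(s, z, y, a). L s z y a) ` ?C. norm v \<le> B"
    using compact_imp_bounded[OF C] unfolding bounded_iff by blast
  have "norm (L s (z s) (y s) (\<alpha> s)) \<le> B" if "s \<in> {t..q}" for s
  proof -
    have "?u s \<in> ?C" using that t ctl_mem[OF \<alpha>] by auto
    from bspec[OF B imageI[OF this]] show ?thesis by simp
  qed
  then show ?thesis
    using meas by (intro absolutely_integrable_bounded_measurable[where B = B]) auto
qed

lemma L_integrable_on:
  assumes "t0 \<le> t" "q \<le> T" "continuous_on {t..q} z" "continuous_on {t..q} y" "ctl \<alpha>"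
  shows "(\<lambda>s. L s (z s) (y s) (\<alpha> s)) integrable_on {t..q}"
  by (rule set_lebesgue_integral_eq_integral(1)[OF L_integrable[OF assms]])

lemma ctl_mid:
  assumes "ctl \<alpha>" "ctl \<beta>" shows "ctl (\<lambda>s. (1/2) *\<^sub>R (\<alpha> s + \<beta> s))"
proof -
  have "(\<lambda>s. (1/2) *\<^sub>R (\<alpha> s + \<beta> s)) \<in> borel_measurable lebesgue"
    using assms unfolding ctl_def by (intro borel_measurable_scaleR borel_measurable_add borel_measurable_const) auto
  then show ?thesis using A_mid ctl_mem[OF assms(1)] ctl_mem[OF assms(2)] by (auto simp: ctl_def)
qed

end

text \<open>\<open>R\<close> bounds the history and \<open>Kw\<close> is a Lipschitz constant of it.
  Fixing them turns the bounds of all trajectories into two constants \<open>M\<close> and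
  \<open>K\<close>, common to all initial times and controls.\<close>

locale delay_control_data = delay_control t0 T b lF cF ltau F tau A G L h cu kG \<mu> lH lL lg kt dd
  for t0 T b lF cF ltau :: real
    and F :: "real \<Rightarrow> 'a::euclidean_space \<Rightarrow> 'a \<Rightarrow> 'a"
    and tau :: "real \<Rightarrow> 'a \<Rightarrow> real"
    and A :: "'c::euclidean_space set" and G L h cu kG \<mu> lH lL lg kt dd +
  fixes R Kw :: real
  assumes R_pos: "0 < R" and Kw_nonneg: "0 \<le> Kw"
begin

definition "M = sol_bound cu R"
definition "K = sol_lip cu R Kw"

definition init :: "real \<Rightarrow> (real \<Rightarrow> 'a) \<Rightarrow> bool" where
  "init t w \<longleftrightarrow> t \<in> {t0..<T} \<and> Kw-lipschitz_on {-b..0} w \<and> (\<forall>\<theta>\<in>{-b..0}. norm (w \<theta>) \<le> R)"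

definition controlled :: "real \<Rightarrow> (real \<Rightarrow> 'a) \<Rightarrow> (real \<Rightarrow> 'c) \<Rightarrow> (real \<Rightarrow> 'a) \<Rightarrow> bool" where
  "controlled t w \<alpha> x \<longleftrightarrow> init t w \<and> ctl \<alpha> \<and> sol t w (\<lambda>s. G (\<alpha> s)) x"

lemma M_pos: "0 < M"
  using R_pos by (simp add: M_def sol_bound_def)

lemma K_nonneg: "0 \<le> K"
  using Kw_nonneg by (simp add: K_def sol_lip_def)

lemma controlled_exists:
  assumes "init t w" "ctl \<alpha>" shows "\<exists>x. controlled t w \<alpha> x"
proof -
  have "\<exists>x. sol t w (\<lambda>s. G (\<alpha> s)) x \<and> (sol_lip cu R Kw)-lipschitz_on {t - b..T} x \<and>
      (\<forall>s\<in>{t - b..T}. norm (x s) \<le> sol_bound cu R)"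
    using assms R_pos by (intro sol_exists G_ctl_integrable_on G_bound ctl_mem) (auto simp: init_def)
  then show ?thesis using assms by (auto simp: controlled_def)
qed

context
  fixes t w \<alpha> x assumes x: "controlled t w \<alpha> x"
begin

lemma controlled_t: "t0 \<le> t" "t < T" "t \<le> T"
  using x by (auto simp: controlled_def init_def)

lemma controlled_ctl: "ctl \<alpha>" and controlled_sol: "sol t w (\<lambda>s. G (\<alpha> s)) x"
  using x by (auto simp: controlled_def)

lemma controlled_lip: "K-lipschitz_on {t - b..T} x"
  and controlled_norm: "s \<in> {t - b..T} \<Longrightarrow> norm (x s) \<le> M"
proof -
  have "(sol_lip cu R Kw)-lipschitz_on {t - b..T} x \<and> (\<forall>s\<in>{t - b..T}. norm (x s) \<le> sol_bound cu R)"
    using x R_pos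
    by (intro conjI ballI sol_bounds[where w = w and u = "\<lambda>s. G (\<alpha> s)"] G_ctl_integrable_on G_bound ctl_mem)
      (auto simp: controlled_def init_def)
  then show "K-lipschitz_on {t - b..T} x" "s \<in> {t - b..T} \<Longrightarrow> norm (x s) \<le> M"
    by (auto simp: K_def M_def)
qed

lemma controlled_cont: "continuous_on {t - b..T} x"
  by (rule lipschitz_on_continuous_on[OF controlled_lip])

lemma controlled_cont': "continuous_on {t..T} x"
  by (rule continuous_on_subset[OF controlled_cont]) (use b_nonneg in auto)

lemma controlled_delayed_cont: "continuous_on {t..T} (\<lambda>s. x (delayed x s))"
  by (rule delayed_value_cont[OF controlled_t(1) controlled_cont])

lemma controlled_delayed_mem: "s \<in> {t..T} \<Longrightarrow> delayed x s \<in> {t - b..T}"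
  using delayed_bounds[of s x] controlled_t by auto

lemma controlled_delayed_norm: "s \<in> {t..T} \<Longrightarrow> norm (x (delayed x s)) \<le> M"
  by (rule controlled_norm[OF controlled_delayed_mem])

lemma controlled_L_integrable:
  assumes "ctl \<beta>" shows "(\<lambda>s. L s (x s) (x (delayed x s)) (\<beta> s)) integrable_on {t..T}"
  by (rule L_integrable_on[OF controlled_t(1) order_refl controlled_cont' controlled_delayed_cont assms])

end

lemma controlled_stability:
  assumes x: "controlled t w \<alpha> x" and y: "controlled t w \<beta> y" and "S \<le> T" and "0 \<le> E"
    and "\<And>s. s \<in> {t..S} \<Longrightarrow> norm (integral {t..s} (\<lambda>s. G (\<alpha> s)) - integral {t..s} (\<lambda>s. G (\<beta> s))) \<le> E"
    and "s \<in> {t - b..S}"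
  shows "norm (x s - y s) \<le> stab_const K * E"
  by (rule stability[OF controlled_t(1)[OF x] \<open>S \<le> T\<close> controlled_sol[OF x] controlled_sol[OF y] controlled_lip[OF y]]) fact+

text \<open>The control \<gamma> in the integrand is the same on both sides and need not generate
  \<open>x\<close> or \<open>y\<close>, so only the state dependence of \<open>L\<close> enters. The
  bound \<open>e\<close> is a function of time because later the difference is large only during a
  short time.\<close>

lemma running_diff:
  assumes x: "controlled t w \<alpha> x" and y: "controlled t w \<beta> y" and \<gamma>: "ctl \<gamma>" and e: "e integrable_on {t..T}"
    and d: "\<And>s. s \<in> {t..T} \<Longrightarrow> norm (x s - y s) + norm (x (delayed x s) - y (delayed y s)) \<le> e s"
  shows "\<bar>running t x \<gamma> - running t y \<gamma>\<bar> \<le> lL M * integral {t..T} e"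
proof -
  let ?f = "\<lambda>x s. L s (x s) (x (delayed x s)) (\<gamma> s)"
  have int: "?f x integrable_on {t..T}" "?f y integrable_on {t..T}"
    using controlled_L_integrable[OF x \<gamma>] controlled_L_integrable[OF y \<gamma>] .
  have "norm (integral {t..T} (\<lambda>s. ?f x s - ?f y s)) \<le> integral {t..T} (\<lambda>s. lL M * e s)"
  proof (rule Henstock_Kurzweil_Integration.integral_norm_bound_integral)
    show "(\<lambda>s. ?f x s - ?f y s) integrable_on {t..T}" using int by (rule integrable_diff)
    show "(\<lambda>s. lL M * e s) integrable_on {t..T}" using e by (rule integrable_on_mult_right)
    fix s assume s: "s \<in> {t..T}"
    then have s': "s \<in> {t - b..T}" "s \<in> {t0..T}" using b_nonneg controlled_t[OF x] by auto
    have "\<bar>?f x s - ?f y s\<bar> \<le> lL M * (norm (x s - y s) + norm (x (delayed x s) - y (delayed y s)))"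
      using s s' M_pos
      by (intro L_lip ctl_mem \<gamma> controlled_norm[OF x] controlled_norm[OF y] controlled_delayed_norm[OF x] controlled_delayed_norm[OF y])
    also have "\<dots> \<le> lL M * e s" by (intro mult_left_mono d s less_imp_le lL_pos M_pos)
    finally show "norm (?f x s - ?f y s) \<le> lL M * e s" by simp
  qed
  then show ?thesis
    unfolding running_def using int
    by (simp add: Henstock_Kurzweil_Integration.integral_diff)
qed

lemma terminal_diff:
  assumes x: "controlled t w \<alpha> x" and y: "controlled t w \<beta> y"
  shows "\<bar>h x - h y\<bar> \<le> lg M * (norm (x T - y T) + integral {T - b..T} (\<lambda>s. norm (x s - y s)))"
proof (rule h_lip[OF M_pos, where K = K])
  have "{T - b..T} \<subseteq> {t - b..T}" using controlled_t[OF x] by auto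
  then show "K-lipschitz_on {T - b..T} x" "K-lipschitz_on {T - b..T} y"
    "\<And>s. s \<in> {T - b..T} \<Longrightarrow> norm (x s) \<le> M" "\<And>s. s \<in> {T - b..T} \<Longrightarrow> norm (y s) \<le> M"
    using controlled_norm[OF x] controlled_norm[OF y]
    by (auto intro: lipschitz_on_subset[OF controlled_lip[OF x]] lipschitz_on_subset[OF controlled_lip[OF y]])
qed

lemma delayed_value_diff_majorant:
  assumes x: "controlled t w \<alpha> x" and y: "controlled t w \<beta> y" and s: "s \<in> {t..T}"
  shows "norm (x s - y s) + norm (x (delayed x s) - y (delayed y s))
    \<le> (1 + K * ltau) * norm (x s - y s) + norm (x (delayed x s) - y (delayed x s))"
  using delayed_value_diff[OF controlled_t(1)[OF x] s controlled_lip[OF y], of x] by (simp add: algebra_simps)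

text \<open>Running part: \<open>2 + K * ltau\<close> collects present state, shifted delay and
  delayed value over a horizon of at most \<open>T - t0\<close>. Terminal part: the value at
  \<open>T\<close> and the integral over a history of length \<open>b\<close>.\<close>

definition cost_const :: real where
  "cost_const = lL M * ((2 + K * ltau) * (T - t0)) + lg M * (1 + b)"

lemma cost_const_pos: "0 < cost_const"
proof -
  have "0 < lg M * (1 + b)" using lg_pos[OF M_pos] b_nonneg by simp
  moreover have "0 \<le> lL M * ((2 + K * ltau) * (T - t0))"
    using lL_pos[OF M_pos] K_nonneg ltau_pos t0_less_T by (intro mult_nonneg_nonneg) auto
  ultimately show ?thesis by (simp add: cost_const_def)
qed

lemma total_diff:
  assumes x: "controlled t w \<alpha> x" and y: "controlled t w \<beta> y" and \<gamma>: "ctl \<gamma>" and "0 \<le> e"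
    and d: "\<And>s. s \<in> {t - b..T} \<Longrightarrow> norm (x s - y s) \<le> e"
  shows "\<bar>total t x \<gamma> - total t y \<gamma>\<bar> \<le> cost_const * e"
proof -
  have t: "t0 \<le> t" "t \<le> T" using controlled_t[OF x] by auto
  have "\<bar>running t x \<gamma> - running t y \<gamma>\<bar> \<le> lL M * integral {t..T} (\<lambda>_. (2 + K * ltau) * e)"
  proof (rule running_diff[OF x y \<gamma>])
    fix s assume s: "s \<in> {t..T}"
    then have "s \<in> {t - b..T}" using b_nonneg by auto
    then have "(1 + K * ltau) * norm (x s - y s) + norm (x (delayed x s) - y (delayed x s))
        \<le> (1 + K * ltau) * e + e"
      using K_nonneg ltau_pos controlled_delayed_mem[OF x s] by (intro add_mono mult_left_mono d) auto
    then show "norm (x s - y s) + norm (x (delayed x s) - y (delayed y s)) \<le> (2 + K * ltau) * e"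
      using delayed_value_diff_majorant[OF x y s] by (simp add: algebra_simps)
  qed auto
  also have "\<dots> = lL M * ((2 + K * ltau) * (T - t)) * e" using t by simp
  also have "\<dots> \<le> lL M * ((2 + K * ltau) * (T - t0)) * e"
    using t K_nonneg ltau_pos lL_pos[OF M_pos] \<open>0 \<le> e\<close> by (intro mult_right_mono mult_left_mono) auto
  finally have 1: "\<bar>running t x \<gamma> - running t y \<gamma>\<bar> \<le> lL M * ((2 + K * ltau) * (T - t0)) * e" .
  have sub: "{T - b..T} \<subseteq> {t - b..T}" using t by auto
  have "integral {T - b..T} (\<lambda>s. norm (x s - y s)) \<le> integral {T - b..T} (\<lambda>_. e)"
    using sub d
    by (intro Henstock_Kurzweil_Integration.integral_le integrable_continuous_real continuous_intros
        continuous_on_subset[OF controlled_cont[OF x]] continuous_on_subset[OF controlled_cont[OF y]]) auto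
  then have "norm (x T - y T) + integral {T - b..T} (\<lambda>s. norm (x s - y s)) \<le> (1 + b) * e"
    using d[of T] t b_nonneg by (simp add: algebra_simps)
  then have "lg M * (norm (x T - y T) + integral {T - b..T} (\<lambda>s. norm (x s - y s))) \<le> lg M * ((1 + b) * e)"
    using lg_pos[OF M_pos] by (intro mult_left_mono) auto
  then have "\<bar>h x - h y\<bar> \<le> lg M * (1 + b) * e" using terminal_diff[OF x y] by simp
  moreover have "cost_const * e = lL M * ((2 + K * ltau) * (T - t0)) * e + lg M * (1 + b) * e"
    by (simp only: cost_const_def distrib_right)
  ultimately show ?thesis using 1 unfolding total_def by linarith
qed

end

text \<open>Termwise integration of the nonnegative series bounds the integral of its sum by a
  geometric series, so the sum is finite almost everywhere.\<close>

lemma AE_summable_of_integral_le_geometric: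
  fixes D :: "nat \<Rightarrow> real \<Rightarrow> real"
  assumes int: "\<And>k. D k integrable_on {p..q}" and nonneg: "\<And>k s. s \<in> {p..q} \<Longrightarrow> 0 \<le> D k s"
    and le: "\<And>k. integral {p..q} (D k) \<le> c * (1/2) ^ k"
  shows "\<exists>N. negligible N \<and> (\<forall>s\<in>{p..q} - N. summable (\<lambda>k. D k s))"
proof -
  let ?S = "lebesgue_on {p..q}"
  have abs: "integrable ?S (D k)" for k
  proof -
    have "D k absolutely_integrable_on {p..q}"
      using int nonneg by (intro nonnegative_absolutely_integrable_1) auto
    then show ?thesis by (simp add: set_integrable_def integrable_restrict_space)
  qed
  have eq: "(\<integral>\<^sup>+s. ennreal (D k s) \<partial>?S) = ennreal (integral {p..q} (D k))" for k
  proof -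
    have "(\<integral>\<^sup>+s. ennreal (D k s) \<partial>?S) = ennreal (integral\<^sup>L ?S (D k))"
      using nonneg by (intro nn_integral_eq_integral abs AE_I2) simp
    then show ?thesis using lebesgue_integral_eq_integral[OF abs] by simp
  qed
  have c: "0 \<le> c"
  proof -
    have "0 \<le> integral {p..q} (D 0)" using int nonneg by (intro Henstock_Kurzweil_Integration.integral_nonneg) auto
    then show ?thesis using le[of 0] by simp
  qed
  have "(\<integral>\<^sup>+s. (\<Sum>k. ennreal (D k s)) \<partial>?S) = (\<Sum>k. \<integral>\<^sup>+s. ennreal (D k s) \<partial>?S)"
    using abs by (intro nn_integral_suminf) (auto dest: borel_measurable_integrable)
  also have "\<dots> \<le> (\<Sum>k. ennreal (c * (1/2) ^ k))"
    unfolding eq using le by (intro suminf_le ennreal_leI) auto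
  also have "\<dots> = ennreal (\<Sum>k. c * (1/2) ^ k)"
    using c by (intro suminf_ennreal2 summable_mult summable_geometric) auto
  finally have "(\<integral>\<^sup>+s. (\<Sum>k. ennreal (D k s)) \<partial>?S) \<noteq> \<infinity>"
    by (metis ennreal_less_top infinity_ennreal_def leD)
  then have "AE s in ?S. (\<Sum>k. ennreal (D k s)) \<noteq> \<infinity>"
    using abs by (intro nn_integral_PInf_AE borel_measurable_suminf measurable_compose[OF _ measurable_ennreal])
      (auto dest: borel_measurable_integrable)
  then have "negligible {s \<in> {p..q}. \<not> (\<Sum>k. ennreal (D k s)) \<noteq> \<infinity>}"
    by (subst (asm) AE_lebesgue_on_iff_negligible) auto
  moreover have "\<forall>s\<in>{p..q} - {s \<in> {p..q}. \<not> (\<Sum>k. ennreal (D k s)) \<noteq> \<infinity>}. summable (\<lambda>k. D k s)"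
    using nonneg by (auto intro: summable_suminf_not_top)
  ultimately show ?thesis by blast
qed

text \<open>The \<open>L\<^sup>2\<close> bound turns into an \<open>L\<^sup>1\<close> bound by
  \<open>d \<le> 2\<^sup>-\<^sup>k + 2\<^sup>k d\<^sup>2\<close>.\<close>

lemma AE_convergent_of_L2_geometric:
  fixes u :: "nat \<Rightarrow> real \<Rightarrow> 'c::euclidean_space"
  assumes "p \<le> q"
    and int: "\<And>k. (\<lambda>s. norm (u (Suc k) s - u k s)) integrable_on {p..q}"
    and int2: "\<And>k. (\<lambda>s. (norm (u (Suc k) s - u k s))\<^sup>2) integrable_on {p..q}"
    and le: "\<And>k. integral {p..q} (\<lambda>s. (norm (u (Suc k) s - u k s))\<^sup>2) \<le> (1/4) ^ k"
  shows "\<exists>N. negligible N \<and> (\<forall>s\<in>{p..q} - N. convergent (\<lambda>k. u k s))"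
proof -
  let ?D = "\<lambda>k s. norm (u (Suc k) s - u k s)"
  have bound: "integral {p..q} (?D k) \<le> (q - p + 1) * (1/2) ^ k" for k
  proof -
    have pw: "2 ^ k * (1/2) ^ k = (1::real)" by (simp flip: power_mult_distrib)
    have amgm: "d \<le> a + B * d\<^sup>2" if "B * a = 1" "0 \<le> B" "0 \<le> d" for a B d :: real
    proof -
      have "0 \<le> B * (a - d)\<^sup>2" using that by simp
      also have "B * (a - d)\<^sup>2 = (B * a) * a - 2 * (B * a) * d + B * d\<^sup>2"
        by (simp add: power2_eq_square algebra_simps)
      finally show ?thesis using that by simp
    qed
    have "?D k s \<le> (1/2) ^ k + 2 ^ k * (?D k s)\<^sup>2" for s
      by (rule amgm[OF pw]) auto
    then have "integral {p..q} (?D k) \<le> integral {p..q} (\<lambda>s. (1/2) ^ k + 2 ^ k * (?D k s)\<^sup>2)"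
      by (intro Henstock_Kurzweil_Integration.integral_le int integrable_add integrable_on_mult_right int2) auto
    also have "\<dots> = (1/2) ^ k * (q - p) + 2 ^ k * integral {p..q} (\<lambda>s. (?D k s)\<^sup>2)"
      using \<open>p \<le> q\<close> int2
      by (subst Henstock_Kurzweil_Integration.integral_add) (auto intro: integrable_on_mult_right)
    also have "\<dots> \<le> (1/2) ^ k * (q - p) + 2 ^ k * (1/4) ^ k"
      by (intro add_left_mono mult_left_mono le) auto
    also have "2 ^ k * (1/4) ^ k = ((1/2) ^ k :: real)" by (simp flip: power_mult_distrib)
    finally show ?thesis by (simp add: algebra_simps)
  qed
  have conv: "convergent (\<lambda>n. u n s)" if "summable (\<lambda>k. ?D k s)" for s
  proof -
    have "summable (\<lambda>k. u (Suc k) s - u k s)" using that by (rule summable_norm_cancel)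
    then have "convergent (\<lambda>n. u n s - u 0 s)"
      unfolding summable_iff_convergent sum_lessThan_telescope[where f = "\<lambda>k. u k s"] .
    then show ?thesis by (simp only: convergent_diff_const_right_iff)
  qed
  have "\<exists>N. negligible N \<and> (\<forall>s\<in>{p..q} - N. summable (\<lambda>k. ?D k s))"
    by (rule AE_summable_of_integral_le_geometric[OF int _ bound]) simp
  then obtain N where N: "negligible N" "\<forall>s\<in>{p..q} - N. summable (\<lambda>k. ?D k s)" by (elim exE conjE)
  show ?thesis by (intro exI[of _ N] conjI ballI N(1) conv bspec[OF N(2)])
qed

section \<open>Compactness of states and strong convexity along minimizing sequences\<close>

context delay_control_data
begin

text \<open>Trajectory and cost see a control only through integrals over \<open>{t..T}\<close>, so
  a change on a null set leaves them as they are.\<close>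

lemma controlled_cong:
  assumes x: "controlled t w \<alpha> x" and \<beta>: "ctl \<beta>" and N: "negligible N" "\<And>s. s \<in> {t..T} - N \<Longrightarrow> \<beta> s = \<alpha> s"
  shows "controlled t w \<beta> x" "running t x \<beta> = running t x \<alpha>" "total t x \<beta> = total t x \<alpha>"
proof -
  have "integral {t..s} (\<lambda>s. G (\<beta> s)) = integral {t..s} (\<lambda>s. G (\<alpha> s))" if "s \<in> {t..T}" for s
    using that N(2) by (intro integral_spike[OF N(1)]) auto
  then show "controlled t w \<beta> x" using x \<beta> unfolding controlled_def sol_def by simp
  show "running t x \<beta> = running t x \<alpha>"
    unfolding running_def using N(2) by (intro integral_spike[OF N(1)]) auto
  then show "total t x \<beta> = total t x \<alpha>" by (simp add: total_def)
qed

lemma L_bounded: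
  "\<exists>B. \<forall>s\<in>{t0..T}. \<forall>z\<in>cball 0 M. \<forall>y\<in>cball 0 M. \<forall>a\<in>A. norm (L s z y a) \<le> B"
proof -
  let ?C = "{t0..T} \<times> cball 0 M \<times> cball 0 M \<times> A"
  have C: "compact ((\<lambda>(s, z, y, a). L s z y a) ` ?C)"
    by (rule compact_continuous_image[OF continuous_on_subset[OF L_cont]])
      (auto intro!: compact_Times A_compact)
  obtain B where "\<forall>v\<in>(\<lambda>(s, z, y, a). L s z y a) ` ?C. norm v \<le> B"
    using compact_imp_bounded[OF C] unfolding bounded_iff by blast
  then show ?thesis by force
qed

lemma total_bounded_below:
  assumes "init t w" shows "\<exists>B. \<forall>\<alpha> x. controlled t w \<alpha> x \<longrightarrow> B \<le> total t x \<alpha>"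
proof (cases "\<exists>\<alpha> x. controlled t w \<alpha> x")
  case True
  then obtain \<alpha>0 x0 where x0: "controlled t w \<alpha>0 x0" by blast
  obtain B where B: "\<forall>s\<in>{t0..T}. \<forall>z\<in>cball 0 M. \<forall>y\<in>cball 0 M. \<forall>a\<in>A. norm (L s z y a) \<le> B"
    using L_bounded by blast
  \<comment> \<open>Only differences of the terminal cost are bounded, so it is compared with that
    of the reference trajectory \<open>x0\<close>.\<close>
  have "- (B * (T - t)) + (h x0 - lg M * (2 * M + 2 * M * b)) \<le> total t x \<alpha>" if x: "controlled t w \<alpha> x" for \<alpha> x
  proof -
    have "norm (running t x \<alpha>) \<le> B * (T - t)"
      unfolding running_def
    proof (rule integral_norm_le_const)
      show "(\<lambda>s. L s (x s) (x (delayed x s)) (\<alpha> s)) integrable_on {t..T}"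
        by (rule controlled_L_integrable[OF x controlled_ctl[OF x]])
      show "t \<le> T" by (rule controlled_t[OF x])
      fix s assume s: "s \<in> {t..T}"
      then have "s \<in> {t - b..T}" using b_nonneg by auto
      then show "norm (L s (x s) (x (delayed x s)) (\<alpha> s)) \<le> B"
        using B s controlled_t[OF x] controlled_norm[OF x] controlled_delayed_norm[OF x s] ctl_mem[OF controlled_ctl[OF x]] by simp
    qed
    moreover have "norm (x T - x0 T) + integral {T - b..T} (\<lambda>s. norm (x s - x0 s)) \<le> 2 * M + 2 * M * b"
    proof (rule add_mono)
      have n: "norm (x s - x0 s) \<le> 2 * M" if "s \<in> {t - b..T}" for s
        using norm_triangle_ineq4[of "x s" "x0 s"] controlled_norm[OF x that] controlled_norm[OF x0 that] by simp
      have sub: "{T - b..T} \<subseteq> {t - b..T}" using controlled_t[OF x] by auto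
      show "norm (x T - x0 T) \<le> 2 * M" using n controlled_t[OF x] b_nonneg by simp
      have "integral {T - b..T} (\<lambda>s. norm (x s - x0 s)) \<le> integral {T - b..T} (\<lambda>_. 2 * M)"
        using sub n
        by (intro Henstock_Kurzweil_Integration.integral_le integrable_continuous_real continuous_intros
            continuous_on_subset[OF controlled_cont[OF x]] continuous_on_subset[OF controlled_cont[OF x0]]) auto
      then show "integral {T - b..T} (\<lambda>s. norm (x s - x0 s)) \<le> 2 * M * b"
        using b_nonneg by (simp add: mult_ac)
    qed
    then have "lg M * (norm (x T - x0 T) + integral {T - b..T} (\<lambda>s. norm (x s - x0 s)))
        \<le> lg M * (2 * M + 2 * M * b)"
      using lg_pos[OF M_pos] by (intro mult_left_mono) auto
    then have "\<bar>h x - h x0\<bar> \<le> lg M * (2 * M + 2 * M * b)" using terminal_diff[OF x x0] by linarith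
    ultimately show ?thesis unfolding total_def real_norm_def by linarith
  qed
  then show ?thesis by blast
qed blast

definition drift_const :: real where "drift_const = 1 + stab_rate K * (T - t0)"

lemma drift_const_pos: "0 < drift_const"
  unfolding drift_const_def using stab_rate_pos[OF K_nonneg] t0_less_T by (intro add_pos_nonneg) auto

text \<open>Converse of \<open>stability\<close>: the equation is solved for the primitive of
  \<open>G\<close>, so uniformly close states force close primitives. In this way compactness of the
  states controls the trajectories of averaged controls.\<close>

lemma G_integral_diff:
  assumes x: "controlled t w \<alpha> x" and y: "controlled t w \<beta> y" and s: "s \<in> {t..T}" and "0 \<le> e"
    and d: "\<And>s. s \<in> {t - b..T} \<Longrightarrow> norm (x s - y s) \<le> e"
  shows "norm (integral {t..s} (\<lambda>s. G (\<alpha> s)) - integral {t..s} (\<lambda>s. G (\<beta> s))) \<le> drift_const * e"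
proof -
  have int: "rate x integrable_on {t..s}" "rate y integrable_on {t..s}"
    using s controlled_t[OF x]
    by (auto intro!: rate_integrable[OF _ controlled_cont[OF x]] rate_integrable[OF _ controlled_cont[OF y]])
  have "norm (integral {t..s} (\<lambda>\<sigma>. rate x \<sigma> - rate y \<sigma>)) \<le> stab_rate K * e * (s - t)"
  proof (rule integral_norm_le_const)
    show "(\<lambda>\<sigma>. rate x \<sigma> - rate y \<sigma>) integrable_on {t..s}" using int by (rule integrable_diff)
    show "t \<le> s" using s by simp
    fix \<sigma> assume "\<sigma> \<in> {t..s}"
    then have \<sigma>: "\<sigma> \<in> {t..T}" "\<sigma> \<in> {t - b..T}" using s b_nonneg by auto
    show "norm (rate x \<sigma> - rate y \<sigma>) \<le> stab_rate K * e"
      by (rule rate_diff_majorant[OF controlled_t(1)[OF x] \<sigma>(1) controlled_lip[OF y]])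
        (use d \<sigma> controlled_delayed_mem[OF x \<sigma>(1)] in auto)
  qed
  also have "\<dots> \<le> stab_rate K * e * (T - t0)"
    using s controlled_t[OF x] stab_rate_pos[OF K_nonneg] \<open>0 \<le> e\<close> by (intro mult_left_mono) auto
  finally have 1: "norm (integral {t..s} (\<lambda>\<sigma>. rate x \<sigma> - rate y \<sigma>)) \<le> stab_rate K * e * (T - t0)" .
  have "x s = w 0 + integral {t..s} (rate x) + integral {t..s} (\<lambda>s. G (\<alpha> s))"
    "y s = w 0 + integral {t..s} (rate y) + integral {t..s} (\<lambda>s. G (\<beta> s))"
    using controlled_sol[OF x] controlled_sol[OF y] s by (simp_all add: sol_def)
  then have "integral {t..s} (\<lambda>s. G (\<alpha> s)) - integral {t..s} (\<lambda>s. G (\<beta> s))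
      = (x s - y s) - integral {t..s} (\<lambda>\<sigma>. rate x \<sigma> - rate y \<sigma>)"
    using int by (simp add: Henstock_Kurzweil_Integration.integral_diff)
  moreover have "norm (x s - y s) \<le> e" using d s b_nonneg by auto
  moreover have "drift_const * e = e + stab_rate K * e * (T - t0)"
    by (simp add: drift_const_def algebra_simps)
  ultimately show ?thesis
    using 1 norm_triangle_ineq4[of "x s - y s" "integral {t..s} (\<lambda>\<sigma>. rate x \<sigma> - rate y \<sigma>)"]
    by (simp only:)
qed

definition mid_const :: real where
  "mid_const = cost_const * (stab_const K * (drift_const / 2))"

lemma mid_const_pos: "0 < mid_const"
  using cost_const_pos stab_const_pos drift_const_pos by (simp add: mid_const_def)

text \<open>The midpoint inequality is integrated pointwise along one fixed state; \<open>m\<close>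
  need not be related to \<alpha> and \<beta>.\<close>

lemma running_mid:
  assumes m: "controlled t w \<gamma> m" and \<alpha>: "ctl \<alpha>" and \<beta>: "ctl \<beta>"
  shows "running t m (\<lambda>s. (1/2) *\<^sub>R (\<alpha> s + \<beta> s))
    \<le> (running t m \<alpha> + running t m \<beta>) / 2 - \<mu> / 8 * integral {t..T} (\<lambda>s. (norm (\<alpha> s - \<beta> s))\<^sup>2)"
proof -
  let ?L = "\<lambda>\<alpha> s. L s (m s) (m (delayed m s)) (\<alpha> s)"
  have int: "?L \<alpha> integrable_on {t..T}" "?L \<beta> integrable_on {t..T}"
    "?L (\<lambda>s. (1/2) *\<^sub>R (\<alpha> s + \<beta> s)) integrable_on {t..T}"
    by (rule controlled_L_integrable[OF m \<alpha>] controlled_L_integrable[OF m \<beta>] controlled_L_integrable[OF m ctl_mid[OF \<alpha> \<beta>]])+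
  have sq: "(\<lambda>s. (norm (\<alpha> s - \<beta> s))\<^sup>2) integrable_on {t..T}"
    by (rule ctl_diff_integrable[OF \<alpha> \<beta>]) (intro continuous_intros)
  let ?R = "\<lambda>s. (1/2) * ?L \<alpha> s + (1/2) * ?L \<beta> s - \<mu> / 8 * (norm (\<alpha> s - \<beta> s))\<^sup>2"
  have "running t m (\<lambda>s. (1/2) *\<^sub>R (\<alpha> s + \<beta> s)) \<le> integral {t..T} ?R"
    unfolding running_def
  proof (rule Henstock_Kurzweil_Integration.integral_le[OF int(3)])
    show "?R integrable_on {t..T}"
      by (intro integrable_diff integrable_add integrable_on_mult_right int sq)
    fix s assume "s \<in> {t..T}"
    then have "s \<in> {t0..T}" using controlled_t[OF m] by auto
    from L_strong[OF this ctl_mem[OF \<alpha>] ctl_mem[OF \<beta>], where z = "m s" and y = "m (delayed m s)"]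
    show "L s (m s) (m (delayed m s)) ((1/2) *\<^sub>R (\<alpha> s + \<beta> s)) \<le> ?R s" by (simp add: field_simps)
  qed
  also have "integral {t..T} ?R = (1/2) * running t m \<alpha> + (1/2) * running t m \<beta>
      - \<mu> / 8 * integral {t..T} (\<lambda>s. (norm (\<alpha> s - \<beta> s))\<^sup>2)"
  proof -
    have "integral {t..T} ?R = integral {t..T} (\<lambda>s. (1/2) * ?L \<alpha> s + (1/2) * ?L \<beta> s)
        - integral {t..T} (\<lambda>s. \<mu> / 8 * (norm (\<alpha> s - \<beta> s))\<^sup>2)"
      by (intro Henstock_Kurzweil_Integration.integral_diff integrable_add integrable_on_mult_right int sq)
    also have "integral {t..T} (\<lambda>s. (1/2) * ?L \<alpha> s + (1/2) * ?L \<beta> s)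
        = integral {t..T} (\<lambda>s. (1/2) * ?L \<alpha> s) + integral {t..T} (\<lambda>s. (1/2) * ?L \<beta> s)"
      by (intro Henstock_Kurzweil_Integration.integral_add integrable_on_mult_right int)
    finally show ?thesis by (simp only: running_def Henstock_Kurzweil_Integration.integral_mult_right)
  qed
  finally show ?thesis by (simp add: add_divide_distrib)
qed

text \<open>As \<open>G\<close> is affine on midpoints, the primitive for the averaged control is
  the average of the two primitives and lies at half their distance from each. Hence
  \<open>m\<close> is close to \<open>x\<close> and to \<open>y\<close>, and both costs can be moved
  to the state \<open>m\<close>, where \<open>running_mid\<close> applies. States are never
  averaged.\<close>

lemma total_mid:
  assumes x: "controlled t w \<alpha> x" and y: "controlled t w \<beta> y" and m: "controlled t w (\<lambda>s. (1/2) *\<^sub>R (\<alpha> s + \<beta> s)) m"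
    and "0 \<le> e" and d: "\<And>s. s \<in> {t - b..T} \<Longrightarrow> norm (x s - y s) \<le> e"
  shows "total t m (\<lambda>s. (1/2) *\<^sub>R (\<alpha> s + \<beta> s)) \<le> (total t x \<alpha> + total t y \<beta>) / 2
    - \<mu> / 8 * integral {t..T} (\<lambda>s. (norm (\<alpha> s - \<beta> s))\<^sup>2) + mid_const * e"
proof -
  note \<alpha> = controlled_ctl[OF x] and \<beta> = controlled_ctl[OF y]
  have U: "integral {t..s} (\<lambda>s. G ((1/2) *\<^sub>R (\<alpha> s + \<beta> s)))
      = (1/2) *\<^sub>R (integral {t..s} (\<lambda>s. G (\<alpha> s)) + integral {t..s} (\<lambda>s. G (\<beta> s)))" for s
    by (simp add: G_mid ctl_mem \<alpha> \<beta> Henstock_Kurzweil_Integration.integral_add G_ctl_integrable_on)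
  have half: "norm (integral {t..s} (\<lambda>s. G ((1/2) *\<^sub>R (\<alpha> s + \<beta> s))) - integral {t..s} (\<lambda>s. G (\<alpha> s)))
      \<le> drift_const / 2 * e"
    "norm (integral {t..s} (\<lambda>s. G ((1/2) *\<^sub>R (\<alpha> s + \<beta> s))) - integral {t..s} (\<lambda>s. G (\<beta> s)))
      \<le> drift_const / 2 * e" if s: "s \<in> {t..T}" for s
  proof -
    let ?a = "integral {t..s} (\<lambda>s. G (\<alpha> s))" and ?b = "integral {t..s} (\<lambda>s. G (\<beta> s))"
    have "(1/2) *\<^sub>R (?a + ?b) - ?a = - ((1/2) *\<^sub>R (?a - ?b))" "(1/2) *\<^sub>R (?a + ?b) - ?b = (1/2) *\<^sub>R (?a - ?b)"
      by (simp_all add: algebra_simps flip: scaleR_add_left)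
    then have "norm ((1/2) *\<^sub>R (?a + ?b) - ?a) = norm (?a - ?b) / 2"
      "norm ((1/2) *\<^sub>R (?a + ?b) - ?b) = norm (?a - ?b) / 2" by simp_all
    then show "norm (integral {t..s} (\<lambda>s. G ((1/2) *\<^sub>R (\<alpha> s + \<beta> s))) - ?a) \<le> drift_const / 2 * e"
      "norm (integral {t..s} (\<lambda>s. G ((1/2) *\<^sub>R (\<alpha> s + \<beta> s))) - ?b) \<le> drift_const / 2 * e"
      using G_integral_diff[OF x y s \<open>0 \<le> e\<close> d] U[of s] by simp_all
  qed
  let ?e = "stab_const K * (drift_const / 2 * e)"
  have e: "0 \<le> drift_const / 2 * e" using drift_const_pos \<open>0 \<le> e\<close> by simp
  then have e': "0 \<le> ?e" using stab_const_pos[of K] by simp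
  have "\<bar>total t m \<alpha> - total t x \<alpha>\<bar> \<le> cost_const * ?e"
    by (rule total_diff[OF m x \<alpha> e']) (rule controlled_stability[OF m x order_refl e half(1)])
  moreover have "\<bar>total t m \<beta> - total t y \<beta>\<bar> \<le> cost_const * ?e"
    by (rule total_diff[OF m y \<beta> e']) (rule controlled_stability[OF m y order_refl e half(2)])
  moreover have "cost_const * ?e = mid_const * e" by (simp add: mid_const_def)
  ultimately show ?thesis using running_mid[OF m \<alpha> \<beta>] unfolding total_def by argo
qed

lemma ctl_const: "a \<in> A \<Longrightarrow> ctl (\<lambda>_. a)"
  by (auto simp: ctl_def)

text \<open>The common bound \<open>M\<close> and Lipschitz constant \<open>K\<close> allow
  Arzela-Ascoli. The limit function is discarded: the uniform Cauchy property suffices, and the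
  optimal state is solved for afterwards.\<close>

lemma controlled_subsequence:
  assumes x: "\<And>k. controlled t w (\<alpha> k) (x k)"
  shows "\<exists>r :: nat \<Rightarrow> nat. strict_mono r \<and>
    (\<forall>e>0. \<exists>N. \<forall>j\<ge>N. \<forall>k\<ge>N. \<forall>s\<in>{t - b..T}. norm (x (r j) s - x (r k) s) \<le> e)"
proof -
  have equi: "\<exists>d>0. \<forall>n y. y \<in> {t - b..T} \<and> norm (s - y) < d \<longrightarrow> norm (x n s - x n y) < e"
    if "s \<in> {t - b..T}" "0 < e" for s e
  proof (intro exI conjI allI impI)
    show "0 < e / (K + 1)" using that K_nonneg by simp
    fix n y assume y: "y \<in> {t - b..T} \<and> norm (s - y) < e / (K + 1)"
    have "norm (x n s - x n y) \<le> K * norm (s - y)"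
      using lipschitz_on_normD[OF controlled_lip[OF x] that(1), of y] y by simp
    also have "\<dots> \<le> (K + 1) * norm (s - y)" by (intro mult_right_mono) auto
    also have "\<dots> < e" using y K_nonneg by (simp add: pos_less_divide_eq mult.commute)
    finally show "norm (x n s - x n y) < e" .
  qed
  obtain X and r :: "nat \<Rightarrow> nat" where r: "strict_mono r"
    and X: "\<And>e. 0 < e \<Longrightarrow> \<exists>N. \<forall>n s. N \<le> n \<and> s \<in> {t - b..T} \<longrightarrow> norm (x (r n) s - X s) < e"
    using Arzela_Ascoli[of "{t - b..T}" x M, OF compact_Icc controlled_norm[OF x] equi] by metis
  show ?thesis
  proof (intro exI[of _ r] conjI r allI impI)
    fix e :: real assume "0 < e"
    then obtain N where N: "\<And>n s. N \<le> n \<Longrightarrow> s \<in> {t - b..T} \<Longrightarrow> norm (x (r n) s - X s) < e / 2"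
      using X[of "e / 2"] by auto
    have "norm (x (r j) s - x (r k) s) \<le> e" if "N \<le> j" "N \<le> k" "s \<in> {t - b..T}" for j k s
      using N[OF that(1,3)] N[OF that(2,3)] norm_triangle_ineq4[of "x (r j) s - X s" "x (r k) s - X s"]
      by simp
    then show "\<exists>N. \<forall>j\<ge>N. \<forall>k\<ge>N. \<forall>s\<in>{t - b..T}. norm (x (r j) s - x (r k) s) \<le> e" by blast
  qed
qed

text \<open>The average of two late controls cannot undercut \<rho>, so the strong convexity term is
  at most the mean excess of the two costs plus the error of \<open>total_mid\<close>.\<close>

lemma minimizing_L2_Cauchy:
  assumes x: "\<And>k. controlled t w (\<alpha> k) (x k)"
    and inf: "\<And>\<beta> y. controlled t w \<beta> y \<Longrightarrow> \<rho> \<le> total t y \<beta>"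
    and near: "\<And>k. total t (x k) (\<alpha> k) \<le> \<rho> + 1 / (real k + 1)"
    and cauchy: "\<And>e. 0 < e \<Longrightarrow> \<exists>N. \<forall>j\<ge>N. \<forall>k\<ge>N. \<forall>s\<in>{t - b..T}. norm (x j s - x k s) \<le> e"
    and "0 < \<epsilon>"
  shows "\<exists>N. \<forall>j\<ge>N. \<forall>k\<ge>N. integral {t..T} (\<lambda>s. (norm (\<alpha> j s - \<alpha> k s))\<^sup>2) \<le> \<epsilon>"
proof -
  \<comment> \<open>Half of the budget \<open>\<mu> / 8 * \<epsilon>\<close> goes to
    \<open>mid_const * e\<close>, the other half to the distance of the costs from \<rho>.\<close>
  define e where "e = \<mu> * \<epsilon> / (16 * mid_const)"
  have e: "0 < e" using \<open>0 < \<epsilon>\<close> \<mu>_pos mid_const_pos by (simp add: e_def)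
  obtain N0 where N0: "\<forall>j\<ge>N0. \<forall>k\<ge>N0. \<forall>s\<in>{t - b..T}. norm (x j s - x k s) \<le> e"
    using cauchy[OF e] by blast
  obtain N1 where N1: "1 / (real N1 + 1) \<le> \<mu> * \<epsilon> / 16"
  proof -
    obtain n where "inverse (real (Suc n)) < \<mu> * \<epsilon> / 16"
      using reals_Archimedean[of "\<mu> * \<epsilon> / 16"] \<open>0 < \<epsilon>\<close> \<mu>_pos by auto
    then show ?thesis by (intro that[of n]) (simp add: inverse_eq_divide add.commute)
  qed
  have "integral {t..T} (\<lambda>s. (norm (\<alpha> j s - \<alpha> k s))\<^sup>2) \<le> \<epsilon>" if j: "max N0 N1 \<le> j" and k: "max N0 N1 \<le> k" for j k
  proof -
    let ?I = "integral {t..T} (\<lambda>s. (norm (\<alpha> j s - \<alpha> k s))\<^sup>2)"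
    have small: "total t (x i) (\<alpha> i) \<le> \<rho> + \<mu> * \<epsilon> / 16" if "max N0 N1 \<le> i" for i
    proof -
      have "1 / (real i + 1) \<le> 1 / (real N1 + 1)" using that by (intro divide_left_mono) auto
      then show ?thesis using near[of i] N1 by linarith
    qed
    have "init t w" using x[of 0] by (simp add: controlled_def)
    then obtain m where m: "controlled t w (\<lambda>s. (1/2) *\<^sub>R (\<alpha> j s + \<alpha> k s)) m"
      using controlled_exists ctl_mid[OF controlled_ctl[OF x] controlled_ctl[OF x]] by blast
    have "\<rho> \<le> (total t (x j) (\<alpha> j) + total t (x k) (\<alpha> k)) / 2 - \<mu> / 8 * ?I + mid_const * e"
      using N0 j k e by (intro order_trans[OF inf[OF m] total_mid[OF x x m]]) auto
    also have "mid_const * e = \<mu> * \<epsilon> / 16" using mid_const_pos by (simp add: e_def)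
    finally have "\<mu> / 8 * ?I \<le> \<mu> / 8 * \<epsilon>" using small[OF j] small[OF k] by (simp add: field_simps)
    then show ?thesis using \<mu>_pos by simp
  qed
  then show ?thesis by blast
qed

text \<open>Replacing \<open>x k\<close> by \<open>y\<close> under the fixed control
  \<open>v k\<close> costs a multiple of the integral of
  \<open>norm (G (v k s) - G (\<alpha> s))\<close>; replacing \<open>v k\<close> by \<alpha> along
  the fixed state \<open>y\<close> is dominated convergence.\<close>

lemma total_limit_le:
  assumes x: "\<And>k. controlled t w (v k) (x k)" and y: "controlled t w \<alpha> y"
    and lim: "\<And>s. (\<lambda>k. v k s) \<longlonglongrightarrow> \<alpha> s"
    and cost: "(\<lambda>k. c k) \<longlonglongrightarrow> \<rho>" "\<And>k. total t (x k) (v k) \<le> c k"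
  shows "total t y \<alpha> \<le> \<rho>"
proof -
  note v = controlled_ctl[OF x] and \<alpha> = controlled_ctl[OF y]
  let ?d = "\<lambda>k s. norm (G (v k s) - G (\<alpha> s))"
  have dint: "?d k integrable_on {p..q}" for k p q
    using set_integral_diff(1)[OF G_ctl_integrable[OF v] G_ctl_integrable[OF \<alpha>]]
    by (auto simp: absolutely_integrable_on_def intro: set_lebesgue_integral_eq_integral(1) absolutely_integrable_norm)
  have "(\<lambda>k. integral {t..T} (?d k)) \<longlonglongrightarrow> integral {t..T} (\<lambda>_. 0)"
  proof (rule dominated_convergence[OF dint])
    show "(\<lambda>_. 2 * cu) integrable_on {t..T}" by (rule integrable_const_ivl)
    show "norm (?d k s) \<le> 2 * cu" for k s
      using norm_triangle_ineq4[of "G (v k s)" "G (\<alpha> s)"] G_bound[OF ctl_mem[OF v], of k s]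
        G_bound[OF ctl_mem[OF \<alpha>], of s] by simp
    fix s
    have "(\<lambda>k. G (v k s)) \<longlonglongrightarrow> G (\<alpha> s)"
      by (rule continuous_on_tendsto_compose[OF G_cont lim]) (use ctl_mem[OF v] ctl_mem[OF \<alpha>] in simp_all)
    then have "(\<lambda>k. ?d k s) \<longlonglongrightarrow> norm (G (\<alpha> s) - G (\<alpha> s))" by (intro tendsto_intros)
    then show "(\<lambda>k. ?d k s) \<longlonglongrightarrow> 0" by simp
  qed
  then have E: "(\<lambda>k. integral {t..T} (?d k)) \<longlonglongrightarrow> 0" by simp
  have state: "\<bar>total t (x k) (v k) - total t y (v k)\<bar> \<le> cost_const * (stab_const K * integral {t..T} (?d k))" for k
  proof -
    have E0: "0 \<le> integral {t..T} (?d k)" by (intro Henstock_Kurzweil_Integration.integral_nonneg dint) auto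
    have dE: "norm (integral {t..s} (\<lambda>s. G (v k s)) - integral {t..s} (\<lambda>s. G (\<alpha> s))) \<le> integral {t..T} (?d k)"
      if "s \<in> {t..T}" for s
    proof -
      have "integral {t..s} (\<lambda>s. G (v k s)) - integral {t..s} (\<lambda>s. G (\<alpha> s))
          = integral {t..s} (\<lambda>s. G (v k s) - G (\<alpha> s))"
        by (intro Henstock_Kurzweil_Integration.integral_diff[symmetric] G_ctl_integrable_on v \<alpha>)
      also have "norm \<dots> \<le> integral {t..s} (?d k)"
        by (intro Henstock_Kurzweil_Integration.integral_norm_bound_integral integrable_diff
            G_ctl_integrable_on v \<alpha> dint) auto
      also have "\<dots> \<le> integral {t..T} (?d k)"
        using that by (intro integral_subset_le dint) auto
      finally show ?thesis .
    qed
    show ?thesis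
      using stab_const_pos[of K] E0
      by (intro total_diff[OF x y v] controlled_stability[OF x y order_refl E0 dE]) auto
  qed
  obtain B where B: "\<forall>s\<in>{t0..T}. \<forall>z\<in>cball 0 M. \<forall>y\<in>cball 0 M. \<forall>a\<in>A. norm (L s z y a) \<le> B"
    using L_bounded by blast
  have "(\<lambda>k. running t y (v k)) \<longlonglongrightarrow> running t y \<alpha>"
    unfolding running_def
  proof (rule dominated_convergence[OF controlled_L_integrable[OF y v]])
    show "(\<lambda>_. B) integrable_on {t..T}" by (rule integrable_const_ivl)
    fix s assume s: "s \<in> {t..T}"
    then have s': "s \<in> {t0..T}" "s \<in> {t - b..T}" using controlled_t[OF y] b_nonneg by auto
    show "norm (L s (y s) (y (delayed y s)) (v k s)) \<le> B" for k
      using B s' controlled_norm[OF y s'(2)] controlled_delayed_norm[OF y s] ctl_mem[OF v] by simp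
    have "continuous_on A (\<lambda>a. (\<lambda>(s, z, y, a). L s z y a) (s, y s, y (delayed y s), a))"
      by (rule continuous_on_compose2[OF L_cont]) (use s' in \<open>auto intro!: continuous_intros\<close>)
    then have "continuous_on A (\<lambda>a. L s (y s) (y (delayed y s)) a)" by simp
    then show "(\<lambda>k. L s (y s) (y (delayed y s)) (v k s)) \<longlonglongrightarrow> L s (y s) (y (delayed y s)) (\<alpha> s)"
      by (rule continuous_on_tendsto_compose[OF _ lim]) (use ctl_mem[OF v] ctl_mem[OF \<alpha>] in simp_all)
  qed
  then have "(\<lambda>k. total t y (v k)) \<longlonglongrightarrow> total t y \<alpha>"
    unfolding total_def by (intro tendsto_intros)
  moreover have "(\<lambda>k. c k + cost_const * (stab_const K * integral {t..T} (?d k))) \<longlonglongrightarrow> \<rho> + cost_const * (stab_const K * 0)"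
    by (intro tendsto_intros cost E)
  moreover have "total t y (v k) \<le> c k + cost_const * (stab_const K * integral {t..T} (?d k))" for k
    using state[of k] cost(2)[of k] by linarith
  ultimately have "total t y \<alpha> \<le> \<rho> + cost_const * (stab_const K * 0)"
    by (intro LIMSEQ_le[where X = "\<lambda>k. total t y (v k)"]) auto
  then show ?thesis by simp
qed

theorem optimal_exists:
  assumes init: "init t w" shows "\<exists>\<alpha> x. optimal t w \<alpha> x"
proof -
  define S where "S = {total t x \<alpha> |\<alpha> x. controlled t w \<alpha> x}"
  obtain a0 where a0: "a0 \<in> A" using A_ne by blast
  have "S \<noteq> {}" using controlled_exists[OF init ctl_const[OF a0]] by (auto simp: S_def)
  obtain B where "\<forall>\<alpha> x. controlled t w \<alpha> x \<longrightarrow> B \<le> total t x \<alpha>" using total_bounded_below[OF init] by blast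
  then have "bdd_below S" by (auto simp: S_def bdd_below_def)
  define \<rho> where "\<rho> = Inf S"
  have inf: "\<rho> \<le> total t y \<beta>" if "controlled t w \<beta> y" for \<beta> y
    unfolding \<rho>_def using that \<open>bdd_below S\<close> by (intro cInf_lower) (auto simp: S_def)
  have "\<exists>\<alpha> x. controlled t w \<alpha> x \<and> total t x \<alpha> < \<rho> + 1 / (real k + 1)" for k
  proof -
    have "Inf S < \<rho> + 1 / (real k + 1)" by (simp add: \<rho>_def add_pos_nonneg)
    then obtain c where "c \<in> S" "c < \<rho> + 1 / (real k + 1)"
      using cInf_lessD[OF \<open>S \<noteq> {}\<close>] by blast
    then show ?thesis by (auto simp: S_def)
  qed
  then obtain \<alpha>' x' where seq: "\<And>k. controlled t w (\<alpha>' k) (x' k)"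
    and near': "\<And>k. total t (x' k) (\<alpha>' k) < \<rho> + 1 / (real k + 1)" by metis
  obtain r where r: "strict_mono (r :: nat \<Rightarrow> nat)" and cauchy:
    "\<And>e. 0 < e \<Longrightarrow> \<exists>N. \<forall>j\<ge>N. \<forall>k\<ge>N. \<forall>s\<in>{t - b..T}. norm (x' (r j) s - x' (r k) s) \<le> e"
    using controlled_subsequence[of t w \<alpha>' x', OF seq] by blast
  define \<alpha> where "\<alpha> k = \<alpha>' (r k)" for k
  define x where "x k = x' (r k)" for k
  have x: "controlled t w (\<alpha> k) (x k)" for k unfolding x_def \<alpha>_def by (rule seq)
  have near: "total t (x k) (\<alpha> k) \<le> \<rho> + 1 / (real k + 1)" for k
  proof -
    have "1 / (real (r k) + 1) \<le> 1 / (real k + 1)"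
      using seq_suble[OF r, of k] by (intro divide_left_mono) auto
    then show ?thesis using near'[of "r k"] unfolding x_def \<alpha>_def by linarith
  qed
  have "\<exists>N. \<forall>j\<ge>N. \<forall>k\<ge>N. integral {t..T} (\<lambda>s. (norm (\<alpha> j s - \<alpha> k s))\<^sup>2) \<le> (1/4) ^ i" for i
    using cauchy by (intro minimizing_L2_Cauchy[OF x inf near]) (auto simp: x_def)
  then obtain Nf where Nf: "\<And>i j k. Nf i \<le> j \<Longrightarrow> Nf i \<le> k \<Longrightarrow>
      integral {t..T} (\<lambda>s. (norm (\<alpha> j s - \<alpha> k s))\<^sup>2) \<le> (1/4) ^ i" by metis
  \<comment> \<open>The sum of all thresholds up to \<open>k\<close> makes \<open>q k\<close> and
    \<open>q (Suc k)\<close> at least \<open>Nf k\<close>; the summand \<open>k\<close> keeps the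
    costs converging to \<rho>.\<close>
  define q where "q k = k + (\<Sum>i\<le>k. Nf i)" for k
  have q: "Nf k \<le> q k" "k \<le> q k" "Nf k \<le> q (Suc k)" for k
    using member_le_sum[of k "{..k}" Nf] by (auto simp: q_def)
  note ctl\<alpha> = controlled_ctl[OF x]
  have "\<exists>N. negligible N \<and> (\<forall>s\<in>{t..T} - N. convergent (\<lambda>k. \<alpha> (q k) s))"
    using controlled_t[OF x] q Nf
    by (intro AE_convergent_of_L2_geometric ctl_diff_integrable[OF ctl\<alpha> ctl\<alpha>, where k = norm]
        ctl_diff_integrable[OF ctl\<alpha> ctl\<alpha>, where k = "\<lambda>v. (norm v)\<^sup>2"] continuous_intros) auto
  then obtain N where N: "negligible N" "\<forall>s\<in>{t..T} - N. convergent (\<lambda>k. \<alpha> (q k) s)" by (elim exE conjE)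
  \<comment> \<open>Outside the set of convergence the controls are set to \<open>a0\<close>, so
    that the sequence converges everywhere; its limit is then measurable and stays in the closed set
    \<open>A\<close>.\<close>
  define v where "v k s = (if s \<in> {t..T} - N then \<alpha> (q k) s else a0)" for k s
  define \<beta> where "\<beta> s = lim (\<lambda>k. v k s)" for s
  have lim: "(\<lambda>k. v k s) \<longlonglongrightarrow> \<beta> s" for s
  proof -
    have "convergent (\<lambda>k. v k s)" using N(2) by (cases "s \<in> {t..T} - N") (auto simp: v_def convergent_const)
    then show ?thesis by (simp add: \<beta>_def convergent_LIMSEQ_iff)
  qed
  have v: "ctl (v k)" for k
  proof -
    have "v k \<in> borel_measurable lebesgue"
      unfolding v_def using ctl\<alpha> negligible_imp_sets[OF N(1)]
      by (intro measurable_If_set) (auto simp: ctl_def)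
    then show ?thesis using ctl_mem[OF ctl\<alpha>] a0 by (auto simp: ctl_def v_def)
  qed
  have "\<beta> \<in> borel_measurable lebesgue"
  proof (rule borel_measurable_LIMSEQ_metric[OF _ lim])
    show "v k \<in> borel_measurable lebesgue" for k using v[of k] by (simp add: ctl_def)
  qed
  moreover have "\<beta> s \<in> A" for s
    by (rule closed_sequentially[OF compact_imp_closed[OF A_compact] ctl_mem[OF v] lim])
  ultimately have "ctl \<beta>" by (auto simp: ctl_def)
  then obtain y where y: "controlled t w \<beta> y" using controlled_exists[OF init] by blast
  have vx: "controlled t w (v k) (x (q k))" "total t (x (q k)) (v k) = total t (x (q k)) (\<alpha> (q k))" for k
    by (rule controlled_cong[OF x v N(1)]; simp add: v_def)+
  have "total t y \<beta> \<le> \<rho>"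
  proof (rule total_limit_le[OF vx(1) y lim])
    have "(\<lambda>k. 1 / (real k + 1)) \<longlonglongrightarrow> 0"
      using LIMSEQ_inverse_real_of_nat by (simp add: inverse_eq_divide add.commute)
    from tendsto_add[OF tendsto_const this] show "(\<lambda>k. \<rho> + 1 / (real k + 1)) \<longlonglongrightarrow> \<rho>" by simp
    fix k
    have "1 / (real (q k) + 1) \<le> 1 / (real k + 1)" using q(2)[of k] by (intro divide_left_mono) auto
    then show "total t (x (q k)) (v k) \<le> \<rho> + 1 / (real k + 1)" using near[of "q k"] vx(2)[of k] by linarith
  qed
  then have "optimal t w \<beta> y"
    unfolding optimal_def using y inf init by (fastforce simp: controlled_def)
  then show ?thesis by blast
qed

end

subsection \<open>Regularity of optimal controls\<close>

text \<open>A compact set of reals whose points are at most \<open>l\<close> apart lies in an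
  interval of length \<open>l\<close> that starts at its minimum.\<close>

lemma integral_indicator_compact_le:
  fixes S :: "real set"
  assumes "compact S" and "0 \<le> l" and "\<And>p q. \<lbrakk>p \<in> S; q \<in> S; p \<le> q\<rbrakk> \<Longrightarrow> q - p \<le> l"
  shows "(\<lambda>s. if s \<in> S then 1 else 0 :: real) integrable_on {c..d}"
    and "integral {c..d} (\<lambda>s. if s \<in> S then 1 else 0 :: real) \<le> l"
proof -
  have meas: "S \<inter> {c..d} \<in> lmeasurable"
    using \<open>compact S\<close> by (intro lmeasurable_compact) (simp add: compact_Int)
  then show "(\<lambda>s. if s \<in> S then 1 else 0 :: real) integrable_on {c..d}"
    by (simp add: integrable_restrict_Int lmeasurable_iff_integrable_on)
  have "integral {c..d} (\<lambda>s. if s \<in> S then 1 else 0 :: real) = measure lebesgue (S \<inter> {c..d})"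
    using meas by (simp add: integral_restrict_Int lmeasure_integral)
  also have "\<dots> \<le> l"
  proof (cases "S = {}")
    case True then show ?thesis using \<open>0 \<le> l\<close> by simp
  next
    case False
    then obtain m where m: "m \<in> S" "\<And>s. s \<in> S \<Longrightarrow> m \<le> s"
      using compact_attains_inf[OF \<open>compact S\<close>] by blast
    have "S \<inter> {c..d} \<subseteq> {m..m + l}" using assms(3)[OF m(1)] m(2) by (auto simp: algebra_simps)
    then have "measure lebesgue (S \<inter> {c..d}) \<le> measure lebesgue {m..m + l}"
      using meas by (intro measure_mono_fmeasurable) (auto simp: fmeasurableD)
    then show ?thesis using \<open>0 \<le> l\<close> by simp
  qed
  finally show "integral {c..d} (\<lambda>s. if s \<in> S then 1 else 0 :: real) \<le> l" .
qed

section \<open>Effect of a localized change of the primitive on state and cost\<close>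

context delay_control_data
begin

text \<open>The delayed time advances at least at speed \<open>dd R\<close>, so it stays in an
  interval \<open>{p..e}\<close> for at most \<open>dwell * (e - p)\<close>.\<close>

definition dwell :: real where "dwell = 1 / dd R"

lemma dwell_pos: "0 < dwell"
  using dd_pos[OF R_pos] by (simp add: dwell_def)

lemma delayed_expanding:
  assumes x: "controlled t w \<alpha> x" and "t \<le> p" "p \<le> q" "q \<le> T"
  shows "q - p \<le> dwell * (delayed x q - delayed x p)"
proof -
  have "dd R * (q - p) \<le> delayed x q - delayed x p"
    using x assms(2-) unfolding controlled_def init_def ctl_def by (intro delayed_mono[OF R_pos]) auto
  then show ?thesis using dd_pos[OF R_pos] by (simp add: dwell_def field_simps)
qed

definition window :: "(real \<Rightarrow> 'a) \<Rightarrow> real \<Rightarrow> real \<Rightarrow> real \<Rightarrow> real set" where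
  "window x t p e = {\<sigma> \<in> {t..T}. delayed x \<sigma> \<in> {p..e}}"

lemma
  assumes x: "controlled t w \<alpha> x" and "p \<le> e"
  shows window_integrable: "(\<lambda>s. if s \<in> window x t p e then 1 else 0 :: real) integrable_on {c..d}"
    and window_integral: "integral {c..d} (\<lambda>s. if s \<in> window x t p e then 1 else 0 :: real) \<le> dwell * (e - p)"
proof -
  have "continuous_on {t..T} (delayed x)" by (rule delayed_cont[OF controlled_t(1)[OF x] controlled_cont'[OF x]])
  then have "closed (window x t p e)"
    unfolding window_def using continuous_closed_preimage[of "{t..T}" "delayed x" "{p..e}"]
    by (simp add: vimage_def Int_def)
  moreover have "bounded (window x t p e)"
    by (rule bounded_subset[of "{t..T}"]) (auto simp: window_def)
  ultimately have c: "compact (window x t p e)" by (simp add: compact_eq_bounded_closed)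
  have l: "0 \<le> dwell * (e - p)" using dwell_pos \<open>p \<le> e\<close> by simp
  have "q' - p' \<le> dwell * (e - p)" if "p' \<in> window x t p e" "q' \<in> window x t p e" "p' \<le> q'" for p' q'
  proof -
    have "q' - p' \<le> dwell * (delayed x q' - delayed x p')"
      using that by (intro delayed_expanding[OF x]) (auto simp: window_def)
    also have "\<dots> \<le> dwell * (e - p)"
      using that dwell_pos by (intro mult_left_mono) (auto simp: window_def)
    finally show ?thesis .
  qed
  from integral_indicator_compact_le[OF c l this]
  show "(\<lambda>s. if s \<in> window x t p e then 1 else 0 :: real) integrable_on {c..d}"
    "integral {c..d} (\<lambda>s. if s \<in> window x t p e then 1 else 0 :: real) \<le> dwell * (e - p)" by auto
qed

text \<open>\<open>stab_rate K\<close> comes from the rates between \<open>p\<close> and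
  \<open>e\<close>, \<open>lF * dwell\<close> from delayed arguments that meet this interval after
  \<open>e\<close>. The inner \<open>stab_const K\<close> is the size of the disturbance there, the
  outer one the Gronwall factor.\<close>

definition tail_const :: real where
  "tail_const = stab_const K * ((stab_rate K + lF * dwell) * stab_const K)"

lemma tail_const_pos: "0 < tail_const"
proof -
  have "0 < stab_rate K + lF * dwell"
    using stab_rate_pos[OF K_nonneg] lF_pos dwell_pos by (intro add_pos_pos mult_pos_pos)
  then show ?thesis using stab_const_pos[of K] by (simp add: tail_const_def)
qed

text \<open>The terms with \<open>tail_const\<close> come from the small displacement allowed
  everywhere, the others from the larger displacement met at evaluation times in
  \<open>{p..e}\<close>.\<close>

definition pert_const :: real where
  "pert_const = lL M * ((2 + K * ltau) * tail_const * (T - t0) + (1 + K * ltau) * stab_const K + stab_const K * dwell)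
     + lg M * (tail_const * (1 + b) + stab_const K)"

section \<open>Controls whose primitives of \<open>G\<close> differ only between \<open>p\<close>
  and \<open>e\<close>\<close>

context
  fixes t w \<alpha> \<beta> x y p e E
  assumes x: "controlled t w \<alpha> x" and y: "controlled t w \<beta> y" and pe: "t \<le> p" "p \<le> e" "e \<le> T" and E: "0 \<le> E"
    and U: "\<And>s. s \<in> {t..T} \<Longrightarrow>
      norm (integral {t..s} (\<lambda>s. G (\<alpha> s)) - integral {t..s} (\<lambda>s. G (\<beta> s))) \<le> E"
    and U_before: "\<And>s. s \<in> {t..p} \<Longrightarrow>
      integral {t..s} (\<lambda>s. G (\<alpha> s)) = integral {t..s} (\<lambda>s. G (\<beta> s))"
    and U_after: "\<And>s. s \<in> {e..T} \<Longrightarrow>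
      integral {t..s} (\<lambda>s. G (\<alpha> s)) = integral {t..s} (\<lambda>s. G (\<beta> s))"
begin

lemma perturbed_before: "s \<in> {t - b..p} \<Longrightarrow> x s = y s"
  using controlled_stability[OF x y, of p 0 s] U_before pe by simp

lemma perturbed_during: "s \<in> {t - b..T} \<Longrightarrow> norm (x s - y s) \<le> stab_const K * E"
  by (rule controlled_stability[OF x y order_refl E U])

text \<open>From \<open>e\<close> on the primitives agree, so only rate differences remain: zero
  before \<open>p\<close>, and \<open>O(E)\<close> during a time \<open>e - p\<close> up to
  \<open>e\<close>. Later a delayed argument lies before \<open>p\<close>, or after \<open>e\<close>
  under the majorant, or in the window, whose total duration is at most
  \<open>dwell * (e - p)\<close>. The Gronwall argument therefore starts at
  \<open>e\<close>.\<close>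

lemma perturbed_after:
  assumes s: "s \<in> {e..T}" shows "norm (x s - y s) \<le> tail_const * E * (e - p)"
proof -
  let ?B = "(stab_rate K + lF * dwell) * stab_const K * E * (e - p)"
  have B: "0 \<le> ?B"
    using stab_rate_pos[OF K_nonneg] lF_pos dwell_pos stab_const_pos[of K] E pe by simp
  have "norm (x s - y s) \<le> 2 * ?B * exp (2 * stab_rate K * (s - e))"
  proof (rule gronwall_monotone_majorant[OF _ stab_rate_pos[OF K_nonneg] B s])
    have "{e..T} \<subseteq> {t..T}" using pe by auto
    then show "continuous_on {e..T} (\<lambda>s. norm (x s - y s))"
      by (intro continuous_intros continuous_on_subset[OF controlled_cont'[OF x]] continuous_on_subset[OF controlled_cont'[OF y]])
  next
    fix s \<Phi> assume s: "s \<in> {e..T}" and \<Phi>: "continuous_on {e..s} \<Phi>" "mono_on {e..s} \<Phi>"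
      "\<And>\<sigma>. \<sigma> \<in> {e..s} \<Longrightarrow> 0 \<le> \<Phi> \<sigma>" "\<And>\<sigma>. \<sigma> \<in> {e..s} \<Longrightarrow> norm (x \<sigma> - y \<sigma>) \<le> \<Phi> \<sigma>"
    let ?r = "\<lambda>\<sigma>. rate x \<sigma> - rate y \<sigma>"
    let ?W = "\<lambda>\<sigma>. if \<sigma> \<in> window x t p e then 1 else 0 :: real"
    have intx: "rate x integrable_on {c..d}" and inty: "rate y integrable_on {c..d}"
      if "t \<le> c" "d \<le> T" for c d
      using that by (auto intro!: rate_integrable[OF controlled_t(1)[OF x] controlled_cont[OF x]]
          rate_integrable[OF controlled_t(1)[OF x] controlled_cont[OF y]])
    have int: "?r integrable_on {c..d}" if "t \<le> c" "d \<le> T" for c d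
      using intx[OF that] inty[OF that] by (rule integrable_diff)
    have before: "norm (integral {t..p} ?r) \<le> 0 * (p - t)"
    proof (rule integral_norm_le_const[OF int])
      fix \<sigma> assume \<sigma>: "\<sigma> \<in> {t..p}"
      then have \<sigma>': "\<sigma> \<in> {t..T}" "\<sigma> \<in> {t0..T}" using pe controlled_t[OF x] by auto
      have "norm (x \<sigma> - y \<sigma>) \<le> 0" "norm (x (delayed x \<sigma>) - y (delayed x \<sigma>)) \<le> 0"
        using perturbed_before[of \<sigma>] perturbed_before[of "delayed x \<sigma>"] \<sigma> b_nonneg
          controlled_delayed_mem[OF x \<sigma>'(1)] delayed_bounds(2)[OF \<sigma>'(2), of x] by auto
      from rate_diff_majorant[OF controlled_t(1)[OF x] \<sigma>'(1) controlled_lip[OF y] this]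
      show "norm (?r \<sigma>) \<le> 0" by simp
    qed (use pe in auto)
    have during: "norm (integral {p..e} ?r) \<le> stab_rate K * (stab_const K * E) * (e - p)"
    proof (rule integral_norm_le_const[OF int])
      fix \<sigma> assume "\<sigma> \<in> {p..e}"
      then have \<sigma>: "\<sigma> \<in> {t..T}" "\<sigma> \<in> {t - b..T}" using pe b_nonneg by auto
      show "norm (?r \<sigma>) \<le> stab_rate K * (stab_const K * E)"
        by (rule rate_diff_majorant[OF controlled_t(1)[OF x] \<sigma>(1) controlled_lip[OF y]
              perturbed_during[OF \<sigma>(2)] perturbed_during[OF controlled_delayed_mem[OF x \<sigma>(1)]]])
    qed (use pe in auto)
    have Wint: "(\<lambda>\<sigma>. lF * (stab_const K * E) * ?W \<sigma>) integrable_on {e..s}"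
      by (intro integrable_on_mult_right window_integrable[OF x pe(2)])
    have \<Phi>int: "(\<lambda>\<sigma>. stab_rate K * \<Phi> \<sigma>) integrable_on {e..s}"
      by (intro integrable_continuous_real continuous_intros \<Phi>)
    have "norm (integral {e..s} ?r) \<le> integral {e..s} (\<lambda>\<sigma>. stab_rate K * \<Phi> \<sigma> + lF * (stab_const K * E) * ?W \<sigma>)"
    proof (rule Henstock_Kurzweil_Integration.integral_norm_bound_integral)
      show "?r integrable_on {e..s}" using pe s by (intro int) auto
      show "(\<lambda>\<sigma>. stab_rate K * \<Phi> \<sigma> + lF * (stab_const K * E) * ?W \<sigma>) integrable_on {e..s}"
        by (rule integrable_add[OF \<Phi>int Wint])
      fix \<sigma> assume \<sigma>: "\<sigma> \<in> {e..s}"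
      then have \<sigma>': "\<sigma> \<in> {t..T}" "\<sigma> \<in> {t0..T}" using pe s controlled_t[OF x] by auto
      let ?d = "delayed x \<sigma>"
      have dmem: "?d \<in> {t - b..T}" "?d \<le> \<sigma>"
        using controlled_delayed_mem[OF x \<sigma>'(1)] delayed_bounds(2)[OF \<sigma>'(2)] by auto
      have CE: "0 \<le> stab_const K * E" using stab_const_pos[of K] E by simp
      have d: "norm (x ?d - y ?d) \<le> \<Phi> \<sigma> + stab_const K * E * ?W \<sigma>"
      proof -
        consider "?d \<le> p" | "?d \<in> {p..e}" | "e \<le> ?d" by force
        then show ?thesis
        proof cases
          case 1
          then have "x ?d = y ?d" using dmem by (intro perturbed_before) auto
          then show ?thesis using \<Phi>(3)[OF \<sigma>] CE by simp
        next
          case 2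
          then have "?W \<sigma> = 1" using \<sigma>' by (simp add: window_def)
          then show ?thesis using perturbed_during[OF dmem(1)] \<Phi>(3)[OF \<sigma>] by simp
        next
          case 3
          then have d: "?d \<in> {e..s}" using dmem \<sigma> by auto
          then have "norm (x ?d - y ?d) \<le> \<Phi> \<sigma>"
            using \<Phi>(4)[OF d] mono_onD[OF \<Phi>(2) d \<sigma> dmem(2)] by simp
          then show ?thesis using CE by (simp add: add_increasing2)
        qed
      qed
      have "norm (?r \<sigma>) \<le> lF * (1 + K * ltau) * norm (x \<sigma> - y \<sigma>) + lF * norm (x ?d - y ?d)"
        by (rule rate_diff[OF controlled_t(1)[OF x] \<sigma>'(1) controlled_lip[OF y]])
      also have "\<dots> \<le> lF * (1 + K * ltau) * \<Phi> \<sigma> + lF * (\<Phi> \<sigma> + stab_const K * E * ?W \<sigma>)"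
        using lF_pos ltau_pos K_nonneg by (intro add_mono mult_left_mono \<Phi>(4) \<sigma> d) auto
      also have "\<dots> = stab_rate K * \<Phi> \<sigma> + lF * (stab_const K * E) * ?W \<sigma>"
        by (simp add: stab_rate_def algebra_simps)
      finally show "norm (?r \<sigma>) \<le> stab_rate K * \<Phi> \<sigma> + lF * (stab_const K * E) * ?W \<sigma>" .
    qed
    also have "\<dots> = stab_rate K * integral {e..s} \<Phi> + lF * (stab_const K * E) * integral {e..s} ?W"
      by (simp only: Henstock_Kurzweil_Integration.integral_add[OF \<Phi>int Wint]
          Henstock_Kurzweil_Integration.integral_mult_right)
    also have "\<dots> \<le> stab_rate K * integral {e..s} \<Phi> + lF * (stab_const K * E) * (dwell * (e - p))"
      using lF_pos stab_const_pos[of K] E by (intro add_left_mono mult_left_mono window_integral[OF x pe(2)]) auto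
    finally have after: "norm (integral {e..s} ?r)
        \<le> stab_rate K * integral {e..s} \<Phi> + lF * (stab_const K * E) * (dwell * (e - p))" .
    have sT: "s \<in> {t..T}" using s pe by auto
    have "x s - y s = integral {t..s} (rate x) - integral {t..s} (rate y)"
      using controlled_sol[OF x] controlled_sol[OF y] sT U_after[OF s] by (simp add: sol_def)
    also have "\<dots> = integral {t..s} ?r"
      using sT by (intro Henstock_Kurzweil_Integration.integral_diff[symmetric] intx inty) auto
    also have "\<dots> = integral {t..p} ?r + integral {p..e} ?r + integral {e..s} ?r"
    proof -
      have "integral {t..p} ?r + integral {p..e} ?r = integral {t..e} ?r"
        using pe by (intro Henstock_Kurzweil_Integration.integral_combine int) auto
      moreover have "integral {t..e} ?r + integral {e..s} ?r = integral {t..s} ?r"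
        using pe s by (intro Henstock_Kurzweil_Integration.integral_combine int) auto
      ultimately show ?thesis by simp
    qed
    finally have split: "x s - y s = integral {t..p} ?r + integral {p..e} ?r + integral {e..s} ?r" .
    have "norm (x s - y s) \<le> norm (integral {t..p} ?r) + norm (integral {p..e} ?r) + norm (integral {e..s} ?r)"
      unfolding split by (rule order_trans[OF norm_triangle_ineq add_right_mono[OF norm_triangle_ineq]])
    then have "norm (x s - y s) \<le> stab_rate K * (stab_const K * E) * (e - p)
        + (stab_rate K * integral {e..s} \<Phi> + lF * (stab_const K * E) * (dwell * (e - p)))"
      using before during after by linarith
    also have "\<dots> = ?B + stab_rate K * integral {e..s} \<Phi>" by (simp add: algebra_simps)
    finally show "norm (x s - y s) \<le> ?B + stab_rate K * integral {e..s} \<Phi>" .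
  qed
  also have "\<dots> \<le> 2 * ?B * exp (2 * stab_rate K * (T - t0))"
    using s pe controlled_t[OF x] B stab_rate_pos[OF K_nonneg] by (intro mult_left_mono) auto
  also have "\<dots> = tail_const * E * (e - p)" by (simp add: tail_const_def stab_const_def)
  finally show ?thesis .
qed

lemma perturbed_state:
  assumes s: "s \<in> {t - b..T}"
  shows "norm (x s - y s) \<le> tail_const * E * (e - p) + stab_const K * E * (if s \<in> {p..e} then 1 else 0)"
proof -
  have C: "0 \<le> tail_const * E * (e - p)" "0 \<le> stab_const K * E"
    using tail_const_pos stab_const_pos[of K] E pe by auto
  consider "s \<le> p" | "s \<in> {p..e}" | "s \<in> {e..T}" using s by force
  then show ?thesis
  proof cases
    case 1
    then have "x s = y s" using s by (intro perturbed_before) auto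
    then show ?thesis using C by simp
  next
    case 2 then show ?thesis using perturbed_during[OF s] C by simp
  next
    case 3 then show ?thesis using perturbed_after[OF 3] C by simp
  qed
qed

text \<open>A displacement of size \<open>O(E)\<close> is met only at times in \<open>{p..e}\<close>
  or in the window, both of measure \<open>O(e - p)\<close>; elsewhere the displacement itself
  carries the factor \<open>e - p\<close>. Either way the product \<open>E * (e - p)\<close>
  results.\<close>

lemma perturbed_total:
  assumes \<gamma>: "ctl \<gamma>"
  shows "\<bar>total t x \<gamma> - total t y \<gamma>\<bar> \<le> pert_const * E * (e - p)"
proof -
  let ?a = "tail_const * E * (e - p)" and ?c = "stab_const K * E"
  let ?I = "\<lambda>s. if s \<in> {p..e} then 1 else 0 :: real"
  let ?W = "\<lambda>s. if s \<in> window x t p e then 1 else 0 :: real"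
  have C: "0 \<le> ?a" "0 \<le> ?c" using tail_const_pos stab_const_pos[of K] E pe by auto
  have k: "0 \<le> 1 + K * ltau" using K_nonneg ltau_pos by simp
  have t: "t0 \<le> t" "t \<le> T" using controlled_t[OF x] by auto
  have I: "?I integrable_on {c..d}" "integral {c..d} ?I \<le> e - p" for c d
    using integral_indicator_compact_le[of "{p..e}" "e - p" c d] pe by auto
  note W = window_integrable[OF x pe(2)] window_integral[OF x pe(2)]
  let ?e = "\<lambda>s. (2 + K * ltau) * ?a + ((1 + K * ltau) * ?c * ?I s + ?c * ?W s)"
  have run: "\<bar>running t x \<gamma> - running t y \<gamma>\<bar> \<le> lL M * integral {t..T} ?e"
  proof (rule running_diff[OF x y \<gamma>])
    show "?e integrable_on {t..T}"
      by (intro integrable_add integrable_const_ivl integrable_on_mult_right I W)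
    fix s assume s: "s \<in> {t..T}"
    then have s': "s \<in> {t - b..T}" using b_nonneg by auto
    have "norm (x s - y s) + norm (x (delayed x s) - y (delayed y s))
        \<le> (1 + K * ltau) * norm (x s - y s) + norm (x (delayed x s) - y (delayed x s))"
      by (rule delayed_value_diff_majorant[OF x y s])
    also have "\<dots> \<le> (1 + K * ltau) * (?a + ?c * ?I s) + (?a + ?c * (if delayed x s \<in> {p..e} then 1 else 0))"
      by (intro add_mono mult_left_mono perturbed_state k s' controlled_delayed_mem[OF x s])
    also have "(if delayed x s \<in> {p..e} then 1 else 0) = ?W s" using s by (simp add: window_def)
    finally show "norm (x s - y s) + norm (x (delayed x s) - y (delayed y s)) \<le> ?e s"
      by (simp only: distrib_left distrib_right mult_1 mult.assoc)
  qed
  have "integral {t..T} ?e = (2 + K * ltau) * ?a * (T - t)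
      + ((1 + K * ltau) * ?c * integral {t..T} ?I + ?c * integral {t..T} ?W)"
  proof -
    have "integral {t..T} ?e = integral {t..T} (\<lambda>_. (2 + K * ltau) * ?a)
        + integral {t..T} (\<lambda>s. (1 + K * ltau) * ?c * ?I s + ?c * ?W s)"
      by (intro Henstock_Kurzweil_Integration.integral_add integrable_add integrable_const_ivl
          integrable_on_mult_right I W)
    also have "integral {t..T} (\<lambda>s. (1 + K * ltau) * ?c * ?I s + ?c * ?W s)
        = integral {t..T} (\<lambda>s. (1 + K * ltau) * ?c * ?I s) + integral {t..T} (\<lambda>s. ?c * ?W s)"
      by (intro Henstock_Kurzweil_Integration.integral_add integrable_on_mult_right I W)
    finally show ?thesis using t by (simp only: Henstock_Kurzweil_Integration.integral_mult_right) simp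
  qed
  also have "\<dots> \<le> (2 + K * ltau) * ?a * (T - t0)
      + ((1 + K * ltau) * ?c * (e - p) + ?c * (dwell * (e - p)))"
    using t C k by (intro add_mono mult_left_mono I W) auto
  finally have "lL M * integral {t..T} ?e \<le> lL M * ((2 + K * ltau) * ?a * (T - t0)
      + ((1 + K * ltau) * ?c * (e - p) + ?c * (dwell * (e - p))))"
    using lL_pos[OF M_pos] by (intro mult_left_mono) auto
  with run have run': "\<bar>running t x \<gamma> - running t y \<gamma>\<bar> \<le> lL M * ((2 + K * ltau) * ?a * (T - t0)
      + ((1 + K * ltau) * ?c * (e - p) + ?c * (dwell * (e - p))))" by linarith
  have sub: "{T - b..T} \<subseteq> {t - b..T}" using t by auto
  have "integral {T - b..T} (\<lambda>s. norm (x s - y s)) \<le> integral {T - b..T} (\<lambda>s. ?a + ?c * ?I s)"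
    using sub perturbed_state
    by (intro Henstock_Kurzweil_Integration.integral_le integrable_continuous_real[of "T - b" T "\<lambda>s. norm (x s - y s)"] continuous_intros
        continuous_on_subset[OF controlled_cont[OF x]] continuous_on_subset[OF controlled_cont[OF y]]
        integrable_add integrable_const_ivl integrable_on_mult_right I) auto
  also have "\<dots> = ?a * b + ?c * integral {T - b..T} ?I"
  proof -
    have "integral {T - b..T} (\<lambda>s. ?a + ?c * ?I s) = integral {T - b..T} (\<lambda>_. ?a) + integral {T - b..T} (\<lambda>s. ?c * ?I s)"
      by (intro Henstock_Kurzweil_Integration.integral_add integrable_const_ivl integrable_on_mult_right I)
    then show ?thesis using b_nonneg
      by (simp only: Henstock_Kurzweil_Integration.integral_mult_right) simp
  qed
  also have "\<dots> \<le> ?a * b + ?c * (e - p)" by (intro add_left_mono mult_left_mono I C)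
  finally have "norm (x T - y T) + integral {T - b..T} (\<lambda>s. norm (x s - y s)) \<le> ?a + (?a * b + ?c * (e - p))"
    using perturbed_after[of T] pe by (intro add_mono) auto
  then have "lg M * (norm (x T - y T) + integral {T - b..T} (\<lambda>s. norm (x s - y s)))
      \<le> lg M * (?a + (?a * b + ?c * (e - p)))"
    using lg_pos[OF M_pos] by (intro mult_left_mono) auto
  with terminal_diff[OF x y] have "\<bar>h x - h y\<bar> \<le> lg M * (?a + (?a * b + ?c * (e - p)))" by linarith
  moreover have "pert_const * E * (e - p) = lL M * ((2 + K * ltau) * ?a * (T - t0)
      + ((1 + K * ltau) * ?c * (e - p) + ?c * (dwell * (e - p)))) + lg M * (?a + (?a * b + ?c * (e - p)))"
    by (simp add: pert_const_def algebra_simps)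
  ultimately show ?thesis using run' unfolding total_def by linarith
qed

end

end

text \<open>The primitive of \<open>q\<close> minus its shift telescopes to an integral over a
  sliding interval of length \<delta>, which vanishes as long as that interval misses the support of
  \<open>q\<close>.\<close>

lemma shifted_difference_integral:
  fixes q :: "real \<Rightarrow> 'a::euclidean_space"
  assumes int: "\<And>c d. q integrable_on {c..d}" and zero: "\<And>s. s \<notin> {p..p + h} \<Longrightarrow> q s = 0"
    and "0 < \<delta>" "t \<le> p" "t \<le> s"
  shows "integral {t..s} (\<lambda>\<sigma>. q \<sigma> - q (\<sigma> - \<delta>)) = integral {s - \<delta>..s} q"
    and "s \<le> p \<Longrightarrow> integral {s - \<delta>..s} q = 0"
    and "p + \<delta> + h \<le> s \<Longrightarrow> integral {s - \<delta>..s} q = 0"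
proof -
  have null: "integral {c..d} q = 0" if "d \<le> p \<or> p + h \<le> c" for c d
  proof -
    have "integral {c..d} q = integral {c..d} (\<lambda>_. 0)"
      by (rule integral_spike[of "{p, p + h}"]) (use that zero in force)+
    then show ?thesis by simp
  qed
  then show "s \<le> p \<Longrightarrow> integral {s - \<delta>..s} q = 0" "p + \<delta> + h \<le> s \<Longrightarrow> integral {s - \<delta>..s} q = 0"
    by auto
  have shift: "integral {t..s} (\<lambda>\<sigma>. q (\<sigma> - \<delta>)) = integral {t - \<delta>..s - \<delta>} q"
    "(\<lambda>\<sigma>. q (\<sigma> - \<delta>)) integrable_on {t..s}"
  proof -
    have "(q has_integral integral {t - \<delta>..s - \<delta>} q) {t - \<delta>..s - \<delta>}"
      by (rule integrable_integral[OF int])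
    from has_integral_shift_real_ivl[OF this, of "- \<delta>"]
    have "((\<lambda>\<sigma>. q (\<sigma> - \<delta>)) has_integral integral {t - \<delta>..s - \<delta>} q) {t..s}" by simp
    then show "integral {t..s} (\<lambda>\<sigma>. q (\<sigma> - \<delta>)) = integral {t - \<delta>..s - \<delta>} q"
      "(\<lambda>\<sigma>. q (\<sigma> - \<delta>)) integrable_on {t..s}" by (auto simp: integral_unique)
  qed
  have "integral {t - \<delta>..t} q + integral {t..s} q = integral {t - \<delta>..s} q"
    using assms by (intro Henstock_Kurzweil_Integration.integral_combine int) auto
  moreover have "integral {t - \<delta>..s - \<delta>} q + integral {s - \<delta>..s} q = integral {t - \<delta>..s} q"
    using assms by (intro Henstock_Kurzweil_Integration.integral_combine int) auto
  moreover have "integral {t - \<delta>..t} q = 0" using null \<open>t \<le> p\<close> by simp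
  ultimately have "integral {t..s} q = integral {t - \<delta>..s - \<delta>} q + integral {s - \<delta>..s} q" by simp
  then show "integral {t..s} (\<lambda>\<sigma>. q \<sigma> - q (\<sigma> - \<delta>)) = integral {s - \<delta>..s} q"
    using shift int by (simp add: Henstock_Kurzweil_Integration.integral_diff)
qed

section \<open>Averaging an optimal control over two intervals\<close>

context delay_control_data
begin

lemma ctl_shift: assumes "ctl \<alpha>" shows "ctl (\<lambda>s. \<alpha> (s + \<delta>))"
proof -
  have "(\<lambda>s. s + \<delta>) \<in> measurable lebesgue (lebesgue :: real measure)"
    using lebesgue_affine_measurable[where c = "\<lambda>_::real. 1" and t = \<delta>] by (simp add: add.commute)
  moreover have "\<alpha> \<in> borel_measurable lebesgue" using assms by (simp add: ctl_def)
  ultimately have "(\<lambda>s. \<alpha> (s + \<delta>)) \<in> borel_measurable lebesgue" by (rule measurable_compose)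
  then show ?thesis using ctl_mem[OF assms] by (auto simp: ctl_def)
qed

lemma ctl_If:
  assumes "ctl \<alpha>" "ctl \<beta>" "S \<in> sets lebesgue" shows "ctl (\<lambda>s. if s \<in> S then \<alpha> s else \<beta> s)"
proof -
  have "(\<lambda>s. if s \<in> S then \<alpha> s else \<beta> s) \<in> borel_measurable lebesgue"
    using assms by (intro measurable_If_set) (auto simp: ctl_def)
  then show ?thesis using ctl_mem[OF assms(1)] ctl_mem[OF assms(2)] by (auto simp: ctl_def)
qed

definition delayed_lip :: real where "delayed_lip = K * (1 + kt M + ltau * K)"

lemma delayed_value_lip:
  assumes x: "controlled t w \<alpha> x" and s: "s \<in> {t..T}" "s' \<in> {t..T}"
  shows "norm (x (delayed x s) - x (delayed x s')) \<le> delayed_lip * \<bar>s - s'\<bar>"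
proof -
  have "(1 + kt M + ltau * K)-lipschitz_on {t..T} (delayed x)"
  proof (rule delayed_lipschitz[OF controlled_t(1)[OF x]])
    show "K-lipschitz_on {t..T} x" by (rule lipschitz_on_subset[OF controlled_lip[OF x]]) (use b_nonneg in auto)
    show "norm (x s) \<le> M" if "s \<in> {t..T}" for s using that b_nonneg by (intro controlled_norm[OF x]) auto
  qed (use tau_time_lip[OF M_pos] kt_pos[OF M_pos] in auto)
  from lipschitz_on_normD[OF this s]
  have "K * \<bar>delayed x s - delayed x s'\<bar> \<le> K * ((1 + kt M + ltau * K) * \<bar>s - s'\<bar>)"
    using K_nonneg by (intro mult_left_mono) auto
  moreover have "norm (x (delayed x s) - x (delayed x s')) \<le> K * \<bar>delayed x s - delayed x s'\<bar>"
    using lipschitz_on_normD[OF controlled_lip[OF x] controlled_delayed_mem[OF x s(1)] controlled_delayed_mem[OF x s(2)]] by simp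
  ultimately show ?thesis unfolding delayed_lip_def mult.assoc by linarith
qed

definition swap_const :: real where "swap_const = lH / 2 * (1 + K + delayed_lip)"

text \<open>After strong convexity is applied at both times, half of the difference between the
  control increments of \<open>L\<close> at \<open>s\<close> and at \<open>s + \<delta>\<close> is
  left. This mixed difference is \<open>O(\<delta> * norm (a' - a))\<close>, because
  \<open>x\<close> and its delayed values are Lipschitz in time; the two gains
  \<open>\<mu> / 8\<close> add up to \<open>\<mu> / 4\<close>.\<close>

lemma swap_gain:
  assumes x: "controlled t w \<alpha> x" and s: "s \<in> {t..T}" "s + \<delta> \<in> {t..T}" and "0 < \<delta>" and a: "a \<in> A" "a' \<in> A"
  shows "(L s (x s) (x (delayed x s)) ((1/2) *\<^sub>R (a + a')) - L s (x s) (x (delayed x s)) a)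
    + (L (s + \<delta>) (x (s + \<delta>)) (x (delayed x (s + \<delta>))) ((1/2) *\<^sub>R (a + a'))
      - L (s + \<delta>) (x (s + \<delta>)) (x (delayed x (s + \<delta>))) a')
    \<le> swap_const * \<delta> * norm (a' - a) - \<mu> / 4 * (norm (a' - a))\<^sup>2"
proof -
  let ?l = "\<lambda>s a. L s (x s) (x (delayed x s)) a"
  have s0: "s \<in> {t0..T}" "s + \<delta> \<in> {t0..T}" and sb: "s \<in> {t - b..T}" "s + \<delta> \<in> {t - b..T}"
    using s controlled_t[OF x] b_nonneg by auto
  have n: "norm (a - a') = norm (a' - a)" by (rule norm_minus_commute)
  have 1: "?l s ((1/2) *\<^sub>R (a + a')) \<le> (?l s a + ?l s a') / 2 - \<mu> / 8 * (norm (a' - a))\<^sup>2"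
    "?l (s + \<delta>) ((1/2) *\<^sub>R (a + a')) \<le> (?l (s + \<delta>) a + ?l (s + \<delta>) a') / 2 - \<mu> / 8 * (norm (a' - a))\<^sup>2"
    using L_strong[OF s0(1) a] L_strong[OF s0(2) a] unfolding n by blast+
  have "\<bar>(?l (s + \<delta>) a - ?l (s + \<delta>) a') - (?l s a - ?l s a')\<bar>
      \<le> lH * (\<bar>s + \<delta> - s\<bar> + norm (x (s + \<delta>) - x s) + norm (x (delayed x (s + \<delta>)) - x (delayed x s))) * norm (a - a')"
    by (rule L_mixed[OF s0(2,1) a])
  also have "\<dots> \<le> lH * (\<delta> + K * \<delta> + delayed_lip * \<delta>) * norm (a - a')"
  proof (intro mult_right_mono mult_left_mono add_mono)
    show "norm (x (s + \<delta>) - x s) \<le> K * \<delta>"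
      using lipschitz_on_normD[OF controlled_lip[OF x] sb(2,1)] \<open>0 < \<delta>\<close> by simp
    show "norm (x (delayed x (s + \<delta>)) - x (delayed x s)) \<le> delayed_lip * \<delta>"
      using delayed_value_lip[OF x s(2,1)] \<open>0 < \<delta>\<close> by simp
  qed (use lH_pos \<open>0 < \<delta>\<close> in auto)
  also have "\<dots> = 2 * (swap_const * \<delta> * norm (a' - a))"
    by (simp add: swap_const_def n algebra_simps)
  finally have 2: "\<bar>(?l (s + \<delta>) a - ?l (s + \<delta>) a') - (?l s a - ?l s a')\<bar> \<le> 2 * (swap_const * \<delta> * norm (a' - a))" .
  from 1 2 show ?thesis by argo
qed

text \<open>Solves \<open>\<mu> / 4 * Q \<le> (pert_const * kG + swap_const) * \<delta> * I\<close>
  for the integral \<open>Q\<close> of the squares; the state error enters as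
  \<open>pert_const * (kG / 2 * I)\<close> times a length of at most
  \<open>2 * \<delta>\<close>.\<close>

definition reg_const :: real where "reg_const = 4 * (pert_const * kG + swap_const) / \<mu>"

lemma pert_const_pos: "0 < pert_const"
proof -
  have "0 \<le> K * ltau" using K_nonneg ltau_pos by simp
  then show ?thesis
    unfolding pert_const_def
    using lL_pos[OF M_pos] lg_pos[OF M_pos] tail_const_pos stab_const_pos[of K] dwell_pos t0_less_T b_nonneg
      K_nonneg ltau_pos
    by (intro add_nonneg_pos mult_nonneg_nonneg add_nonneg_nonneg mult_pos_pos add_nonneg_pos) auto
qed

lemma reg_const_pos: "0 < reg_const"
proof -
  have "0 < swap_const"
    unfolding swap_const_def delayed_lip_def using lH_pos K_nonneg ltau_pos kt_pos[OF M_pos]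
    by (intro mult_pos_pos add_pos_nonneg mult_nonneg_nonneg add_nonneg_nonneg) auto
  then show ?thesis unfolding reg_const_def using pert_const_pos kG_pos \<mu>_pos by (simp add: add_pos_pos)
qed

theorem optimal_increment:
  assumes init: "init t w" and opt: "optimal t w \<alpha> x"
    and \<eta>: "0 < \<eta>" "\<eta> < \<delta>" and p: "t \<le> p" "p + \<delta> + \<eta> \<le> T"
  shows "integral {p..p + \<eta>} (\<lambda>s. norm (\<alpha> (s + \<delta>) - \<alpha> s)) \<le> reg_const * \<delta> * \<eta>"
proof -
  have \<alpha>: "ctl \<alpha>" and x: "controlled t w \<alpha> x" using opt init by (auto simp: optimal_def controlled_def)
  have \<alpha>s: "ctl (\<lambda>s. \<alpha> (s + c))" for c by (rule ctl_shift[OF \<alpha>])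
  let ?I1 = "{p..p + \<eta>}" and ?I2 = "{p + \<delta>..p + \<delta> + \<eta>}"
  \<comment> \<open>Both intervals receive the same values:
    \<open>\<beta> (s + \<delta>) = \<beta> s\<close> for \<open>s\<close> in the first one. The
    condition \<open>\<eta> < \<delta>\<close> keeps the intervals disjoint.\<close>
  define \<beta> where "\<beta> s = (if s \<in> ?I1 then (1/2) *\<^sub>R (\<alpha> s + \<alpha> (s + \<delta>))
    else if s \<in> ?I2 then (1/2) *\<^sub>R (\<alpha> s + \<alpha> (s + - \<delta>)) else \<alpha> s)" for s
  have \<beta>: "ctl \<beta>" unfolding \<beta>_def by (intro ctl_If ctl_mid \<alpha> \<alpha>s) auto
  obtain y where y: "controlled t w \<beta> y" using controlled_exists[OF init \<beta>] by blast
  let ?\<Delta> = "\<lambda>s. norm (\<alpha> (s + \<delta>) - \<alpha> s)"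
  define I where "I = integral ?I1 ?\<Delta>"
  have \<Delta>: "?\<Delta> integrable_on {c..d}" for c d
    by (rule ctl_diff_integrable[OF \<alpha>s \<alpha>]) (intro continuous_intros)
  have \<Delta>2: "(\<lambda>s. (?\<Delta> s)\<^sup>2) integrable_on {c..d}" for c d
    by (rule ctl_diff_integrable[OF \<alpha>s \<alpha>]) (intro continuous_intros)
  have I0: "0 \<le> I" unfolding I_def by (intro Henstock_Kurzweil_Integration.integral_nonneg \<Delta>) auto

  \<comment> \<open>By the midpoint property, \<open>G\<close> changes by \<open>q\<close> on the
    first interval and by minus its shift on the second, so the primitives differ by a sliding
    integral of \<open>q\<close>.\<close>
  define q where "q s = (if s \<in> ?I1 then (1/2) *\<^sub>R (G (\<alpha> (s + \<delta>)) - G (\<alpha> s)) else 0)" for s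
  have q0: "(\<lambda>s. (1/2) *\<^sub>R (G (\<alpha> (s + \<delta>)) - G (\<alpha> s))) integrable_on {c..d}" for c d
    by (intro integrable_on_scaleR_left integrable_cmul integrable_diff G_ctl_integrable_on \<alpha>s \<alpha>)
  have q: "q integrable_on {c..d}" for c d
    unfolding q_def integrable_restrict_Int Int_atLeastAtMost by (rule q0)
  have q_le: "norm (integral {c..d} q) \<le> kG / 2 * I" for c d
  proof -
    have "norm (integral {c..d} q) \<le> integral {c..d} (\<lambda>s. if s \<in> ?I1 then kG / 2 * ?\<Delta> s else 0)"
    proof (rule Henstock_Kurzweil_Integration.integral_norm_bound_integral[OF q])
      show "(\<lambda>s. if s \<in> ?I1 then kG / 2 * ?\<Delta> s else 0) integrable_on {c..d}"
        unfolding integrable_restrict_Int Int_atLeastAtMost by (intro integrable_on_mult_right \<Delta>)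
      show "norm (q s) \<le> (if s \<in> ?I1 then kG / 2 * ?\<Delta> s else 0)" for s
        using G_lip[OF ctl_mem[OF \<alpha>s] ctl_mem[OF \<alpha>], of s \<delta> s] by (simp add: q_def)
    qed
    also have "\<dots> = integral (?I1 \<inter> {c..d}) (\<lambda>s. kG / 2 * ?\<Delta> s)" by (rule integral_restrict_Int)
    also have "\<dots> \<le> integral ?I1 (\<lambda>s. kG / 2 * ?\<Delta> s)"
      using kG_pos
      by (intro integral_subset_le) (auto simp: Int_atLeastAtMost intro!: integrable_on_mult_right \<Delta>)
    finally show ?thesis by (simp add: I_def)
  qed
  have disj: "s \<notin> ?I2" if "s \<in> ?I1" for s using that \<eta> by auto
  have G\<beta>: "G (\<beta> s) - G (\<alpha> s) = q s - q (s - \<delta>)" for s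
  proof -
    have "s - \<delta> \<in> ?I1 \<longleftrightarrow> s \<in> ?I2" by auto
    then show ?thesis
      using disj[of s] G_mid[OF ctl_mem[OF \<alpha>] ctl_mem[OF \<alpha>]]
      by (auto simp: \<beta>_def q_def algebra_simps simp flip: scaleR_add_left)
  qed
  have U: "integral {t..s} (\<lambda>s. G (\<beta> s)) - integral {t..s} (\<lambda>s. G (\<alpha> s)) = integral {s - \<delta>..s} q"
    if "t \<le> s" for s
  proof -
    have "integral {t..s} (\<lambda>s. G (\<beta> s)) - integral {t..s} (\<lambda>s. G (\<alpha> s))
        = integral {t..s} (\<lambda>s. G (\<beta> s) - G (\<alpha> s))"
      by (intro Henstock_Kurzweil_Integration.integral_diff[symmetric] G_ctl_integrable_on \<alpha> \<beta>)
    also have "\<dots> = integral {s - \<delta>..s} q"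
      unfolding G\<beta> using \<eta> p that
      by (intro shifted_difference_integral(1)[where p = p and h = \<eta>] q) (auto simp: q_def)
    finally show ?thesis .
  qed
  have zero: "s \<le> p \<Longrightarrow> integral {s - \<delta>..s} q = 0" "p + \<delta> + \<eta> \<le> s \<Longrightarrow> integral {s - \<delta>..s} q = 0" if "t \<le> s" for s
  proof -
    have qz: "q s = 0" if "s \<notin> {p..p + \<eta>}" for s using that by (auto simp: q_def)
    have "0 < \<delta>" using \<eta> by simp
    show "integral {s - \<delta>..s} q = 0" if "s \<le> p"
      by (rule shifted_difference_integral(2)[OF q qz \<open>0 < \<delta>\<close> p(1) \<open>t \<le> s\<close> that])
    show "integral {s - \<delta>..s} q = 0" if "p + \<delta> + \<eta> \<le> s"
      by (rule shifted_difference_integral(3)[OF q qz \<open>0 < \<delta>\<close> p(1) \<open>t \<le> s\<close> that])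
  qed
  have "\<bar>total t x \<beta> - total t y \<beta>\<bar> \<le> pert_const * (kG / 2 * I) * ((p + \<delta> + \<eta>) - p)"
  proof (rule perturbed_total[OF x y])
    show "norm (integral {t..s} (\<lambda>s. G (\<alpha> s)) - integral {t..s} (\<lambda>s. G (\<beta> s))) \<le> kG / 2 * I"
      if "s \<in> {t..T}" for s
      using U[of s] q_le[of "s - \<delta>" s] that by (metis atLeastAtMost_iff norm_minus_commute)
    show "integral {t..s} (\<lambda>s. G (\<alpha> s)) = integral {t..s} (\<lambda>s. G (\<beta> s))" if "s \<in> {t..p}" for s
      using U[of s] zero(1)[of s] that by simp
    show "integral {t..s} (\<lambda>s. G (\<alpha> s)) = integral {t..s} (\<lambda>s. G (\<beta> s))" if "s \<in> {p + \<delta> + \<eta>..T}" for s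
      using U[of s] zero(2)[of s] that \<eta> p by simp
  qed (use p \<eta> kG_pos I0 \<beta> in auto)
  also have "\<dots> = pert_const * (kG / 2 * I) * (\<delta> + \<eta>)" by simp
  finally have state: "\<bar>total t x \<beta> - total t y \<beta>\<bar> \<le> pert_const * (kG / 2 * I) * (\<delta> + \<eta>)" .

  let ?l = "\<lambda>s a. L s (x s) (x (delayed x s)) a"
  define lam where "lam s = ?l s (\<beta> s) - ?l s (\<alpha> s)" for s
  have lam: "lam integrable_on {t..T}"
    unfolding lam_def by (intro integrable_diff controlled_L_integrable[OF x] \<alpha> \<beta>)
  have sub: "?I1 \<subseteq> {t..T}" "?I2 \<subseteq> {t..T}" using p \<eta> by auto
  have lam1: "lam integrable_on ?I1" and lam2: "lam integrable_on ?I2"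
    using sub by (auto intro: integrable_on_subinterval[OF lam])
  \<comment> \<open>The second interval is shifted onto the first, so that the two changes of the
    running cost can be added pointwise and \<open>swap_gain\<close> applies.\<close>
  have lam_shift: "((\<lambda>s. lam (s + \<delta>)) has_integral integral ?I2 lam) ?I1"
    using has_integral_shift_real_ivl[OF integrable_integral[OF lam2], of \<delta>] by (simp add: algebra_simps)
  have lam_zero: "lam s = 0" if "s \<notin> ?I1" "s \<notin> ?I2" for s
    using that by (simp add: lam_def \<beta>_def del: atLeastAtMost_iff)
  have lam_eq: "lam s = (if s \<in> ?I1 then lam s else 0) + (if s \<in> ?I2 then lam s else 0)" for s
    using disj[of s] lam_zero[of s]
    by (cases "s \<in> ?I1"; cases "s \<in> ?I2") (simp_all del: atLeastAtMost_iff)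
  have "running t x \<beta> - running t x \<alpha> = integral {t..T} lam"
    unfolding running_def lam_def
    by (intro Henstock_Kurzweil_Integration.integral_diff[symmetric] controlled_L_integrable[OF x] \<alpha> \<beta>)
  also have "lam = (\<lambda>s. (if s \<in> ?I1 then lam s else 0) + (if s \<in> ?I2 then lam s else 0))"
    by (rule ext) (rule lam_eq)
  also have "integral {t..T} \<dots> = integral {t..T} (\<lambda>s. if s \<in> ?I1 then lam s else 0)
      + integral {t..T} (\<lambda>s. if s \<in> ?I2 then lam s else 0)"
    by (intro Henstock_Kurzweil_Integration.integral_add)
      (simp_all only: integrable_restrict_Int Int_absorb2[OF sub(1)] Int_absorb2[OF sub(2)] lam1 lam2)
  also have "\<dots> = integral ?I1 lam + integral ?I2 lam"
    by (simp only: integral_restrict_Int Int_absorb2[OF sub(1)] Int_absorb2[OF sub(2)])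
  also have "\<dots> = integral ?I1 (\<lambda>s. lam s + lam (s + \<delta>))"
    using lam_shift lam1 by (subst Henstock_Kurzweil_Integration.integral_add) (auto simp: integral_unique)
  also have "\<dots> \<le> integral ?I1 (\<lambda>s. swap_const * \<delta> * ?\<Delta> s - \<mu> / 4 * (?\<Delta> s)\<^sup>2)"
  proof (rule Henstock_Kurzweil_Integration.integral_le)
    show "(\<lambda>s. lam s + lam (s + \<delta>)) integrable_on ?I1" using lam_shift lam1 by (auto intro: integrable_add)
    show "(\<lambda>s. swap_const * \<delta> * ?\<Delta> s - \<mu> / 4 * (?\<Delta> s)\<^sup>2) integrable_on ?I1"
      by (intro integrable_diff integrable_on_mult_right \<Delta> \<Delta>2)
    fix s assume s: "s \<in> ?I1"
    then have "s + \<delta> \<notin> ?I1" "s + \<delta> \<in> ?I2" using \<eta> by auto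
    then have "\<beta> (s + \<delta>) = (1/2) *\<^sub>R (\<alpha> s + \<alpha> (s + \<delta>))"
      by (simp add: \<beta>_def add.commute[of "\<alpha> (s + \<delta>)"] del: atLeastAtMost_iff)
    moreover have "\<beta> s = (1/2) *\<^sub>R (\<alpha> s + \<alpha> (s + \<delta>))" using s by (simp add: \<beta>_def)
    ultimately show "lam s + lam (s + \<delta>) \<le> swap_const * \<delta> * ?\<Delta> s - \<mu> / 4 * (?\<Delta> s)\<^sup>2"
      unfolding lam_def using s sub \<open>s + \<delta> \<in> ?I2\<close> \<eta>
      by (simp only:) (intro swap_gain[OF x] ctl_mem[OF \<alpha>]; auto)
  qed
  also have "\<dots> = swap_const * \<delta> * I - \<mu> / 4 * integral ?I1 (\<lambda>s. (?\<Delta> s)\<^sup>2)"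
    unfolding I_def
    by (subst Henstock_Kurzweil_Integration.integral_diff)
      (auto intro: integrable_on_mult_right \<Delta> \<Delta>2)
  finally have gain: "running t x \<beta> - running t x \<alpha> \<le> swap_const * \<delta> * I - \<mu> / 4 * integral ?I1 (\<lambda>s. (?\<Delta> s)\<^sup>2)" .

  have "total t x \<alpha> \<le> total t y \<beta>" using opt y by (auto simp: optimal_def controlled_def)
  with state gain have "\<mu> / 4 * integral ?I1 (\<lambda>s. (?\<Delta> s)\<^sup>2) \<le> pert_const * (kG / 2 * I) * (\<delta> + \<eta>) + swap_const * \<delta> * I"
    unfolding total_def by linarith
  also have "\<dots> \<le> pert_const * (kG / 2 * I) * (2 * \<delta>) + swap_const * \<delta> * I"
    using pert_const_pos kG_pos I0 \<eta> by (intro add_right_mono mult_left_mono) auto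
  also have "\<dots> = \<mu> / 4 * (reg_const * \<delta> * I)"
    using \<mu>_pos by (simp add: reg_const_def field_simps)
  finally have Q: "integral ?I1 (\<lambda>s. (?\<Delta> s)\<^sup>2) \<le> reg_const * \<delta> * I" using \<mu>_pos by simp

  define k where "k = reg_const * \<delta>"
  have k: "0 < k" using reg_const_pos \<eta> by (simp add: k_def)
  \<comment> \<open>Integrating \<open>2 * k * d - k\<^sup>2 \<le> d\<^sup>2\<close> takes the place
    of Cauchy-Schwarz: it turns the bound \<open>k * I\<close> on the integral of the squares into
    \<open>I \<le> k * \<eta>\<close>.\<close>
  have "integral ?I1 (\<lambda>s. 2 * k * ?\<Delta> s - k\<^sup>2) \<le> integral ?I1 (\<lambda>s. (?\<Delta> s)\<^sup>2)"
  proof (rule Henstock_Kurzweil_Integration.integral_le)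
    show "(\<lambda>s. 2 * k * ?\<Delta> s - k\<^sup>2) integrable_on ?I1"
      by (intro integrable_diff integrable_const_ivl integrable_on_mult_right \<Delta>)
    show "(\<lambda>s. (?\<Delta> s)\<^sup>2) integrable_on ?I1" by (rule \<Delta>2)
    show "2 * k * ?\<Delta> s - k\<^sup>2 \<le> (?\<Delta> s)\<^sup>2" for s
      using zero_le_power2[of "?\<Delta> s - k"] by (simp add: power2_diff algebra_simps)
  qed
  also have "integral ?I1 (\<lambda>s. 2 * k * ?\<Delta> s - k\<^sup>2) = 2 * k * I - k\<^sup>2 * \<eta>"
    unfolding I_def using \<eta>
    by (subst Henstock_Kurzweil_Integration.integral_diff)
      (auto intro: integrable_on_mult_right \<Delta>)
  finally have "2 * k * I - k\<^sup>2 * \<eta> \<le> k * I" using Q[folded k_def] by linarith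
  then have "k * I \<le> k * (k * \<eta>)" by (simp add: power2_eq_square algebra_simps)
  then have "I \<le> k * \<eta>" using k by (simp only: mult_le_cancel_left_pos)
  then show ?thesis unfolding I_def k_def .
qed

text \<open>Where the primitive of \<alpha> has derivative \<alpha>, short averages approximate the
  values. \<open>optimal_increment\<close>, with \<delta> the distance of two such points, bounds
  the difference of their averages, and its linear dependence on \<eta> survives division by
  \<eta>.\<close>

lemma optimal_lipschitz_AE:
  assumes init: "init t w" and opt: "optimal t w \<alpha> x"
  shows "\<exists>N. negligible N \<and> reg_const-lipschitz_on ({t<..<T} - N) \<alpha>"
proof -
  have \<alpha>: "ctl \<alpha>" using opt by (simp add: optimal_def)
  have "\<alpha> absolutely_integrable_on {t..T}" using bounded_ctl_integrable[OF \<alpha>, of "\<lambda>a. a"] by simp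
  then obtain N where N: "negligible N" "\<And>s. \<lbrakk>t < s; s < T; s \<notin> N\<rbrakk> \<Longrightarrow>
      ((\<lambda>s. integral {t..s} \<alpha>) has_vector_derivative \<alpha> s) (at s)"
    using AE_has_vector_derivative_integral by blast
  have mean: "\<exists>d>0. \<forall>\<eta>. 0 < \<eta> \<and> \<eta> < d \<longrightarrow> norm (integral {s..s + \<eta>} \<alpha> - \<eta> *\<^sub>R \<alpha> s) \<le> e * \<eta>"
    if s: "t < s" "s < T" "s \<notin> N" and "0 < e" for s e
  proof -
    obtain d where d: "0 < d" "\<And>y. norm (y - s) < d \<Longrightarrow>
        norm (integral {t..y} \<alpha> - integral {t..s} \<alpha> - (y - s) *\<^sub>R \<alpha> s) \<le> e * norm (y - s)"
      using N(2)[OF s] \<open>0 < e\<close> unfolding has_vector_derivative_def has_derivative_at_alt by blast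
    have "norm (integral {s..s + \<eta>} \<alpha> - \<eta> *\<^sub>R \<alpha> s) \<le> e * \<eta>" if "0 < \<eta>" "\<eta> < d" for \<eta>
    proof -
      have "integral {t..s} \<alpha> + integral {s..s + \<eta>} \<alpha> = integral {t..s + \<eta>} \<alpha>"
        using s that by (intro Henstock_Kurzweil_Integration.integral_combine ctl_integrable_on \<alpha>) auto
      then have "integral {s..s + \<eta>} \<alpha> = integral {t..s + \<eta>} \<alpha> - integral {t..s} \<alpha>"
        by (simp add: algebra_simps)
      then show ?thesis using d(2)[of "s + \<eta>"] that by simp
    qed
    then show ?thesis using d(1) by blast
  qed
  have main: "norm (\<alpha> s' - \<alpha> s) \<le> reg_const * (s' - s)"
    if s: "s \<in> {t<..<T} - N" "s' \<in> {t<..<T} - N" "s < s'" for s s'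
  proof (rule field_le_epsilon)
    fix e :: real assume "0 < e"
    then have e2: "0 < e / 2" by simp
    obtain d where d: "0 < d" "\<And>\<eta>. 0 < \<eta> \<Longrightarrow> \<eta> < d \<Longrightarrow> norm (integral {s..s + \<eta>} \<alpha> - \<eta> *\<^sub>R \<alpha> s) \<le> e / 2 * \<eta>"
      using mean[OF _ _ _ e2, of s] s by auto
    obtain d' where d': "0 < d'" "\<And>\<eta>. 0 < \<eta> \<Longrightarrow> \<eta> < d' \<Longrightarrow> norm (integral {s'..s' + \<eta>} \<alpha> - \<eta> *\<^sub>R \<alpha> s') \<le> e / 2 * \<eta>"
      using mean[OF _ _ _ e2, of s'] s by auto
    \<comment> \<open>Besides being small for both averages, \<eta> stays below \<delta> and leaves
      the second interval inside \<open>{t..T}\<close>.\<close>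
    define \<eta> where "\<eta> = Min {d, d', s' - s, T - s'} / 2"
    have "0 < Min {d, d', s' - s, T - s'}" using d d' s by simp
    then have \<eta>: "0 < \<eta>" "\<eta> < d" "\<eta> < d'" "\<eta> < s' - s" "\<eta> < T - s'" by (auto simp: \<eta>_def)
    define \<delta> where "\<delta> = s' - s"
    have \<delta>: "s + \<delta> = s'" by (simp add: \<delta>_def)
    have sh: "ctl (\<lambda>s. \<alpha> (s + \<delta>))" by (rule ctl_shift[OF \<alpha>])
    have "((\<lambda>r. \<alpha> (r + \<delta>)) has_integral integral {s'..s' + \<eta>} \<alpha>) {s' - \<delta>..s' + \<eta> - \<delta>}"
      by (rule has_integral_shift_real_ivl[OF integrable_integral[OF ctl_integrable_on[OF \<alpha>]]])
    moreover have "s' - \<delta> = s" "s' + \<eta> - \<delta> = s + \<eta>" by (simp_all add: \<delta>_def)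
    ultimately have "integral {s..s + \<eta>} (\<lambda>r. \<alpha> (r + \<delta>)) = integral {s'..s' + \<eta>} \<alpha>"
      by (metis integral_unique)
    then have "integral {s'..s' + \<eta>} \<alpha> - integral {s..s + \<eta>} \<alpha> = integral {s..s + \<eta>} (\<lambda>r. \<alpha> (r + \<delta>) - \<alpha> r)"
      by (simp add: Henstock_Kurzweil_Integration.integral_diff ctl_integrable_on \<alpha> sh)
    also have "norm \<dots> \<le> integral {s..s + \<eta>} (\<lambda>r. norm (\<alpha> (r + \<delta>) - \<alpha> r))"
      by (intro Henstock_Kurzweil_Integration.integral_norm_bound_integral integrable_diff ctl_integrable_on \<alpha> sh
          ctl_diff_integrable[OF sh \<alpha>] continuous_intros) auto
    also have "\<dots> \<le> reg_const * \<delta> * \<eta>"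
      using \<eta> s by (intro optimal_increment[OF init opt]) (auto simp: \<delta>_def)
    finally have 1: "norm (integral {s'..s' + \<eta>} \<alpha> - integral {s..s + \<eta>} \<alpha>) \<le> reg_const * \<delta> * \<eta>" .
    have split: "\<eta> *\<^sub>R (\<alpha> s' - \<alpha> s) = (integral {s'..s' + \<eta>} \<alpha> - integral {s..s + \<eta>} \<alpha>)
        - (integral {s'..s' + \<eta>} \<alpha> - \<eta> *\<^sub>R \<alpha> s') + (integral {s..s + \<eta>} \<alpha> - \<eta> *\<^sub>R \<alpha> s)"
      by (simp add: algebra_simps)
    have "norm (\<eta> *\<^sub>R (\<alpha> s' - \<alpha> s)) \<le> norm (integral {s'..s' + \<eta>} \<alpha> - integral {s..s + \<eta>} \<alpha>)
        + norm (integral {s'..s' + \<eta>} \<alpha> - \<eta> *\<^sub>R \<alpha> s') + norm (integral {s..s + \<eta>} \<alpha> - \<eta> *\<^sub>R \<alpha> s)"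
      unfolding split by (rule order_trans[OF norm_triangle_ineq add_right_mono[OF norm_triangle_ineq4]])
    also have "\<dots> \<le> reg_const * \<delta> * \<eta> + e / 2 * \<eta> + e / 2 * \<eta>"
      by (intro add_mono 1 d(2) d'(2) \<eta>)
    finally have "\<bar>\<eta>\<bar> * norm (\<alpha> s' - \<alpha> s) \<le> reg_const * \<delta> * \<eta> + e / 2 * \<eta> + e / 2 * \<eta>"
      unfolding norm_scaleR .
    then have "\<eta> * norm (\<alpha> s' - \<alpha> s) \<le> \<eta> * (reg_const * \<delta> + e)"
      using \<eta>(1) by (simp add: algebra_simps)
    then show "norm (\<alpha> s' - \<alpha> s) \<le> reg_const * (s' - s) + e"
      using \<eta>(1) by (simp add: \<delta>_def)
  qed
  have "reg_const-lipschitz_on ({t<..<T} - N) \<alpha>"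
  proof (rule lipschitz_on_leI)
    fix s s' assume s: "s \<in> {t<..<T} - N" "s' \<in> {t<..<T} - N" "s \<le> s'"
    show "dist (\<alpha> s) (\<alpha> s') \<le> reg_const * dist s s'"
    proof (cases "s = s'")
      case False
      then show ?thesis using main[of s s'] s by (simp add: dist_norm norm_minus_commute)
    qed simp
  qed (use reg_const_pos in simp)
  then show ?thesis using N(1) by blast
qed

end

section \<open>From almost everywhere estimates to Lipschitz representatives\<close>

lemma subset_closure_Diff_negligible:
  fixes S :: "'a::euclidean_space set"
  assumes "open S" "negligible N" shows "S \<subseteq> closure (S - N)"
proof
  fix x assume x: "x \<in> S"
  show "x \<in> closure (S - N)"
  proof (rule ccontr)
    assume "x \<notin> closure (S - N)"
    then have "open (S \<inter> - closure (S - N))" "x \<in> S \<inter> - closure (S - N)" using x \<open>open S\<close> by auto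
    moreover have "S \<inter> - closure (S - N) \<subseteq> N" using closure_subset by blast
    ultimately show False using open_not_negligible \<open>negligible N\<close> negligible_subset by blast
  qed
qed

text \<open>The complement of a null set is dense in the interval, and the bound passes to limits.
  The function is first extended to the closed interval, so that it is continuous on the closure of
  the smaller set.\<close>

lemma lipschitz_on_of_AE:
  fixes \<beta> :: "real \<Rightarrow> 'b::complete_space"
  assumes "K-lipschitz_on {a<..<c} \<beta>" and "negligible N" and lip: "C-lipschitz_on ({a<..<c} - N) \<beta>"
  shows "C-lipschitz_on {a<..<c} \<beta>"
proof -
  obtain \<gamma> where \<gamma>: "K-lipschitz_on (closure {a<..<c}) \<gamma>" "\<And>x. x \<in> {a<..<c} \<Longrightarrow> \<gamma> x = \<beta> x"
    using lipschitz_extend_closure[OF assms(1)] by blast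
  have "C-lipschitz_on (closure ({a<..<c} - N)) \<gamma>"
  proof (rule lipschitz_on_closure)
    show "C-lipschitz_on ({a<..<c} - N) \<gamma>" by (rule lipschitz_on_transform[OF lip]) (use \<gamma>(2) in auto)
    show "continuous_on (closure ({a<..<c} - N)) \<gamma>"
      by (rule continuous_on_subset[OF lipschitz_on_continuous_on[OF \<gamma>(1)]]) (simp add: closure_mono)
  qed
  then have "C-lipschitz_on {a<..<c} \<gamma>"
    by (rule lipschitz_on_subset) (rule subset_closure_Diff_negligible[OF open_greaterThanLessThan assms(2)])
  then show ?thesis by (rule lipschitz_on_transform) (simp add: \<gamma>(2))
qed

text \<open>A Lipschitz function on a dense subset extends with the same constant; closedness of
  \<open>A\<close> keeps the values admissible.\<close>

lemma lipschitz_representative_exists: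
  fixes \<alpha> :: "real \<Rightarrow> 'b::complete_space"
  assumes "negligible N" and lip: "C-lipschitz_on ({a<..<c} - N) \<alpha>" and "closed A" and A: "\<And>s. s \<in> {a<..<c} \<Longrightarrow> \<alpha> s \<in> A"
  shows "\<exists>\<beta>. C-lipschitz_on {a<..<c} \<beta> \<and> (\<forall>s\<in>{a<..<c}. \<beta> s \<in> A) \<and> (\<forall>s\<in>{a<..<c} - N. \<beta> s = \<alpha> s)"
proof -
  obtain \<beta> where \<beta>: "C-lipschitz_on (closure ({a<..<c} - N)) \<beta>" "\<forall>s\<in>{a<..<c} - N. \<beta> s = \<alpha> s"
    using lipschitz_extend_closure[OF lip] by blast
  have sub: "{a<..<c} \<subseteq> closure ({a<..<c} - N)"
    by (rule subset_closure_Diff_negligible[OF open_greaterThanLessThan assms(1)])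
  have "\<beta> ` closure ({a<..<c} - N) \<subseteq> A"
    by (rule image_closure_subset[OF lipschitz_on_continuous_on[OF \<beta>(1)] \<open>closed A\<close>]) (use \<beta>(2) A in auto)
  then show ?thesis using \<beta> lipschitz_on_subset[OF \<beta>(1) sub] sub by blast
qed

subsection \<open>Reduction of the control problem\<close>

locale convex_hamiltonian =
  fixes I :: "real set" and A :: "(real ^ 'm) set"
    and f :: "real \<Rightarrow> real ^ 'n \<Rightarrow> real ^ 'n \<Rightarrow> real ^ 'm \<Rightarrow> real ^ 'n"
    and L :: "real \<Rightarrow> real ^ 'n \<Rightarrow> real ^ 'n \<Rightarrow> real ^ 'm \<Rightarrow> real"
    and Ha :: "real \<Rightarrow> real ^ 'n \<Rightarrow> real ^ 'n \<Rightarrow> real ^ 'n \<Rightarrow> real ^ 'm \<Rightarrow> real ^ 'm"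
    and \<mu> lam :: real
  assumes A_convex: "convex A"
    and grad: "is_control_gradient I A (hamiltonian f L) Ha"
    and mono: "\<lbrakk>t \<in> I; a \<in> A; a' \<in> A\<rbrakk> \<Longrightarrow>
      \<mu> * (norm (a - a'))\<^sup>2 \<le> (Ha t z y p a - Ha t z y p a') \<bullet> (a - a')"
    and lam_pos: "0 < lam"
    and lip: "\<lbrakk>t \<in> I; t' \<in> I; a \<in> A\<rbrakk> \<Longrightarrow> norm (Ha t z y p a - Ha t' z' y' p' a)
      \<le> lam * (\<bar>t - t'\<bar> + norm (z - z') + norm (y - y') + norm (p - p'))"
begin

definition seg :: "real ^ 'm \<Rightarrow> real ^ 'm \<Rightarrow> real \<Rightarrow> real ^ 'm" where
  "seg a a' \<theta> = a + \<theta> *\<^sub>R (a' - a)"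

lemma seg_mem: "\<lbrakk>a \<in> A; a' \<in> A; \<theta> \<in> {0..1}\<rbrakk> \<Longrightarrow> seg a a' \<theta> \<in> A"
  using convexD[OF A_convex, of a a' "1 - \<theta>" \<theta>] by (simp add: seg_def algebra_simps)

lemma seg_ends: "seg a a' 0 = a" "seg a a' 1 = a'"
  by (simp_all add: seg_def)

lemma seg_mid: "seg a a' (1/2) = (1/2) *\<^sub>R (a + a')"
  by (simp add: seg_def vec_eq_iff field_simps)

text \<open>The chain rule is used with derivatives within sets, since \<open>A\<close> may have
  empty interior; along a segment only the component of \<open>Ha\<close> in its direction
  matters.\<close>

lemma hamiltonian_seg_derivative:
  assumes "t \<in> I" "a \<in> A" "a' \<in> A" "\<theta> \<in> {0..1}"
  shows "((\<lambda>\<theta>. hamiltonian f L t z y p (seg a a' \<theta>)) has_derivative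
    (\<lambda>k. k * (Ha t z y p (seg a a' \<theta>) \<bullet> (a' - a)))) (at \<theta> within {0..1})"
proof -
  have "(seg a a' has_derivative (\<lambda>k. k *\<^sub>R (a' - a))) (at \<theta> within {0..1})"
    unfolding seg_def by (auto intro!: derivative_eq_intros)
  moreover have "(hamiltonian f L t z y p has_derivative (\<lambda>v. Ha t z y p (seg a a' \<theta>) \<bullet> v))
      (at (seg a a' \<theta>) within seg a a' ` {0..1})"
  proof (rule has_derivative_subset)
    show "(hamiltonian f L t z y p has_derivative (\<lambda>v. Ha t z y p (seg a a' \<theta>) \<bullet> v)) (at (seg a a' \<theta>) within A)"
      using grad assms seg_mem[OF assms(2,3)] unfolding is_control_gradient_def by blast
    show "seg a a' ` {0..1} \<subseteq> A" using seg_mem[OF assms(2,3)] by blast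
  qed
  ultimately show ?thesis
    using has_derivative_in_compose[of "seg a a'"] by fastforce
qed

text \<open>Mean value theorem for the difference of the two Hamiltonians along the segment: both
  gradients are then taken at the same control, as in the Lipschitz hypothesis.\<close>

lemma hamiltonian_increment_diff:
  assumes "t \<in> I" "t' \<in> I" "a \<in> A" "a' \<in> A"
  shows "\<bar>(hamiltonian f L t z y p a' - hamiltonian f L t z y p a)
      - (hamiltonian f L t' z' y' p' a' - hamiltonian f L t' z' y' p' a)\<bar>
    \<le> lam * (\<bar>t - t'\<bar> + norm (z - z') + norm (y - y') + norm (p - p')) * norm (a' - a)"
proof -
  let ?h = "\<lambda>\<theta>. hamiltonian f L t z y p (seg a a' \<theta>) - hamiltonian f L t' z' y' p' (seg a a' \<theta>)"
  have "(?h has_derivative (\<lambda>k. k * (Ha t z y p (seg a a' \<theta>) \<bullet> (a' - a))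
      - k * (Ha t' z' y' p' (seg a a' \<theta>) \<bullet> (a' - a)))) (at \<theta> within {0..1})" if "\<theta> \<in> {0..1}" for \<theta>
    using assms that by (intro has_derivative_diff hamiltonian_seg_derivative)
  then obtain \<theta> where \<theta>: "\<theta> \<in> {0<..<1}" and "?h 1 - ?h 0 = (1 - 0) * (Ha t z y p (seg a a' \<theta>) \<bullet> (a' - a))
      - (1 - 0) * (Ha t' z' y' p' (seg a a' \<theta>) \<bullet> (a' - a))"
    using mvt_simple[of 0 1 ?h "\<lambda>\<theta> k. k * (Ha t z y p (seg a a' \<theta>) \<bullet> (a' - a))
      - k * (Ha t' z' y' p' (seg a a' \<theta>) \<bullet> (a' - a))"] by auto
  then have eq: "?h 1 - ?h 0 = (Ha t z y p (seg a a' \<theta>) - Ha t' z' y' p' (seg a a' \<theta>)) \<bullet> (a' - a)"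
    by (simp add: inner_diff_left)
  have "\<bar>?h 1 - ?h 0\<bar> \<le> norm (Ha t z y p (seg a a' \<theta>) - Ha t' z' y' p' (seg a a' \<theta>)) * norm (a' - a)"
    unfolding eq by (rule Cauchy_Schwarz_ineq2)
  also have "\<dots> \<le> lam * (\<bar>t - t'\<bar> + norm (z - z') + norm (y - y') + norm (p - p')) * norm (a' - a)"
    using assms \<theta> by (intro mult_right_mono lip seg_mem) auto
  finally show ?thesis by (simp add: seg_ends algebra_simps)
qed

lemma L_mixed:
  assumes "t \<in> I" "t' \<in> I" "a \<in> A" "a' \<in> A"
  shows "\<bar>(L t z y a' - L t z y a) - (L t' z' y' a' - L t' z' y' a)\<bar>
    \<le> lam * (\<bar>t - t'\<bar> + norm (z - z') + norm (y - y')) * norm (a' - a)"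
  using hamiltonian_increment_diff[OF assms, of z y 0 z' y' 0] by (simp add: hamiltonian_def)

text \<open>For a common costate \<open>p\<close> the bound of
  \<open>hamiltonian_increment_diff\<close> is free of \<open>p\<close>, while the quantity inside
  the absolute value is affine in \<open>p\<close> with slope \<open>v\<close>. Letting
  \<open>p = k *\<^sub>R v\<close> grow forces \<open>v = 0\<close>.\<close>

lemma f_increment_eq:
  assumes "t \<in> I" "t' \<in> I" "a \<in> A" "a' \<in> A"
  shows "f t z y a' - f t z y a = f t' z' y' a' - f t' z' y' a"
proof (rule ccontr)
  define v where "v = (f t z y a' - f t z y a) - (f t' z' y' a' - f t' z' y' a)"
  define c where "c = (L t z y a' - L t z y a) - (L t' z' y' a' - L t' z' y' a)"
  define B where "B = lam * (\<bar>t - t'\<bar> + norm (z - z') + norm (y - y')) * norm (a' - a)"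
  assume "f t z y a' - f t z y a \<noteq> f t' z' y' a' - f t' z' y' a"
  then have v: "0 < v \<bullet> v" by (simp add: v_def)
  have bound: "\<bar>k * (v \<bullet> v) + c\<bar> \<le> B" for k
  proof -
    have "k * (v \<bullet> v) + c = (hamiltonian f L t z y (k *\<^sub>R v) a' - hamiltonian f L t z y (k *\<^sub>R v) a)
        - (hamiltonian f L t' z' y' (k *\<^sub>R v) a' - hamiltonian f L t' z' y' (k *\<^sub>R v) a)"
      by (simp add: hamiltonian_def c_def v_def algebra_simps)
    then show ?thesis
      using hamiltonian_increment_diff[OF assms, of z y "k *\<^sub>R v" z' y' "k *\<^sub>R v"] by (simp add: B_def)
  qed
  have "(B + \<bar>c\<bar> + 1) / (v \<bullet> v) * (v \<bullet> v) = B + \<bar>c\<bar> + 1" using v by simp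
  then show False using bound[of "(B + \<bar>c\<bar> + 1) / (v \<bullet> v)"] by linarith
qed

text \<open>For the costates \<open>v\<close> and 0 at the same point, the increments of the
  Hamiltonian differ by exactly \<open>v \<bullet> v\<close>, while the bound is linear in
  \<open>norm v\<close>.\<close>

lemma f_lip_control:
  assumes "t \<in> I" "a \<in> A" "a' \<in> A"
  shows "norm (f t z y a' - f t z y a) \<le> lam * norm (a' - a)"
proof -
  define v where "v = f t z y a' - f t z y a"
  have "(hamiltonian f L t z y v a' - hamiltonian f L t z y v a)
      - (hamiltonian f L t z y 0 a' - hamiltonian f L t z y 0 a) = v \<bullet> v"
    by (simp add: hamiltonian_def v_def algebra_simps)
  then have "v \<bullet> v \<le> lam * norm v * norm (a' - a)"
    using hamiltonian_increment_diff[OF assms(1,1,2,3), of z y v z y 0] by simp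
  then have "norm v * norm v \<le> norm v * (lam * norm (a' - a))"
    by (simp add: dot_square_norm power2_eq_square mult_ac)
  then show ?thesis
    using lam_pos unfolding v_def[symmetric]
    by (cases "v = 0") (auto simp: mult_le_cancel_left)
qed

text \<open>Subtracting \<open>c / 2 * \<theta>\<^sup>2\<close> leaves a function with nondecreasing
  derivative along the segment, so its mean slope on the first half is at most that on the second.
  The quadratic then contributes \<open>c / 8\<close> at the midpoint.\<close>

lemma hamiltonian_strongly_convex:
  assumes "t \<in> I" "a \<in> A" "a' \<in> A"
  shows "hamiltonian f L t z y p ((1/2) *\<^sub>R (a + a'))
    \<le> (hamiltonian f L t z y p a + hamiltonian f L t z y p a') / 2 - \<mu> / 8 * (norm (a - a'))\<^sup>2"
proof -
  let ?h = "\<lambda>\<theta>. hamiltonian f L t z y p (seg a a' \<theta>)" and ?d = "\<lambda>\<theta>. Ha t z y p (seg a a' \<theta>) \<bullet> (a' - a)"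
  define c where "c = \<mu> * (norm (a - a'))\<^sup>2"
  let ?k = "\<lambda>\<theta>. ?h \<theta> - c / 2 * \<theta>\<^sup>2"
  have der: "(?k has_derivative (\<lambda>k. k * (?d \<theta> - c * \<theta>))) (at \<theta> within S)"
    if "\<theta> \<in> {0..1}" "S \<subseteq> {0..1}" for \<theta> S
  proof -
    have "(?h has_derivative (\<lambda>k. k * ?d \<theta>)) (at \<theta> within S)"
      by (rule has_derivative_subset[OF hamiltonian_seg_derivative]) (use assms that in auto)
    then show ?thesis by (auto intro!: derivative_eq_intros simp: algebra_simps)
  qed
  obtain \<theta>1 where 1: "\<theta>1 \<in> {0<..<1/2}" "?k (1/2) - ?k 0 = (1/2 - 0) * (?d \<theta>1 - c * \<theta>1)"
    using mvt_simple[of 0 "1/2" ?k "\<lambda>\<theta> k. k * (?d \<theta> - c * \<theta>)"] der by auto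
  obtain \<theta>2 where 2: "\<theta>2 \<in> {1/2<..<1}" "?k 1 - ?k (1/2) = (1 - 1/2) * (?d \<theta>2 - c * \<theta>2)"
    using mvt_simple[of "1/2" 1 ?k "\<lambda>\<theta> k. k * (?d \<theta> - c * \<theta>)"] der by auto
  have lt: "\<theta>1 < \<theta>2" and m: "seg a a' \<theta>1 \<in> A" "seg a a' \<theta>2 \<in> A"
    using 1(1) 2(1) assms by (auto intro: seg_mem)
  have diff: "seg a a' \<theta>2 - seg a a' \<theta>1 = (\<theta>2 - \<theta>1) *\<^sub>R (a' - a)"
    by (simp add: seg_def algebra_simps)
  have "\<mu> * (norm (seg a a' \<theta>2 - seg a a' \<theta>1))\<^sup>2
      \<le> (Ha t z y p (seg a a' \<theta>2) - Ha t z y p (seg a a' \<theta>1)) \<bullet> (seg a a' \<theta>2 - seg a a' \<theta>1)"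
    by (rule mono[OF assms(1) m(2,1)])
  then have "(\<theta>2 - \<theta>1) * (c * (\<theta>2 - \<theta>1)) \<le> (\<theta>2 - \<theta>1) * (?d \<theta>2 - ?d \<theta>1)"
    unfolding diff c_def
    by (simp add: inner_diff_left power_mult_distrib power2_eq_square norm_minus_commute mult_ac)
  then have "c * (\<theta>2 - \<theta>1) \<le> ?d \<theta>2 - ?d \<theta>1" using lt by (simp add: mult_le_cancel_left_pos)
  then have "?k (1/2) - ?k 0 \<le> ?k 1 - ?k (1/2)" unfolding 1(2) 2(2) by (simp add: algebra_simps)
  then show ?thesis by (simp add: seg_ends seg_mid c_def power2_eq_square field_simps)
qed

lemma L_strongly_convex:
  assumes "t \<in> I" "a \<in> A" "a' \<in> A"
  shows "L t z y ((1/2) *\<^sub>R (a + a')) \<le> (L t z y a + L t z y a') / 2 - \<mu> / 8 * (norm (a - a'))\<^sup>2"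
  using hamiltonian_strongly_convex[OF assms, of z y 0] by (simp add: hamiltonian_def)

text \<open>The midpoint defect of the Hamiltonian is affine in the costate with slope
  \<open>v\<close>, the defect of \<open>f\<close>, and strong convexity bounds it above by a number
  free of the costate; hence \<open>v = 0\<close>.\<close>

lemma f_midpoint:
  assumes "t \<in> I" "a \<in> A" "a' \<in> A"
  shows "f t z y ((1/2) *\<^sub>R (a + a')) = (1/2) *\<^sub>R (f t z y a + f t z y a')"
proof (rule ccontr)
  define v where "v = f t z y ((1/2) *\<^sub>R (a + a')) - (1/2) *\<^sub>R (f t z y a + f t z y a')"
  define c where "c = (L t z y a + L t z y a') / 2 - L t z y ((1/2) *\<^sub>R (a + a')) - \<mu> / 8 * (norm (a - a'))\<^sup>2"
  assume "f t z y ((1/2) *\<^sub>R (a + a')) \<noteq> (1/2) *\<^sub>R (f t z y a + f t z y a')"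
  then have v: "0 < v \<bullet> v" by (simp add: v_def)
  have vu: "v \<bullet> u = f t z y ((1/2) *\<^sub>R (a + a')) \<bullet> u - (f t z y a \<bullet> u + f t z y a' \<bullet> u) / 2" for u
    by (simp only: v_def inner_diff_left inner_add_left inner_scaleR_left)
  have "k * (v \<bullet> v) \<le> c" for k
    using hamiltonian_strongly_convex[OF assms, of z y "k *\<^sub>R v"] vu[of "k *\<^sub>R v"]
    unfolding hamiltonian_def c_def inner_scaleR_right by argo
  from this[of "(c + 1) / (v \<bullet> v)"] v show False by simp
qed

end

text \<open>The derivative is bounded on the compact convex set
  \<open>{t0..T} \<times> cball 0 R\<close>, and points with equal \<open>z\<close> differ in time
  only.\<close>

lemma C1_on_time_lipschitz:
  fixes tau :: "real \<Rightarrow> 'a::euclidean_space \<Rightarrow> real"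
  assumes "C1_on ({t0..T} \<times> UNIV) (\<lambda>(t, z). tau t z)"
  shows "\<exists>k>0. \<forall>s\<in>{t0..T}. \<forall>s'\<in>{t0..T}. \<forall>z. norm z \<le> R \<longrightarrow> \<bar>tau s z - tau s' z\<bar> \<le> k * \<bar>s - s'\<bar>"
proof -
  obtain F' :: "real \<times> 'a \<Rightarrow> (real \<times> 'a) \<Rightarrow>\<^sub>L real" where
    F': "\<And>v. v \<in> {t0..T} \<times> UNIV \<Longrightarrow> ((\<lambda>(t, z). tau t z) has_derivative F' v) (at v within {t0..T} \<times> UNIV)"
    "continuous_on ({t0..T} \<times> UNIV) F'"
    using assms unfolding C1_on_def by blast
  let ?S = "{t0..T} \<times> cball (0::'a) R"
  have C: "compact (F' ` ?S)"
    by (rule compact_continuous_image[OF continuous_on_subset[OF F'(2)]]) (auto intro: compact_Times)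
  obtain B where B: "\<forall>D\<in>F' ` ?S. norm D \<le> B"
    using compact_imp_bounded[OF C] unfolding bounded_iff by blast
  have "\<bar>tau s z - tau s' z\<bar> \<le> (\<bar>B\<bar> + 1) * \<bar>s - s'\<bar>" if "s \<in> {t0..T}" "s' \<in> {t0..T}" "norm z \<le> R" for s s' z
  proof -
    have "norm ((\<lambda>(t, z). tau t z) (s, z) - (\<lambda>(t, z). tau t z) (s', z)) \<le> B * norm ((s, z) - (s', z))"
    proof (rule differentiable_bound[of ?S _ "\<lambda>v. blinfun_apply (F' v)"])
      show "convex ?S" by (intro convex_Times) auto
      fix v assume v: "v \<in> ?S"
      show "((\<lambda>(t, z). tau t z) has_derivative F' v) (at v within ?S)"
        by (rule has_derivative_subset[OF F'(1)]) (use v in auto)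
      show "onorm (F' v) \<le> B" using bspec[OF B imageI[OF v]] by (simp add: norm_blinfun.rep_eq)
    qed (use that in auto)
    also have "norm ((s, z) - (s', z)) = \<bar>s - s'\<bar>" by (simp add: norm_prod_def)
    also have "B * \<bar>s - s'\<bar> \<le> (\<bar>B\<bar> + 1) * \<bar>s - s'\<bar>" by (intro mult_right_mono) auto
    finally show ?thesis by simp
  qed
  then show ?thesis by (intro exI[of _ "\<bar>B\<bar> + 1"]) auto
qed

text \<open>Joint differentiability gives the chain rule along every curve through the point. Curves
  with constant state, and variations in space at fixed time, identify the two partial derivatives
  with values of the total one; interior times turn the derivative within the strip into a full
  one.\<close>

lemma C1_on_curve_derivative:
  fixes tau :: "real \<Rightarrow> 'a::euclidean_space \<Rightarrow> real"
  assumes C1: "C1_on ({t0..T} \<times> UNIV) (\<lambda>(t, z). tau t z)" and s: "t0 < s" "s < T"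
    and tau_t: "((\<lambda>r. tau r (x s)) has_real_derivative dt) (at s within {t0..T})"
    and tau_z: "GDERIV (tau s) (x s) :> dz"
    and x: "(x has_vector_derivative v) (at s)"
  shows "((\<lambda>r. tau r (x r)) has_real_derivative dt + dz \<bullet> v) (at s)"
proof -
  let ?f = "\<lambda>(t, z). tau t z"
  obtain D :: "(real \<times> 'a) \<Rightarrow>\<^sub>L real" where D0: "(?f has_derivative D) (at (s, x s) within {t0..T} \<times> UNIV)"
    using C1 s unfolding C1_on_def by fastforce
  have D: "(?f has_derivative D) (at (s, x s))"
  proof -
    have "(?f has_derivative D) (at (s, x s) within {t0<..<T} \<times> UNIV)"
      by (rule has_derivative_subset[OF D0]) auto
    then show ?thesis using s by (subst (asm) at_within_open) (auto intro: open_Times)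
  qed
  have curve: "((\<lambda>r. ?f (r, y r)) has_derivative (\<lambda>k. D (k, k *\<^sub>R u))) (at s)"
    if "(y has_vector_derivative u) (at s)" "y s = x s" for y u
  proof -
    have "((\<lambda>r. (r, y r)) has_derivative (\<lambda>k. (k, k *\<^sub>R u))) (at s)"
      using that unfolding has_vector_derivative_def by (intro has_derivative_Pair has_derivative_ident)
    from has_derivative_compose[OF this, of ?f D] D that show ?thesis by simp
  qed
  have "((\<lambda>r. ?f (r, x s)) has_derivative (\<lambda>k. D (k, k *\<^sub>R 0))) (at s)"
    by (rule curve) (auto intro: has_vector_derivative_const)
  moreover have "((\<lambda>r. tau r (x s)) has_derivative (\<lambda>k. dt * k)) (at s)"
    using tau_t unfolding at_within_Icc_at[OF s] has_field_derivative_def .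
  ultimately have "(\<lambda>k. D (k, k *\<^sub>R 0)) = (\<lambda>k. dt * k)" unfolding prod.case by (rule has_derivative_unique)
  from fun_cong[OF this, of 1] have Dt: "D (1, 0) = dt" by simp
  have "((\<lambda>z. (s, z)) has_derivative (\<lambda>u. (0, u))) (at (x s))"
    by (intro has_derivative_Pair has_derivative_ident has_derivative_const)
  from has_derivative_compose[OF this, of ?f D] D have "((\<lambda>z. tau s z) has_derivative (\<lambda>u. D (0, u))) (at (x s))" by simp
  moreover have "(tau s has_derivative (\<lambda>u. u \<bullet> dz)) (at (x s))" using tau_z by (simp add: gderiv_def)
  ultimately have "(\<lambda>u. D (0, u)) = (\<lambda>u. u \<bullet> dz)" by (intro has_derivative_unique)
  from fun_cong[OF this, of v] have Dz: "D (0, v) = v \<bullet> dz" .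
  have "D (k, k *\<^sub>R v) = (dt + dz \<bullet> v) * k" for k
  proof -
    have "D (k, k *\<^sub>R v) = D (k *\<^sub>R ((1, 0) + (0, v)))" by simp
    also have "\<dots> = k *\<^sub>R (D (1, 0) + D (0, v))" by (simp only: blinfun.scaleR_right blinfun.add_right)
    finally show ?thesis by (simp add: Dt Dz inner_commute mult.commute)
  qed
  then show ?thesis using curve[OF x refl] by (simp add: has_field_derivative_def)
qed

section \<open>Growth of the delayed time\<close>

context delay_dynamics
begin

text \<open>The condition says that \<open>delayed x s - d * s\<close> has nonnegative derivative
  almost everywhere; this function is Lipschitz, so it increases.\<close>

lemma delayed_expanding_of_derivative:
  assumes C1: "C1_on ({t0..T} \<times> UNIV) (\<lambda>(t, z). tau t z)"
    and tau_t: "\<forall>t\<in>{t0..T}. \<forall>z. ((\<lambda>s. tau s z) has_real_derivative tau_t t z) (at t within {t0..T})"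
    and tau_z: "\<forall>t\<in>{t0..T}. \<forall>z. GDERIV (tau t) z :> tau_z t z"
    and t: "t0 \<le> t" and x: "K-lipschitz_on {t..T} x"
    and diff: "AE s in lebesgue_on {t<..<T}. \<exists>v. (x has_vector_derivative v) (at s)"
    and ge: "AE s in lebesgue_on {t..T}. 1 - tau_t s (x s) - tau_z s (x s) \<bullet> vector_derivative x (at s) \<ge> d"
    and pq: "t \<le> p" "p \<le> q" "q \<le> T"
  shows "d * (q - p) \<le> delayed x q - delayed x p"
proof -
  obtain R where R: "\<And>s. s \<in> {t..T} \<Longrightarrow> norm (x s) \<le> R"
    using compact_imp_bounded[OF compact_continuous_image[OF lipschitz_on_continuous_on[OF x] compact_Icc]]
    unfolding bounded_iff by blast
  obtain k where k: "0 < k" "\<forall>s\<in>{t0..T}. \<forall>s'\<in>{t0..T}. \<forall>z. norm z \<le> R \<longrightarrow> \<bar>tau s z - tau s' z\<bar> \<le> k * \<bar>s - s'\<bar>"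
    using C1_on_time_lipschitz[OF C1, of R] by blast
  have dl: "(1 + k + ltau * K)-lipschitz_on {t..T} (delayed x)"
    using k by (intro delayed_lipschitz[OF t x R]) auto
  define N where "N = {s \<in> {t<..<T}. \<not> (\<exists>v. (x has_vector_derivative v) (at s))}
    \<union> {s \<in> {t..T}. \<not> 1 - tau_t s (x s) - tau_z s (x s) \<bullet> vector_derivative x (at s) \<ge> d}"
  have N: "negligible N"
    using diff ge unfolding N_def by (subst (asm) (1 2) AE_lebesgue_on_iff_negligible) auto
  let ?f = "\<lambda>s. delayed x s - d * s"
  have "((1 + k + ltau * K) + \<bar>d\<bar>)-lipschitz_on {p..q} ?f"
  proof (rule lipschitz_on_diff)
    show "(1 + k + ltau * K)-lipschitz_on {p..q} (delayed x)" by (rule lipschitz_on_subset[OF dl]) (use pq in auto)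
    show "\<bar>d\<bar>-lipschitz_on {p..q} (\<lambda>s. d * s)"
      by (rule lipschitz_onI) (auto simp: dist_real_def abs_mult simp flip: right_diff_distrib)
  qed
  then have "?f p \<le> ?f q"
  proof (rule lipschitz_AE_deriv_nonneg_imp_le[OF pq(2) _ N])
    fix s assume s: "p < s" "s < q" "s \<notin> N"
    then obtain v where v: "(x has_vector_derivative v) (at s)" using pq by (auto simp: N_def)
    have s0: "t0 < s" "s < T" using s pq t by auto
    have ge: "1 - tau_t s (x s) - tau_z s (x s) \<bullet> v \<ge> d"
      using s pq vector_derivative_at[OF v] by (auto simp: N_def)
    have "((\<lambda>r. tau r (x r)) has_real_derivative tau_t s (x s) + tau_z s (x s) \<bullet> v) (at s)"
      using tau_t tau_z s0 by (intro C1_on_curve_derivative[OF C1 s0 _ _ v]) auto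
    then have "(?f has_real_derivative 1 - (tau_t s (x s) + tau_z s (x s) \<bullet> v) - d * 1) (at s)"
      unfolding delayed_def by (intro DERIV_diff DERIV_ident DERIV_cmult)
    then show "\<exists>D\<ge>0. (?f has_real_derivative D) (at s)" using ge by (intro exI conjI) auto
  qed
  then show ?thesis by (simp add: algebra_simps)
qed

lemma sol_cong:
  assumes "t0 \<le> t" and x: "sol t w u x" and eq: "\<And>s. s \<in> {t - b..T} \<Longrightarrow> y s = x s" "t \<le> T"
  shows "sol t w u y"
proof -
  have "rate y \<sigma> = rate x \<sigma>" if "\<sigma> \<in> {t..T}" for \<sigma>
  proof -
    have "y \<sigma> = x \<sigma>" using that b_nonneg by (intro eq) auto
    moreover have "delayed x \<sigma> \<in> {t - b..T}" using delayed_bounds[of \<sigma> x] that assms(1) by auto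
    ultimately show ?thesis using eq by (simp add: rate_def delayed_def)
  qed
  then have "integral {t..s} (rate y) = integral {t..s} (rate x)" if "s \<in> {t..T}" for s
    using that by (intro integral_cong) auto
  moreover have "y s = x s" if "s \<in> {t..T}" for s using that b_nonneg by (intro eq(1)) auto
  ultimately have A: "\<forall>s\<in>{t..T}. y s = w 0 + integral {t..s} (rate y) + integral {t..s} u"
    using x by (simp add: sol_def)
  have "y (t + \<theta>) = x (t + \<theta>)" if "\<theta> \<in> {-b..0}" for \<theta> using that eq(2) by (intro eq(1)) auto
  then have B: "\<forall>\<theta>\<in>{-b..0}. y (t + \<theta>) = w \<theta>" using x by (simp add: sol_def)
  obtain K where "K-lipschitz_on {t - b..T} x" using x by (auto simp: sol_def)
  then have "K-lipschitz_on {t - b..T} y" by (rule lipschitz_on_transform) (rule eq(1))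
  then show ?thesis unfolding sol_def using A B by (intro conjI exI)
qed

end

section \<open>From the trajectories of the problem to solutions of the integral equation\<close>

locale delay_trajectories = delay_dynamics t0 T b lF cF ltau F tau
  for t0 T b lF cF ltau :: real
    and F :: "real \<Rightarrow> real ^ 'n \<Rightarrow> real ^ 'n \<Rightarrow> real ^ 'n"
    and tau :: "real \<Rightarrow> real ^ 'n \<Rightarrow> real" +
  fixes A :: "(real ^ 'm) set" and G :: "real ^ 'm \<Rightarrow> real ^ 'n" and cu :: real
    and f :: "real \<Rightarrow> real ^ 'n \<Rightarrow> real ^ 'n \<Rightarrow> real ^ 'm \<Rightarrow> real ^ 'n"
  assumes A_ne: "A \<noteq> {}" and G_cont: "continuous_on A G"
    and G_bound: "a \<in> A \<Longrightarrow> norm (G a) \<le> cu"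
    and f_eq: "\<lbrakk>t \<in> {t0..T}; a \<in> A\<rbrakk> \<Longrightarrow> f t z y a = F t z y + G a"
begin

text \<open>Controls carry no information outside the open interval, not even measurability.\<close>

definition fill :: "real \<Rightarrow> (real \<Rightarrow> real ^ 'm) \<Rightarrow> real \<Rightarrow> real ^ 'm" where
  "fill t \<alpha> s = (if s \<in> {t<..<T} then \<alpha> s else (SOME a. a \<in> A))"

lemma fill_mem:
  assumes "\<alpha> \<in> controls A t T" shows "fill t \<alpha> s \<in> A"
  using assms A_ne by (auto simp: fill_def controls_def some_in_eq)

lemma fill_measurable:
  assumes "\<alpha> \<in> controls A t T" shows "fill t \<alpha> \<in> borel_measurable lebesgue"
proof -
  have "(\<lambda>s. if s \<in> {t<..<T} then \<alpha> s else 0) \<in> borel_measurable lebesgue"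
    using assms by (subst borel_measurable_if) (auto simp: controls_def)
  then have "(\<lambda>s. if s \<in> {t<..<T} then (if s \<in> {t<..<T} then \<alpha> s else 0) else (SOME a. a \<in> A))
      \<in> borel_measurable lebesgue"
    by (rule measurable_If_set) simp_all
  moreover have "fill t \<alpha> = (\<lambda>s. if s \<in> {t<..<T} then (if s \<in> {t<..<T} then \<alpha> s else 0) else (SOME a. a \<in> A))"
    by (auto simp: fill_def)
  ultimately show ?thesis by simp
qed

lemma controls_of_total:
  assumes "\<alpha> \<in> borel_measurable lebesgue" "range \<alpha> \<subseteq> A" shows "\<alpha> \<in> controls A t T"
  using assms by (auto simp: controls_def intro: measurable_restrict_space1)

lemma G_fill_integrable:
  assumes "\<alpha> \<in> controls A t T" shows "(\<lambda>s. G (fill t \<alpha> s)) absolutely_integrable_on {p..q}"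
proof (rule absolutely_integrable_bounded_measurable)
  show "(\<lambda>s. G (fill t \<alpha> s)) \<in> borel_measurable (lebesgue_on {p..q})"
    by (rule borel_measurable_compose_continuous_on[OF _ _ G_cont])
      (auto intro: measurable_restrict_space1 fill_measurable[OF assms] fill_mem[OF assms])
  show "norm (G (fill t \<alpha> s)) \<le> cu" for s by (rule G_bound[OF fill_mem[OF assms]])
qed

lemma is_trajectory_iff_sol:
  assumes t: "t \<in> {t0..<T}" and \<alpha>: "\<alpha> \<in> controls A t T"
  shows "is_trajectory T b f tau t w \<alpha> x \<longleftrightarrow> sol t w (\<lambda>s. G (fill t \<alpha> s)) x"
proof -
  have "f s (x s) (x (s - tau s (x s))) (\<alpha> s) = rate x s + G (fill t \<alpha> s)" if "s \<in> {t<..<T}" for s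
  proof -
    have "\<alpha> s = fill t \<alpha> s" using that by (simp add: fill_def)
    then show ?thesis
      using f_eq[of s "fill t \<alpha> s"] fill_mem[OF \<alpha>] that t by (simp add: rate_def delayed_def)
  qed
  then have "(AE s in lebesgue_on {t<..<T}.
        (x has_vector_derivative f s (x s) (x (s - tau s (x s))) (\<alpha> s)) (at s))
      \<longleftrightarrow> (AE s in lebesgue_on {t<..<T}. (x has_vector_derivative rate x s + G (fill t \<alpha> s)) (at s))"
    by (intro AE_cong) simp
  moreover have "t \<in> {t0..T}" using t by simp
  note sol_iff_AE_derivative[OF this G_fill_integrable[OF \<alpha>] G_bound[OF fill_mem[OF \<alpha>]]]
  ultimately show ?thesis unfolding is_trajectory_def by (simp add: conj_ac)
qed

text \<open>A solution restricted to \<open>{t - b..T}\<close> satisfies the definite description,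
  and \<open>sol_unique\<close> together with extensionality leaves no other.\<close>

lemma traj_sol:
  assumes t: "t \<in> {t0..<T}" and w: "w \<in> lip_space b" and \<alpha>: "\<alpha> \<in> controls A t T"
  shows "sol t w (\<lambda>s. G (fill t \<alpha> s)) (traj T b f tau t w \<alpha>)"
proof -
  let ?P = "\<lambda>x. x \<in> extensional {t - b..T} \<and> is_trajectory T b f tau t w \<alpha> x"
  obtain Kw where Kw: "Kw-lipschitz_on {-b..0} w" using w by (auto simp: lip_space_def)
  obtain R where R: "\<And>\<theta>. \<theta> \<in> {-b..0} \<Longrightarrow> norm (w \<theta>) \<le> R"
    using compact_imp_bounded[OF compact_continuous_image[OF lipschitz_on_continuous_on[OF Kw] compact_Icc]]
    unfolding bounded_iff by blast
  have "0 \<le> R" using R[of 0] b_nonneg norm_ge_zero[of "w 0"] by (simp del: norm_ge_zero)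
  have t': "t \<in> {t0..T}" "t0 \<le> t" "t \<le> T" using t by auto
  obtain x where x: "sol t w (\<lambda>s. G (fill t \<alpha> s)) x"
    using sol_exists[OF t'(1) \<open>0 \<le> R\<close> Kw R set_lebesgue_integral_eq_integral(1)[OF G_fill_integrable[OF \<alpha>]]
        G_bound[OF fill_mem[OF \<alpha>]]] by blast
  have r: "sol t w (\<lambda>s. G (fill t \<alpha> s)) (restrict x {t - b..T})"
    by (rule sol_cong[OF t'(2) x _ t'(3)]) simp
  have "\<exists>!x. ?P x"
  proof (rule ex1I[of _ "restrict x {t - b..T}"])
    show "?P (restrict x {t - b..T})" using r is_trajectory_iff_sol[OF t \<alpha>] by simp
    fix y assume y: "?P y"
    then have "sol t w (\<lambda>s. G (fill t \<alpha> s)) y" using is_trajectory_iff_sol[OF t \<alpha>] by simp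
    then have "y s = restrict x {t - b..T} s" if "s \<in> {t - b..T}" for s
      using sol_unique[OF t'(2) _ r that] by simp
    then show "y = restrict x {t - b..T}" using y by (intro extensionalityI[of y "{t - b..T}"]) auto
  qed
  from theI'[OF this] show ?thesis using is_trajectory_iff_sol[OF t \<alpha>] unfolding traj_def by blast
qed

text \<open>The hypothesis constrains the chosen function \<open>traj\<close>; uniqueness carries
  the conclusion over to any solution \<open>x\<close>. Within \<open>{t..T}\<close> the control and
  its \<open>fill\<close> differ at most at the two ends.\<close>

lemma delayed_expanding_of_monotone_delay:
  assumes C1: "C1_on ({t0..T} \<times> UNIV) (\<lambda>(t, z). tau t z)"
    and tau_t: "\<forall>t\<in>{t0..T}. \<forall>z. ((\<lambda>s. tau s z) has_real_derivative tau_t t z) (at t within {t0..T})"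
    and tau_z: "\<forall>t\<in>{t0..T}. \<forall>z. GDERIV (tau t) z :> tau_z t z"
    and t: "t \<in> {t0..<T}" and w: "w \<in> lip_space b"
    and \<alpha>: "\<alpha> \<in> borel_measurable lebesgue" "range \<alpha> \<subseteq> A" and x: "sol t w (\<lambda>s. G (\<alpha> s)) x"
    and ge: "let x = traj T b f tau t w \<alpha> in AE s in lebesgue_on {t..T}.
      1 - tau_t s (x s) - tau_z s (x s) \<bullet> vector_derivative x (at s) \<ge> d"
    and pq: "t \<le> p" "p \<le> q" "q \<le> T"
  shows "d * (q - p) \<le> delayed x q - delayed x p"
proof -
  let ?X = "traj T b f tau t w \<alpha>"
  have t': "t \<in> {t0..T}" "t0 \<le> t" using t by auto
  have ctl: "\<alpha> \<in> controls A t T" by (rule controls_of_total[OF \<alpha>])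
  have X: "sol t w (\<lambda>s. G (fill t \<alpha> s)) ?X" by (rule traj_sol[OF t w ctl])
  have "integral {t..s} (\<lambda>s. G (fill t \<alpha> s)) = integral {t..s} (\<lambda>s. G (\<alpha> s))" if "s \<in> {t..T}" for s
    by (rule integral_spike[of "{t, T}"]) (use that in \<open>auto simp: fill_def\<close>)
  then have "sol t w (\<lambda>s. G (\<alpha> s)) ?X" using X by (simp add: sol_def)
  then have eq: "x s = ?X s" if "s \<in> {t - b..T}" for s using sol_unique[OF t'(2) x _ that] by simp
  obtain K where "K-lipschitz_on {t - b..T} ?X" using X by (auto simp: sol_def)
  then have K: "K-lipschitz_on {t..T} ?X" by (rule lipschitz_on_subset) (use b_nonneg in auto)
  have "AE s in lebesgue_on {t<..<T}. (?X has_vector_derivative rate ?X s + G (fill t \<alpha> s)) (at s)"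
    using X sol_iff_AE_derivative[OF t'(1) G_fill_integrable[OF ctl] G_bound[OF fill_mem[OF ctl]]] by blast
  then have "AE s in lebesgue_on {t<..<T}. \<exists>v. (?X has_vector_derivative v) (at s)"
    by (rule eventually_mono) blast
  then have "d * (q - p) \<le> delayed ?X q - delayed ?X p"
    using ge unfolding Let_def
    by (intro delayed_expanding_of_derivative[OF C1 tau_t tau_z t'(2) K _ _ pq])
  moreover have "delayed x s = delayed ?X s" if "s \<in> {t..T}" for s
    using eq[of s] that b_nonneg by (simp add: delayed_def)
  ultimately show ?thesis using pq by simp
qed

end

section \<open>Transfer to the original cost and optimal controls\<close>

locale delay_problem =
  delay_control_data t0 T b lF cF ltau F tau A G L "\<lambda>x. g (x T, hist x T)" cu kG \<mu> lH lL lg kt dd R Kw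
  for t0 T b lF cF ltau :: real
    and F :: "real \<Rightarrow> real ^ 'n \<Rightarrow> real ^ 'n \<Rightarrow> real ^ 'n"
    and tau :: "real \<Rightarrow> real ^ 'n \<Rightarrow> real"
    and A :: "(real ^ 'm) set" and G L g cu kG \<mu> lH lL lg kt dd R Kw +
  fixes f :: "real \<Rightarrow> real ^ 'n \<Rightarrow> real ^ 'n \<Rightarrow> real ^ 'm \<Rightarrow> real ^ 'n"
  assumes f_eq: "\<lbrakk>t \<in> {t0..T}; a \<in> A\<rbrakk> \<Longrightarrow> f t z y a = F t z y + G a"
begin

sublocale delay_trajectories t0 T b lF cF ltau F tau A G cu f
  by unfold_locales (use A_ne G_cont G_bound f_eq in auto)

abbreviation trajectory where "trajectory t w \<alpha> \<equiv> traj T b f tau t w \<alpha>"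

lemma ctl_fill: "\<alpha> \<in> controls A t T \<Longrightarrow> ctl (fill t \<alpha>)"
  using fill_measurable fill_mem by (auto simp: ctl_def)

lemma controlled_trajectory:
  assumes "init t w" "\<alpha> \<in> controls A t T" shows "controlled t w (fill t \<alpha>) (trajectory t w \<alpha>)"
  using assms ctl_fill traj_sol[of t w \<alpha>] by (auto simp: controlled_def init_def lip_space_def)

lemma cost_eq_total:
  assumes init: "init t w" and \<alpha>: "\<alpha> \<in> controls A t T"
  shows "cost T b f L g tau t w \<alpha> = total t (trajectory t w \<alpha>) (fill t \<alpha>)"
proof -
  let ?x = "trajectory t w \<alpha>"
  have x: "controlled t w (fill t \<alpha>) ?x" by (rule controlled_trajectory[OF assms])
  let ?L = "\<lambda>s. L s (?x s) (?x (delayed ?x s)) (fill t \<alpha> s)"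
  have "?L absolutely_integrable_on {t..T}"
    by (rule L_integrable[OF controlled_t(1)[OF x] order_refl controlled_cont'[OF x] controlled_delayed_cont[OF x] controlled_ctl[OF x]])
  then have "?L absolutely_integrable_on {t<..<T}" by (rule set_integrable_subset) auto
  then have "(LINT s:{t<..<T}|lebesgue. ?L s) = integral {t<..<T} ?L"
    by (rule set_lebesgue_integral_eq_integral(2))
  also have "\<dots> = integral {t..T} ?L"
    using integral_open_interval[of t T ?L] by simp
  finally have "(LINT s:{t<..<T}|lebesgue. ?L s) = running t ?x (fill t \<alpha>)" by (simp add: running_def)
  moreover have "(LINT s:{t<..<T}|lebesgue. L s (?x s) (?x (s - tau s (?x s))) (\<alpha> s)) = (LINT s:{t<..<T}|lebesgue. ?L s)"
    by (intro set_lebesgue_integral_cong) (auto simp: fill_def delayed_def)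
  ultimately show ?thesis by (simp add: cost_def total_def Let_def)
qed

text \<open>The terminal cost receives a total function, and \<open>x\<close> and \<open>y\<close>
  may differ outside \<open>{t - b..T}\<close>. The Lipschitz estimate with \<open>e = 0\<close>
  identifies the costs all the same.\<close>

lemma total_unique:
  assumes "controlled t w \<alpha> x" "controlled t w \<alpha> y" shows "total t x \<alpha> = total t y \<alpha>"
proof -
  have "x s = y s" if "s \<in> {t - b..T}" for s
    by (rule sol_unique[OF controlled_t(1)[OF assms(1)] controlled_sol[OF assms(1)] controlled_sol[OF assms(2)] that])
  then show ?thesis using total_diff[OF assms controlled_ctl[OF assms(1)], of 0] by simp
qed

lemma fill_ctl:
  assumes "controlled t w \<beta> y" shows "\<beta> \<in> controls A t T" "controlled t w (fill t \<beta>) y" "total t y (fill t \<beta>) = total t y \<beta>"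
proof -
  show c: "\<beta> \<in> controls A t T" using controlled_ctl[OF assms] by (intro controls_of_total) (auto simp: ctl_def)
  have "negligible {t, T}" by simp
  from controlled_cong[OF assms ctl_fill[OF c] this]
  show "controlled t w (fill t \<beta>) y" "total t y (fill t \<beta>) = total t y \<beta>" by (auto simp: fill_def)
qed

text \<open>The optimal pair of the reduced problem is admissible in the original one, so the
  infimum in \<open>value_fun\<close> is attained. Conversely, \<open>fill\<close> turns an optimal
  control into a competitor of the reduced problem with the same cost.\<close>

lemma
  assumes init: "init t w"
  shows optimal_control_exists: "\<exists>\<alpha>. optimal_control T b A f L g tau t w \<alpha>"
    and optimal_control_imp_optimal:
      "optimal_control T b A f L g tau t w \<alpha> \<Longrightarrow> optimal t w (fill t \<alpha>) (trajectory t w \<alpha>)"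
proof -
  let ?J = "cost T b f L g tau t w"
  obtain \<beta> y where opt: "optimal t w \<beta> y" using optimal_exists[OF init] by blast
  then have y: "controlled t w \<beta> y" using init by (simp add: optimal_def controlled_def)
  note \<beta> = fill_ctl[OF y]
  have J\<beta>: "?J \<beta> = total t y \<beta>"
    using cost_eq_total[OF init \<beta>(1)] total_unique[OF controlled_trajectory[OF init \<beta>(1)] \<beta>(2)] \<beta>(3) by simp
  have min: "?J \<beta> \<le> ?J \<gamma>" if "\<gamma> \<in> controls A t T" for \<gamma>
    unfolding J\<beta> cost_eq_total[OF init that]
    using opt controlled_trajectory[OF init that] by (auto simp: optimal_def controlled_def)
  have val: "value_fun T b A f L g tau t w = ?J \<beta>"
    unfolding value_fun_def by (rule cInf_eq_minimum) (use \<beta>(1) min in auto)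
  then show "\<exists>\<alpha>. optimal_control T b A f L g tau t w \<alpha>"
    using \<beta>(1) by (auto simp: optimal_control_def)
  assume "optimal_control T b A f L g tau t w \<alpha>"
  then have \<alpha>: "\<alpha> \<in> controls A t T" and J\<alpha>: "?J \<alpha> = ?J \<beta>" by (auto simp: optimal_control_def val)
  have "total t (trajectory t w \<alpha>) (fill t \<alpha>) = total t y \<beta>" using J\<alpha> J\<beta> cost_eq_total[OF init \<alpha>] by simp
  then show "optimal t w (fill t \<alpha>) (trajectory t w \<alpha>)"
    using opt controlled_trajectory[OF init \<alpha>] unfolding optimal_def controlled_def by auto
qed

lemma optimal_control_lipschitz_AE:
  assumes init: "init t w" and opt: "optimal_control T b A f L g tau t w \<alpha>"
  shows "\<exists>N. negligible N \<and> reg_const-lipschitz_on ({t<..<T} - N) \<alpha>"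
proof -
  obtain N where N: "negligible N" "reg_const-lipschitz_on ({t<..<T} - N) (fill t \<alpha>)"
    using optimal_lipschitz_AE[OF init optimal_control_imp_optimal[OF init opt]] by blast
  have "reg_const-lipschitz_on ({t<..<T} - N) \<alpha>"
    by (rule lipschitz_on_transform[OF N(2)]) (simp add: fill_def)
  then show ?thesis using N(1) by blast
qed

lemma optimal_control_representative:
  assumes init: "init t w" and opt: "optimal_control T b A f L g tau t w \<alpha>"
  shows "\<exists>\<beta>. lipschitz_representative A t T \<alpha> \<beta>"
proof -
  obtain N where N: "negligible N" "reg_const-lipschitz_on ({t<..<T} - N) \<alpha>"
    using optimal_control_lipschitz_AE[OF assms] by blast
  have \<alpha>: "\<alpha> s \<in> A" if "s \<in> {t<..<T}" for s
    using opt that by (auto simp: optimal_control_def controls_def)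
  obtain \<beta> where \<beta>: "reg_const-lipschitz_on {t<..<T} \<beta>" "\<forall>s\<in>{t<..<T}. \<beta> s \<in> A" "\<forall>s\<in>{t<..<T} - N. \<beta> s = \<alpha> s"
    using lipschitz_representative_exists[OF N compact_imp_closed[OF A_compact] \<alpha>] by blast
  have "\<beta> \<in> borel_measurable (lebesgue_on {t<..<T})"
    by (intro continuous_imp_measurable_on_sets_lebesgue lipschitz_on_continuous_on[OF \<beta>(1)]) simp
  moreover have "{s \<in> {t<..<T}. \<not> \<beta> s = \<alpha> s} \<subseteq> N" using \<beta>(3) by blast
  then have "AE s in lebesgue_on {t<..<T}. \<beta> s = \<alpha> s"
    using negligible_subset[OF N(1)] by (subst AE_lebesgue_on_iff_negligible) auto
  ultimately show ?thesis
    using \<beta> unfolding lipschitz_representative_def controls_def by blast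
qed

text \<open>Off a null set the representative inherits the estimate for \<alpha>; its own
  unspecified constant can then be replaced by \<open>reg_const\<close>.\<close>

lemma representative_lipschitz:
  assumes init: "init t w" and opt: "optimal_control T b A f L g tau t w \<alpha>"
    and rep: "lipschitz_representative A t T \<alpha> \<beta>"
  shows "reg_const-lipschitz_on {t<..<T} \<beta>"
proof -
  obtain N where N: "negligible N" "reg_const-lipschitz_on ({t<..<T} - N) \<alpha>"
    using optimal_control_lipschitz_AE[OF init opt] by blast
  let ?N = "N \<union> {s \<in> {t<..<T}. \<not> \<beta> s = \<alpha> s}"
  obtain K where K: "K-lipschitz_on {t<..<T} \<beta>" using rep by (auto simp: lipschitz_representative_def)
  have "AE s in lebesgue_on {t<..<T}. \<beta> s = \<alpha> s" using rep by (simp add: lipschitz_representative_def)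
  then have "negligible {s \<in> {t<..<T}. \<not> \<beta> s = \<alpha> s}" by (subst (asm) AE_lebesgue_on_iff_negligible) auto
  then have "negligible ?N" using N(1) by (rule negligible_Un[rotated])
  moreover have "reg_const-lipschitz_on ({t<..<T} - ?N) \<alpha>" by (rule lipschitz_on_subset[OF N(2)]) auto
  then have "reg_const-lipschitz_on ({t<..<T} - ?N) \<beta>" by (rule lipschitz_on_transform) auto
  ultimately show ?thesis by (rule lipschitz_on_of_AE[OF K])
qed

end

text \<open>Membership in \<open>lip_space\<close> provides some Lipschitz constant, and the
  essential bound on the derivative improves it to \<open>r\<close>. Thus \<open>r\<close> serves
  both as \<open>R\<close> and as \<open>Kw\<close>.\<close>

lemma V_set_lipschitz:
  assumes "w \<in> V_set b r" "0 \<le> r"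
  shows "r-lipschitz_on {-b..0} w" "\<And>\<theta>. \<theta> \<in> {-b..0} \<Longrightarrow> norm (w \<theta>) \<le> r"
proof -
  obtain K where K: "K-lipschitz_on {-b..0} w" using assms by (auto simp: V_set_def P_set_def lip_space_def)
  show "norm (w \<theta>) \<le> r" if "\<theta> \<in> {-b..0}" for \<theta> using assms that by (auto simp: V_set_def P_set_def)
  have "negligible {\<theta> \<in> {-b..0}. \<not> (\<exists>v. (w has_vector_derivative v) (at \<theta>) \<and> norm v \<le> r)}"
    using assms AE_lebesgue_on_iff_negligible[of "{-b..0}"] by (simp add: V_set_def)
  from lipschitz_onI_AE_deriv_bound[OF K this assms(2)] show "r-lipschitz_on {-b..0} w" by auto
qed

section \<open>Choice of the constants and conclusion\<close>

lemma pos_choice: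
  fixes P :: "real \<Rightarrow> real \<Rightarrow> bool"
  assumes "\<forall>R>0. \<exists>l>0. P R l"
  shows "\<exists>g. \<forall>R>0. 0 < g R \<and> P R (g R)"
  using assms by (intro choice allI) blast

text \<open>Substituting \<open>s = T + \<theta>\<close> turns the norm on histories into the form
  required of the terminal functional in \<open>delay_control\<close>.\<close>

lemma terminal_cost_lipschitz:
  fixes x y :: "real \<Rightarrow> real ^ 'n"
  assumes "0 \<le> b" and x: "K-lipschitz_on {T - b..T} x" and y: "K-lipschitz_on {T - b..T} y"
    and R: "\<And>s. s \<in> {T - b..T} \<Longrightarrow> norm (x s) \<le> R" "\<And>s. s \<in> {T - b..T} \<Longrightarrow> norm (y s) \<le> R"
    and g: "\<forall>(z1, w1)\<in>X_space b. \<forall>(z2, w2)\<in>X_space b. w1 \<in> P_set b R \<longrightarrow> w2 \<in> P_set b R \<longrightarrow>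
      \<bar>g (z1, w1) - g (z2, w2)\<bar> \<le> l * X_norm b (z1 - z2, \<lambda>\<theta>. w1 \<theta> - w2 \<theta>)"
  shows "\<bar>g (x T, hist x T) - g (y T, hist y T)\<bar>
    \<le> l * (norm (x T - y T) + integral {T - b..T} (\<lambda>s. norm (x s - y s)))"
proof -
  have hist: "(hist x T) \<in> P_set b R" "(x T, hist x T) \<in> X_space b"
    if "K-lipschitz_on {T - b..T} x" "\<And>s. s \<in> {T - b..T} \<Longrightarrow> norm (x s) \<le> R" for x :: "real \<Rightarrow> real ^ 'n"
  proof -
    have "K-lipschitz_on {-b..0} (hist x T)"
    proof (rule lipschitz_onI)
      fix p q assume "p \<in> {-b..0}" "q \<in> {-b..0}"
      then show "dist (hist x T p) (hist x T q) \<le> K * dist p q"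
        using lipschitz_onD[OF that(1), of "T + p" "T + q"] by (simp add: hist_def)
    qed (rule lipschitz_on_nonneg[OF that(1)])
    then have "hist x T \<in> lip_space b" by (auto simp: lip_space_def)
    then show "(hist x T) \<in> P_set b R" "(x T, hist x T) \<in> X_space b"
      using that(2) by (auto simp: P_set_def X_space_def hist_def)
  qed
  let ?d = "\<lambda>s. norm (x s - y s)"
  have "continuous_on {T - b..T} ?d"
    by (intro continuous_intros lipschitz_on_continuous_on[OF x] lipschitz_on_continuous_on[OF y])
  then have "continuous_on {-b..0} (\<lambda>\<theta>. ?d (T + \<theta>))"
    by (rule continuous_on_compose2) (auto intro!: continuous_intros)
  then have "(\<lambda>\<theta>. ?d (T + \<theta>)) absolutely_integrable_on {-b..0}" by (rule absolutely_integrable_continuous_real)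
  then have "(LINT \<theta>:{-b..0}|lebesgue. ?d (T + \<theta>)) = integral {-b..0} (\<lambda>\<theta>. ?d (T + \<theta>))"
    by (rule set_lebesgue_integral_eq_integral(2))
  also have "\<dots> = integral {T - b..T} ?d"
    using Henstock_Kurzweil_Integration.integral_shift_Icc_real[of "-b" 0 ?d T] by (simp add: o_def)
  finally have "X_norm b (x T - y T, \<lambda>\<theta>. hist x T \<theta> - hist y T \<theta>) = norm (x T - y T) + integral {T - b..T} ?d"
    by (simp add: X_norm_def hist_def)
  moreover have "\<bar>g (x T, hist x T) - g (y T, hist y T)\<bar> \<le> l * X_norm b (x T - y T, \<lambda>\<theta>. hist x T \<theta> - hist y T \<theta>)"
    using g hist[OF x R(1)] hist[OF y R(2)] by fastforce
  ultimately show ?thesis by simp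
qed

theorem lemma6p2:
  fixes t0 T taubar :: real
    and A :: "(real ^ 'm) set"
    and f :: "real \<Rightarrow> real ^ 'n \<Rightarrow> real ^ 'n \<Rightarrow> real ^ 'm \<Rightarrow> real ^ 'n"
    and L :: "real \<Rightarrow> real ^ 'n \<Rightarrow> real ^ 'n \<Rightarrow> real ^ 'm \<Rightarrow> real"
    and g :: "(real ^ 'n) \<times> (real \<Rightarrow> real ^ 'n) \<Rightarrow> real"
    and tau :: "real \<Rightarrow> real ^ 'n \<Rightarrow> real"
    and tau_t :: "real \<Rightarrow> real ^ 'n \<Rightarrow> real"
    and tau_z :: "real \<Rightarrow> real ^ 'n \<Rightarrow> real ^ 'n"
    and Ha :: "real \<Rightarrow> real ^ 'n \<Rightarrow> real ^ 'n \<Rightarrow> real ^ 'n \<Rightarrow> real ^ 'm \<Rightarrow> real ^ 'm"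
  assumes t0_less_T: "t0 < T"
    and A: "A \<noteq> {}" "convex A" "compact A"
    and f_cont: "continuous_on ({t0..T} \<times> UNIV \<times> UNIV \<times> A) (\<lambda>(t, z, y, a). f t z y a)"
    and L_cont: "continuous_on ({t0..T} \<times> UNIV \<times> UNIV \<times> A) (\<lambda>(t, z, y, a). L t z y a)"
    and f_lip: "\<exists>lam_f>0. \<forall>t\<in>{t0..T}. \<forall>a\<in>A. \<forall>z y z' y'.
      norm (f t z y a - f t z' y' a) \<le> lam_f * (norm (z - z') + norm (y - y'))"
    and epi_convex: "\<forall>t\<in>{t0..T}. \<forall>z y. convex {(f t z y a, l) |a l. a \<in> A \<and> L t z y a \<le> l}"
    and L_lip: "\<forall>R>0. \<exists>lam_L>0. \<forall>t\<in>{t0..T}. \<forall>a\<in>A.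
      \<forall>z\<in>cball 0 R. \<forall>y\<in>cball 0 R. \<forall>z'\<in>cball 0 R. \<forall>y'\<in>cball 0 R.
        \<bar>L t z y a - L t z' y' a\<bar> \<le> lam_L * (norm (z - z') + norm (y - y'))"
    and L_growth: "\<exists>CL>0. \<forall>t\<in>{t0..T}. \<forall>a\<in>A. \<forall>z y. \<bar>L t z y a\<bar> \<le> CL * (1 + norm z + norm y)"
    and g_lip: "\<forall>R>0. \<exists>lam_g>0. \<forall>(z1, w1)\<in>X_space taubar. \<forall>(z2, w2)\<in>X_space taubar.
      w1 \<in> P_set taubar R \<longrightarrow> w2 \<in> P_set taubar R \<longrightarrow>
        \<bar>g (z1, w1) - g (z2, w2)\<bar> \<le> lam_g * X_norm taubar (z1 - z2, \<lambda>\<theta>. w1 \<theta> - w2 \<theta>)"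
    and tau_nonneg: "\<forall>t\<in>{t0..T}. \<forall>z. 0 \<le> tau t z"
    and tau_C1: "C1_on ({t0..T} \<times> UNIV) (\<lambda>(t, z). tau t z)"
    and tau_t: "\<forall>t\<in>{t0..T}. \<forall>z.
      ((\<lambda>s. tau s z) has_real_derivative tau_t t z) (at t within {t0..T})"
    and tau_z: "\<forall>t\<in>{t0..T}. \<forall>z. GDERIV (tau t) z :> tau_z t z"
    and tau_bdd: "bdd_above ((\<lambda>(t, z). tau t z) ` ({t0..T} \<times> UNIV))"
    and taubar: "taubar = (SUP (t, z)\<in>{t0..T} \<times> UNIV. tau t z)"
    and tau_lip: "\<exists>lam_tau>0. \<forall>t\<in>{t0..T}. \<forall>z y. \<bar>tau t z - tau t y\<bar> \<le> lam_tau * norm (z - y)"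
    and monotone_delay: "\<forall>r>0. \<exists>d>0. \<forall>t\<in>{t0..<T}. \<forall>w\<in>P_set taubar r. \<forall>\<alpha>\<in>controls A t T.
      let x = traj T taubar f tau t w \<alpha> in
        AE s in lebesgue_on {t..T}.
          1 - tau_t s (x s) - tau_z s (x s) \<bullet> vector_derivative x (at s) \<ge> d"
    and S1_f: "C1_on ({t0..T} \<times> UNIV \<times> UNIV \<times> A) (\<lambda>(t, z, y, a). f t z y a)"
    and S1_L: "C1_on ({t0..T} \<times> UNIV \<times> UNIV \<times> A) (\<lambda>(t, z, y, a). L t z y a)"
    and Ha: "is_control_gradient {t0..T} A (hamiltonian f L) Ha"
    and S2_mono: "\<exists>\<mu>>0. \<forall>t\<in>{t0..T}. \<forall>z y p. \<forall>a1\<in>A. \<forall>a2\<in>A.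
      (Ha t z y p a1 - Ha t z y p a2) \<bullet> (a1 - a2) \<ge> \<mu> * (norm (a1 - a2))\<^sup>2"
    and S2_lip: "\<exists>lam_H>0. \<forall>t1\<in>{t0..T}. \<forall>t2\<in>{t0..T}. \<forall>z1 z2 y1 y2 p1 p2. \<forall>a\<in>A.
      norm (Ha t1 z1 y1 p1 a - Ha t2 z2 y2 p2 a)
        \<le> lam_H * (\<bar>t1 - t2\<bar> + norm (z1 - z2) + norm (y1 - y2) + norm (p1 - p2))"
    and S3_f: "\<forall>r>0. \<exists>\<gamma>f>0. \<forall>t\<in>{t0..T}. \<forall>a\<in>A.
      \<forall>z1\<in>cball 0 r. \<forall>z2\<in>cball 0 r. \<forall>y1\<in>cball 0 r. \<forall>y2\<in>cball 0 r.
        norm (f t z1 y1 a + f t z2 y2 a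
              - 2 *\<^sub>R f t ((1/2) *\<^sub>R (z1 + z2)) ((1/2) *\<^sub>R (y1 + y2)) a)
          \<le> \<gamma>f * ((norm (z1 - z2))\<^sup>2 + (norm (y1 - y2))\<^sup>2)"
    and S3_L: "\<forall>r>0. \<exists>\<gamma>L>0. \<forall>t\<in>{t0..T}. \<forall>a\<in>A.
      \<forall>z1\<in>cball 0 r. \<forall>z2\<in>cball 0 r. \<forall>y1\<in>cball 0 r. \<forall>y2\<in>cball 0 r.
        \<bar>L t z1 y1 a + L t z2 y2 a
              - 2 * L t ((1/2) *\<^sub>R (z1 + z2)) ((1/2) *\<^sub>R (y1 + y2)) a\<bar>
          \<le> \<gamma>L * ((norm (z1 - z2))\<^sup>2 + (norm (y1 - y2))\<^sup>2)"
    and S4: "\<forall>r>0. \<exists>\<gamma>\<tau>>0. \<forall>t\<in>{t0..T}. \<forall>z1\<in>cball 0 r. \<forall>z2\<in>cball 0 r.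
        \<bar>tau t z1 + tau t z2 - 2 * tau t ((1/2) *\<^sub>R (z1 + z2))\<bar> \<le> \<gamma>\<tau> * (norm (z1 - z2))\<^sup>2"
    and S5_diff: "\<forall>(t, w)\<in>G_set t0 T taubar. t < T \<longrightarrow> (\<forall>\<alpha>\<in>controls A t T.
      \<exists>gz gw. has_X_gradient taubar g (end_state T taubar f tau t w \<alpha>) gz gw)"
    and S5_bound: "\<forall>r>0. \<exists>\<gamma>g>0. \<forall>t\<in>{t0..<T}. \<forall>w\<in>V_set taubar r. \<forall>\<alpha>\<in>controls A t T.
      \<forall>gz gw. has_X_gradient taubar g (end_state T taubar f tau t w \<alpha>) gz gw \<longrightarrow>
        (AE \<theta> in lebesgue_on {-taubar..0}. norm (gw \<theta>) \<le> \<gamma>g)"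
  shows "(\<forall>(t, w)\<in>G_set t0 T taubar. t < T \<longrightarrow>
            (\<exists>\<alpha>. optimal_control T taubar A f L g tau t w \<alpha>) \<and>
            (\<forall>\<alpha>. optimal_control T taubar A f L g tau t w \<alpha> \<longrightarrow>
               (\<exists>\<beta>. lipschitz_representative A t T \<alpha> \<beta>)))
       \<and> (\<forall>r>0. \<exists>C>0. \<forall>t\<in>{t0..<T}. \<forall>w\<in>V_set taubar r.
            \<forall>\<alpha> \<beta>. optimal_control T taubar A f L g tau t w \<alpha> \<longrightarrow>
              lipschitz_representative A t T \<alpha> \<beta> \<longrightarrow> C-lipschitz_on {t<..<T} \<beta>)"
proof -
  obtain lf where lf: "0 < lf" "\<forall>t\<in>{t0..T}. \<forall>a\<in>A. \<forall>z y z' y'.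
      norm (f t z y a - f t z' y' a) \<le> lf * (norm (z - z') + norm (y - y'))"
    using f_lip by blast
  obtain lt where lt: "0 < lt" "\<forall>t\<in>{t0..T}. \<forall>z y. \<bar>tau t z - tau t y\<bar> \<le> lt * norm (z - y)"
    using tau_lip by blast
  obtain \<mu> where \<mu>: "0 < \<mu>" "\<forall>t\<in>{t0..T}. \<forall>z y p. \<forall>a1\<in>A. \<forall>a2\<in>A.
      (Ha t z y p a1 - Ha t z y p a2) \<bullet> (a1 - a2) \<ge> \<mu> * (norm (a1 - a2))\<^sup>2"
    using S2_mono by blast
  obtain lam where lam: "0 < lam" "\<forall>t1\<in>{t0..T}. \<forall>t2\<in>{t0..T}. \<forall>z1 z2 y1 y2 p1 p2. \<forall>a\<in>A.
      norm (Ha t1 z1 y1 p1 a - Ha t2 z2 y2 p2 a)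
        \<le> lam * (\<bar>t1 - t2\<bar> + norm (z1 - z2) + norm (y1 - y2) + norm (p1 - p2))"
    using S2_lip by blast
  interpret H: convex_hamiltonian "{t0..T}" A f L Ha \<mu> lam
    by unfold_locales (use A(2) Ha \<mu> lam in auto)
  obtain lL where lL: "\<forall>R>0. 0 < lL R \<and> (\<forall>t\<in>{t0..T}. \<forall>a\<in>A.
      \<forall>z\<in>cball 0 R. \<forall>y\<in>cball 0 R. \<forall>z'\<in>cball 0 R. \<forall>y'\<in>cball 0 R.
        \<bar>L t z y a - L t z' y' a\<bar> \<le> lL R * (norm (z - z') + norm (y - y')))"
    using pos_choice[OF L_lip] by (elim exE)
  obtain lg where lg: "\<forall>R>0. 0 < lg R \<and> (\<forall>(z1, w1)\<in>X_space taubar. \<forall>(z2, w2)\<in>X_space taubar.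
      w1 \<in> P_set taubar R \<longrightarrow> w2 \<in> P_set taubar R \<longrightarrow>
        \<bar>g (z1, w1) - g (z2, w2)\<bar> \<le> lg R * X_norm taubar (z1 - z2, \<lambda>\<theta>. w1 \<theta> - w2 \<theta>))"
    using pos_choice[OF g_lip] by (elim exE)
  obtain dd where dd: "\<forall>r>0. 0 < dd r \<and> (\<forall>t\<in>{t0..<T}. \<forall>w\<in>P_set taubar r. \<forall>\<alpha>\<in>controls A t T.
      let x = traj T taubar f tau t w \<alpha> in
        AE s in lebesgue_on {t..T}.
          1 - tau_t s (x s) - tau_z s (x s) \<bullet> vector_derivative x (at s) \<ge> dd r)"
    using pos_choice[OF monotone_delay] by (elim exE)
  have "\<forall>R>0. \<exists>k>0. \<forall>s\<in>{t0..T}. \<forall>s'\<in>{t0..T}. \<forall>z. norm z \<le> R \<longrightarrow> \<bar>tau s z - tau s' z\<bar> \<le> k * \<bar>s - s'\<bar>"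
    using C1_on_time_lipschitz[OF tau_C1] by blast
  from pos_choice[OF this] obtain kt where kt: "\<forall>R>0. 0 < kt R \<and> (\<forall>s\<in>{t0..T}. \<forall>s'\<in>{t0..T}. \<forall>z. norm z \<le> R \<longrightarrow>
      \<bar>tau s z - tau s' z\<bar> \<le> kt R * \<bar>s - s'\<bar>)"
    by (elim exE)

  obtain a0 where a0: "a0 \<in> A" using A(1) by blast
  have t0: "t0 \<in> {t0..T}" using t0_less_T by simp
  \<comment> \<open>The control \<open>a0\<close> and the point \<open>(t0, 0, 0)\<close> are mere
    references: the increment of \<open>f\<close> in the control is the same at every point, so
    \<open>G\<close> can be read off at one of them.\<close>
  define F where "F t z y = f t z y a0" for t z y
  define G where "G a = f t0 0 0 a - f t0 0 0 a0" for a
  have f_eq: "f t z y a = F t z y + G a" if "t \<in> {t0..T}" "a \<in> A" for t z y a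
    using H.f_increment_eq[OF that(1) t0 a0 that(2), of z y 0 0] by (simp add: F_def G_def algebra_simps)
  have G_lip: "norm (G a - G a') \<le> lam * norm (a - a')" if "a \<in> A" "a' \<in> A" for a a'
    using H.f_lip_control[OF t0 that(2,1), of 0 0] by (simp add: G_def)
  have G_mid: "G ((1/2) *\<^sub>R (a + a')) = (1/2) *\<^sub>R (G a + G a')" if "a \<in> A" "a' \<in> A" for a a'
    using H.f_midpoint[OF t0 that, of 0 0] by (simp add: G_def vec_eq_iff field_simps)
  have "lam-lipschitz_on A G" using G_lip lam(1) by (intro lipschitz_onI) (auto simp: dist_norm)
  then have G_cont: "continuous_on A G" by (rule lipschitz_on_continuous_on)
  obtain cu where cu: "\<And>a. a \<in> A \<Longrightarrow> norm (G a) \<le> cu"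
    using compact_imp_bounded[OF compact_continuous_image[OF G_cont A(3)]] unfolding bounded_iff by blast
  have "continuous_on ({t0..T} \<times> UNIV \<times> UNIV) (\<lambda>v. (\<lambda>(t, z, y, a). f t z y a) (fst v, fst (snd v), snd (snd v), a0))"
    by (rule continuous_on_compose2[OF f_cont]) (use a0 in \<open>auto intro!: continuous_intros\<close>)
  then have F_cont: "continuous_on ({t0..T} \<times> UNIV \<times> UNIV) (\<lambda>(t, z, y). F t z y)"
    by (simp add: F_def case_prod_unfold)
  have "continuous_on {t0..T} (\<lambda>t. (\<lambda>(t, z, y). F t z y) (t, 0, 0))"
    by (rule continuous_on_compose2[OF F_cont]) (auto intro!: continuous_intros)
  from compact_imp_bounded[OF compact_continuous_image[OF this compact_Icc]]
  obtain cF where "\<forall>v\<in>(\<lambda>t. (\<lambda>(t, z, y). F t z y) (t, 0, 0)) ` {t0..T}. norm v \<le> cF"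
    unfolding bounded_iff by blast
  then have cF: "norm (F t 0 0) \<le> cF" if "t \<in> {t0..T}" for t using that by simp
  have tau_le: "tau t z \<le> taubar" if "t \<in> {t0..T}" for t z
    using cSUP_upper[OF _ tau_bdd, of "(t, z)"] that by (simp add: taubar)
  have tau_cont: "continuous_on ({t0..T} \<times> UNIV) (\<lambda>(t, z). tau t z)"
    using tau_C1 unfolding C1_on_def by (elim exE conjE) (rule has_derivative_continuous_on, rule bspec)

  interpret D: delay_trajectories t0 T taubar lf cF lt F tau A G cu f
  proof unfold_locales
    show "norm (F t z y - F t z' y') \<le> lf * (norm (z - z') + norm (y - y'))" if "t \<in> {t0..T}" for t z y z' y'
      using lf(2) a0 that by (simp add: F_def)
  qed (use t0_less_T F_cont lf(1) cF tau_nonneg tau_le tau_cont lt A(1) G_cont cu f_eq in simp_all)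

  \<comment> \<open>The constant \<open>lam\<close> serves twice, for the Lipschitz bound of
    \<open>G\<close> and for the mixed differences of \<open>L\<close>.\<close>
  have prob: "delay_problem t0 T taubar lf cF lt F tau A G L g cu lam \<mu> lam lL lg kt dd R Kw f"
    if "0 < R" "0 \<le> Kw" for R Kw
  proof unfold_locales
    show "(1/2) *\<^sub>R (a + a') \<in> A" if "a \<in> A" "a' \<in> A" for a a'
      using H.seg_mem[OF that, of "1/2"] by (simp add: H.seg_mid)
    show "L s z y ((1/2) *\<^sub>R (a + a')) \<le> (L s z y a + L s z y a') / 2 - \<mu> / 8 * (norm (a - a'))\<^sup>2"
      if "s \<in> {t0..T}" "a \<in> A" "a' \<in> A" for s z y a a'
      by (rule H.L_strongly_convex[OF that])
    show "\<bar>(L s z y a - L s z y a') - (L s' z' y' a - L s' z' y' a')\<bar>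
        \<le> lam * (\<bar>s - s'\<bar> + norm (z - z') + norm (y - y')) * norm (a - a')"
      if "s \<in> {t0..T}" "s' \<in> {t0..T}" "a \<in> A" "a' \<in> A" for s s' z z' y y' a a'
      by (rule H.L_mixed[OF that(1,2,4,3)])
    show "\<bar>L s z y a - L s z' y' a\<bar> \<le> lL R * (norm (z - z') + norm (y - y'))"
      if "0 < R" "s \<in> {t0..T}" "a \<in> A" "norm z \<le> R" "norm y \<le> R" "norm z' \<le> R" "norm y' \<le> R" for R s a z y z' y'
      using lL that by simp
    show "\<bar>g (x T, hist x T) - g (x' T, hist x' T)\<bar>
        \<le> lg R * (norm (x T - x' T) + integral {T - taubar..T} (\<lambda>s. norm (x s - x' s)))"
      if "0 < R" "K-lipschitz_on {T - taubar..T} x" "K-lipschitz_on {T - taubar..T} x'"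
        "\<And>s. s \<in> {T - taubar..T} \<Longrightarrow> norm (x s) \<le> R" "\<And>s. s \<in> {T - taubar..T} \<Longrightarrow> norm (x' s) \<le> R" for R K x x'
      by (rule terminal_cost_lipschitz[OF D.b_nonneg that(2-5) lg[rule_format, OF that(1), THEN conjunct2]])
    show "\<bar>tau s z - tau s' z\<bar> \<le> kt R * \<bar>s - s'\<bar>"
      if "0 < R" "s \<in> {t0..T}" "s' \<in> {t0..T}" "norm z \<le> R" for R s s' z
      using kt that by simp
    show "dd R * (q - p) \<le> D.delayed x q - D.delayed x p"
      if R: "0 < R" and t: "t \<in> {t0..<T}" and w: "K-lipschitz_on {-taubar..0} w"
        "\<And>\<theta>. \<theta> \<in> {-taubar..0} \<Longrightarrow> norm (w \<theta>) \<le> R"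
        and \<alpha>: "\<alpha> \<in> borel_measurable lebesgue" "range \<alpha> \<subseteq> A" and x: "D.sol t w (\<lambda>s. G (\<alpha> s)) x"
        and pq: "t \<le> p" "p \<le> q" "q \<le> T" for R t K w \<alpha> x p q
    proof -
      have wl: "w \<in> lip_space taubar" using w(1) by (auto simp: lip_space_def)
      then have "w \<in> P_set taubar R" using w(2) by (simp add: P_set_def)
      then have "let x = traj T taubar f tau t w \<alpha> in AE s in lebesgue_on {t..T}.
          1 - tau_t s (x s) - tau_z s (x s) \<bullet> vector_derivative x (at s) \<ge> dd R"
        using dd R t D.controls_of_total[OF \<alpha>] by blast
      from D.delayed_expanding_of_monotone_delay[OF tau_C1 tau_t tau_z t wl \<alpha> x this pq] show ?thesis .
    qed
  qed (use A lam \<mu> G_lip G_mid cu L_cont lL lg kt dd f_eq that in auto)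

  have ex: "\<exists>\<alpha>. optimal_control T taubar A f L g tau t w \<alpha>"
    and rep: "\<And>\<alpha>. optimal_control T taubar A f L g tau t w \<alpha> \<Longrightarrow> \<exists>\<beta>. lipschitz_representative A t T \<alpha> \<beta>"
    if tw: "(t, w) \<in> G_set t0 T taubar" "t < T" for t w
  proof -
    obtain K where K: "K-lipschitz_on {-taubar..0} w" using tw by (auto simp: G_set_def lip_space_def)
    obtain R where R: "\<And>\<theta>. \<theta> \<in> {-taubar..0} \<Longrightarrow> norm (w \<theta>) \<le> R"
      using compact_imp_bounded[OF compact_continuous_image[OF lipschitz_on_continuous_on[OF K] compact_Icc]]
      unfolding bounded_iff by blast
    \<comment> \<open>The radius must be positive, hence \<open>\<bar>R\<bar> + 1\<close>. It may
      depend on \<open>w\<close> here, since no uniform constant is claimed.\<close>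
    interpret P: delay_problem t0 T taubar lf cF lt F tau A G L g cu lam \<mu> lam lL lg kt dd "\<bar>R\<bar> + 1" K f
      by (rule prob) (use lipschitz_on_nonneg[OF K] in auto)
    have init: "P.init t w"
      using tw K R by (force simp: P.init_def G_set_def)
    show "\<exists>\<alpha>. optimal_control T taubar A f L g tau t w \<alpha>"
      by (rule P.optimal_control_exists[OF init])
    show "\<exists>\<beta>. lipschitz_representative A t T \<alpha> \<beta>" if "optimal_control T taubar A f L g tau t w \<alpha>" for \<alpha>
      by (rule P.optimal_control_representative[OF init that])
  qed
  have unif: "\<exists>C>0. \<forall>t\<in>{t0..<T}. \<forall>w\<in>V_set taubar r. \<forall>\<alpha> \<beta>. optimal_control T taubar A f L g tau t w \<alpha> \<longrightarrow>
      lipschitz_representative A t T \<alpha> \<beta> \<longrightarrow> C-lipschitz_on {t<..<T} \<beta>" if r: "0 < r" for r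
  proof -
    \<comment> \<open>With \<open>r\<close> as radius and as Lipschitz constant,
      \<open>P.reg_const\<close> depends on neither \<open>t\<close> nor \<open>w\<close>.\<close>
    interpret P: delay_problem t0 T taubar lf cF lt F tau A G L g cu lam \<mu> lam lL lg kt dd r r f
      by (rule prob) (use r in auto)
    have "P.reg_const-lipschitz_on {t<..<T} \<beta>"
      if t: "t \<in> {t0..<T}" and w: "w \<in> V_set taubar r" and opt: "optimal_control T taubar A f L g tau t w \<alpha>"
        and rep: "lipschitz_representative A t T \<alpha> \<beta>" for t w \<alpha> \<beta>
    proof -
      have "P.init t w"
        unfolding P.init_def using t V_set_lipschitz[OF w less_imp_le[OF r]] by blast
      from P.representative_lipschitz[OF this opt rep] show ?thesis .
    qed
    then show ?thesis using P.reg_const_pos by (intro exI[of _ P.reg_const]) blast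
  qed
  show ?thesis using ex rep unif by blast
qed

end
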